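(* Let $G$ be a locally compact group and $1<p<\infty$. Consider the following assertions. (i) $L_p^{T}(G)$ is a Banach algebra under the norm $\|\cdot\|_p^T$ and the convolution product. (ii) There exists a positive constant $K$ such that $|||f|||_p^T\leq K\|f\|_p^T$ for each $f\in L_p^{T}(G)$. (iii) The norms $\|\cdot\|_p^T$ and $|||\cdot|||^T_p$ are equivalent on $L_p^T(G)$. (iv) There exists a positive constant $K$ such that $\|f\|_p\leq K\|f\|_p^T$ for each $f\in L_p^{T}(G)$. (v) $G$ is discrete. Then (v)$\Rightarrow$(iv), (iv)$\Rightarrow$(iii), and (iii)$\Rightarrow$(ii). If moreover $G$ is unimodular and $1<p\leq 2$, then all five assertions are equivalent.
   Context: $\lambda$ is a fixed left Haar measure on $G$, and $L^p(G)$ is taken with respect to $\lambda$. For measurable $f,g$ the convolution is $f*g(x)=\int_G f(y)g(y^{-1}x)\,d\lambda(y)$; $f*g$ is said to exist if the integrand is $\lambda$-integrable in $y$ for almost all $x\in G$. For $1<p<\infty$, $L_p^T(G)$ is the set of all $f\in L^p(G)$ such that $g*f$ exists for all $g\in L^p(G)$ and $\|f\|_p^T=\sup\{\|g*f\|_p: g\in L^p(G),\ \|g\|_p\le 1\}<\infty$. A second norm on $L_p^T(G)$ is $|||f|||_p^T=\|f\|_p+\|f\|_p^T$. *)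

theory Defs
  imports "HOL-Analysis.Analysis"
begin

text \<open>
  A locally compact group is a type of class \<open>topological_group_add\<close> and \<open>t2_space\<close> whose
  topology is locally compact. The class \<open>group_add\<close> is not commutative, but it is written
  additively: \<open>x + y\<close> is the group product, \<open>- x\<close> the inverse and \<open>0\<close> the identity.
\<close>

text \<open>
  A left Haar measure is a nonzero left-invariant Radon measure on the Borel sets. The group need
  not be \<open>\<sigma>\<close>-compact, so the regularity convention matters: outer regular on Borel sets, inner
  regular on open sets.
\<close>

definition left_haar_measure :: "'a::topological_group_add measure \<Rightarrow> bool" where
  "left_haar_measure M \<longleftrightarrow>
     sets M = sets borel \<and>
     emeasure M UNIV \<noteq> 0 \<and>
     (\<forall>K. compact K \<longrightarrow> emeasure M K < \<infinity>) \<and>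
     (\<forall>A\<in>sets borel. emeasure M A = (INF U\<in>{U. open U \<and> A \<subseteq> U}. emeasure M U)) \<and>
     (\<forall>U. open U \<longrightarrow> emeasure M U = (SUP K\<in>{K. compact K \<and> K \<subseteq> U}. emeasure M K)) \<and>
     (\<forall>a. \<forall>A\<in>sets borel. emeasure M ((\<lambda>x. a + x) ` A) = emeasure M A)"

text \<open>For a left Haar measure \<open>M\<close>: the group is unimodular iff \<open>M\<close> is also right-invariant.\<close>

definition unimodular :: "'a::topological_group_add measure \<Rightarrow> bool" where
  "unimodular M \<longleftrightarrow> (\<forall>a. \<forall>A\<in>sets borel. emeasure M ((\<lambda>x. x + a) ` A) = emeasure M A)"

definition Lp_enorm :: "real \<Rightarrow> 'a measure \<Rightarrow> ('a \<Rightarrow> complex) \<Rightarrow> ennreal" where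
  "Lp_enorm p M f =
     (let I = (\<integral>\<^sup>+ x. ennreal (norm (f x) powr p) \<partial>M)
      in if I = \<infinity> then \<infinity> else ennreal (enn2real I powr (1 / p)))"

definition Lp_space :: "real \<Rightarrow> 'a measure \<Rightarrow> ('a \<Rightarrow> complex) set" where
  "Lp_space p M = {f \<in> borel_measurable M. Lp_enorm p M f < \<infinity>}"

text \<open>
  Where the integrand is not integrable, the Bochner integral, hence \<open>haar_conv\<close>, is \<open>0\<close>. When the
  convolution exists this only affects a null set.
\<close>

definition haar_conv ::
  "'a::topological_group_add measure \<Rightarrow> ('a \<Rightarrow> complex) \<Rightarrow> ('a \<Rightarrow> complex) \<Rightarrow> 'a \<Rightarrow> complex" where
  "haar_conv M f g x = (LINT y|M. f y * g (- y + x))"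

definition haar_conv_exists ::
  "'a::topological_group_add measure \<Rightarrow> ('a \<Rightarrow> complex) \<Rightarrow> ('a \<Rightarrow> complex) \<Rightarrow> bool" where
  "haar_conv_exists M f g \<longleftrightarrow> (AE x in M. integrable M (\<lambda>y. f y * g (- y + x)))"

definition LpT_enorm ::
  "real \<Rightarrow> 'a::topological_group_add measure \<Rightarrow> ('a \<Rightarrow> complex) \<Rightarrow> ennreal" where
  "LpT_enorm p M f =
     (SUP g\<in>{g \<in> Lp_space p M. Lp_enorm p M g \<le> 1}. Lp_enorm p M (haar_conv M g f))"

definition LpT_space ::
  "real \<Rightarrow> 'a::topological_group_add measure \<Rightarrow> ('a \<Rightarrow> complex) set" where
  "LpT_space p M =
     {f \<in> Lp_space p M. (\<forall>g\<in>Lp_space p M. haar_conv_exists M g f) \<and> LpT_enorm p M f < \<infinity>}"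

definition Lp_norm :: "real \<Rightarrow> 'a measure \<Rightarrow> ('a \<Rightarrow> complex) \<Rightarrow> real" where
  "Lp_norm p M f = enn2real (Lp_enorm p M f)"

definition LpT_norm ::
  "real \<Rightarrow> 'a::topological_group_add measure \<Rightarrow> ('a \<Rightarrow> complex) \<Rightarrow> real" where
  "LpT_norm p M f = enn2real (LpT_enorm p M f)"

definition LpT_norm3 ::
  "real \<Rightarrow> 'a::topological_group_add measure \<Rightarrow> ('a \<Rightarrow> complex) \<Rightarrow> real" where
  "LpT_norm3 p M f = Lp_norm p M f + LpT_norm p M f"

definition equivalent_norms_on :: "'v set \<Rightarrow> ('v \<Rightarrow> real) \<Rightarrow> ('v \<Rightarrow> real) \<Rightarrow> bool" where
  "equivalent_norms_on V N1 N2 \<longleftrightarrow>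
     (\<exists>c>0. \<exists>C>0. \<forall>v\<in>V. c * N1 v \<le> N2 v \<and> N2 v \<le> C * N1 v)"

text \<open>Complex Banach algebras, not necessarily unital, on an explicit carrier.\<close>

locale complex_banach_algebra =
  fixes carr :: "'v set"
    and add :: "'v \<Rightarrow> 'v \<Rightarrow> 'v"
    and zero :: "'v"
    and smult :: "complex \<Rightarrow> 'v \<Rightarrow> 'v"
    and mult :: "'v \<Rightarrow> 'v \<Rightarrow> 'v"
    and nrm :: "'v \<Rightarrow> real"
  assumes zero_closed: "zero \<in> carr"
    and add_closed: "\<lbrakk>u \<in> carr; v \<in> carr\<rbrakk> \<Longrightarrow> add u v \<in> carr"
    and smult_closed: "u \<in> carr \<Longrightarrow> smult a u \<in> carr"
    and mult_closed: "\<lbrakk>u \<in> carr; v \<in> carr\<rbrakk> \<Longrightarrow> mult u v \<in> carr"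
    and add_assoc: "\<lbrakk>u \<in> carr; v \<in> carr; w \<in> carr\<rbrakk> \<Longrightarrow> add (add u v) w = add u (add v w)"
    and add_commute: "\<lbrakk>u \<in> carr; v \<in> carr\<rbrakk> \<Longrightarrow> add u v = add v u"
    and add_zero: "u \<in> carr \<Longrightarrow> add zero u = u"
    and add_inverse: "u \<in> carr \<Longrightarrow> add u (smult (-1) u) = zero"
    and smult_add_vec: "\<lbrakk>u \<in> carr; v \<in> carr\<rbrakk> \<Longrightarrow> smult a (add u v) = add (smult a u) (smult a v)"
    and smult_add_scalar: "u \<in> carr \<Longrightarrow> smult (a + b) u = add (smult a u) (smult b u)"
    and smult_smult: "u \<in> carr \<Longrightarrow> smult a (smult b u) = smult (a * b) u"
    and smult_one: "u \<in> carr \<Longrightarrow> smult 1 u = u"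
    and mult_assoc:
      "\<lbrakk>u \<in> carr; v \<in> carr; w \<in> carr\<rbrakk> \<Longrightarrow> mult (mult u v) w = mult u (mult v w)"
    and mult_add_left:
      "\<lbrakk>u \<in> carr; v \<in> carr; w \<in> carr\<rbrakk> \<Longrightarrow> mult (add u v) w = add (mult u w) (mult v w)"
    and mult_add_right:
      "\<lbrakk>u \<in> carr; v \<in> carr; w \<in> carr\<rbrakk> \<Longrightarrow> mult u (add v w) = add (mult u v) (mult u w)"
    and mult_smult_left: "\<lbrakk>u \<in> carr; v \<in> carr\<rbrakk> \<Longrightarrow> mult (smult a u) v = smult a (mult u v)"
    and mult_smult_right: "\<lbrakk>u \<in> carr; v \<in> carr\<rbrakk> \<Longrightarrow> mult u (smult a v) = smult a (mult u v)"
    and nrm_nonneg: "u \<in> carr \<Longrightarrow> 0 \<le> nrm u"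
    and nrm_eq_zero: "u \<in> carr \<Longrightarrow> nrm u = 0 \<longleftrightarrow> u = zero"
    and nrm_smult: "u \<in> carr \<Longrightarrow> nrm (smult a u) = cmod a * nrm u"
    and nrm_triangle: "\<lbrakk>u \<in> carr; v \<in> carr\<rbrakk> \<Longrightarrow> nrm (add u v) \<le> nrm u + nrm v"
    and nrm_mult: "\<lbrakk>u \<in> carr; v \<in> carr\<rbrakk> \<Longrightarrow> nrm (mult u v) \<le> nrm u * nrm v"
    and complete:
      "\<lbrakk>range s \<subseteq> carr;
        \<forall>e>0. \<exists>N. \<forall>m\<ge>N. \<forall>n\<ge>N. nrm (add (s m) (smult (-1) (s n))) < e\<rbrakk>
       \<Longrightarrow> \<exists>u\<in>carr. (\<lambda>n. nrm (add (s n) (smult (-1) u))) \<longlonglongrightarrow> 0"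

text \<open>
  The Banach algebra structure lives on classes of functions modulo equality almost everywhere;
  the operations are computed on representatives.
\<close>

definition ae_class :: "'a measure \<Rightarrow> ('a \<Rightarrow> complex) \<Rightarrow> ('a \<Rightarrow> complex) set" where
  "ae_class M f = {g \<in> borel_measurable M. AE x in M. g x = f x}"

definition ae_rep :: "('a \<Rightarrow> complex) set \<Rightarrow> 'a \<Rightarrow> complex" where
  "ae_rep F = (SOME f. f \<in> F)"

definition LpT_banach_algebra :: "real \<Rightarrow> 'a::topological_group_add measure \<Rightarrow> bool" where
  "LpT_banach_algebra p M \<longleftrightarrow>
     complex_banach_algebra
       (ae_class M ` LpT_space p M)
       (\<lambda>F G. ae_class M (\<lambda>x. ae_rep F x + ae_rep G x))
       (ae_class M (\<lambda>_. 0))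
       (\<lambda>a F. ae_class M (\<lambda>x. a * ae_rep F x))
       (\<lambda>F G. ae_class M (haar_conv M (ae_rep F) (ae_rep G)))
       (\<lambda>F. LpT_norm p M (ae_rep F))"

end

theory Submission
  imports Defs
begin

text \<open>
  The substance lies in \<open>(v) \<Longrightarrow> (i)\<close>, \<open>(iv) \<Longrightarrow> (v)\<close> and \<open>(i) \<Longrightarrow> (v)\<close>. For the last two, convolution
  by a nonnegative \<open>f\<close> is bounded by \<open>\<integral> f\<close> on \<open>L\<^sup>p\<close> of a unimodular group, so on a nondiscrete group a
  tall bump on a small set has a large \<open>L\<^sup>p\<close> norm and a small operator norm. This refutes (iv).
  A series of such bumps is Cauchy for the operator norm, and convolving a limit \<open>u\<close> with narrow bumps
  at the identity shows that \<open>\<parallel>u\<parallel>\<^sub>p\<close> is at least the \<open>L\<^sup>p\<close> size of every summand, which refutes (i) without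
  the open mapping theorem. On a discrete group \<open>p \<le> 2\<close> gives \<open>\<ell>\<^sup>p \<subseteq> \<ell>\<^sup>2\<close>, hence all convolutions exist
  pointwise, and associativity and completeness follow by approximation with finitely supported
  functions.

  Since \<open>G\<close> need not be second countable or \<open>\<sigma>\<close>-compact, Tonelli's theorem is only used for kernels
  \<open>k (x, y)\<close> that are continuous and properly supported; by regularity an \<open>L\<^sup>p\<close> function lives on a
  \<open>\<sigma>\<close>-compact set, on which such kernels are measurable for the product \<open>\<sigma>\<close>-algebra.
\<close>

section \<open>\<open>L\<^sup>p\<close> norms\<close>

text \<open>The bound of convolution by \<open>\<integral> f\<close> is Jensen's inequality for the
  kernel \<open>f (- y + x)\<close>, whose integrals in \<open>x\<close> and in \<open>y\<close>
  must both equal \<open>\<integral> f\<close>. The first is left invariance, the second invariance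
  under \<open>y \<mapsto> - y + x\<close>. So invariance under inversion is derived from
  unimodularity, for compactly supported functions and then, by regularity, for sets. A bump of
  height \<open>c\<close> on a set of measure \<open>m\<close> has integral about
  \<open>c * m\<close>; with this product fixed, \<open>c powr p * m\<close> grows like
  \<open>m powr (1 - p)\<close>, which is unbounded as \<open>m\<close> tends to 0 because
  \<open>1 < p\<close>. In (i) the limit \<open>u\<close> is known only through the operator norm,
  which gives no convergence almost everywhere. Hence the test with one fixed \<open>g\<close>: its
  convolutions with the partial sums tend in \<open>L\<^sup>p\<close> to that with \<open>u\<close>,
  and \<open>\<integral> g\<close> occurs in the lower bound for the former and in the upper bound
  for the latter, so it cancels. On a discrete group all points have the same positive mass, so
  \<open>L\<^sup>p\<close> bounds are pointwise bounds, and convolution with the indicator of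
  \<open>{0}\<close> is a multiple of the identity, which yields (iv).\<close>

lemma le_one_plus_powr:
  fixes t p :: real
  assumes "1 \<le> p" "0 \<le> t"
  shows "t \<le> 1 + t powr p"
proof (cases "t \<le> 1")
  case False
  then have "t powr 1 \<le> t powr p" using assms by (intro powr_mono) auto
  then show ?thesis using False by simp
qed (simp add: add_increasing2)

text \<open>For positive arguments this is \<open>powr_convex\<close>; if one argument is 0, it
  reduces to \<open>s powr p \<le> s\<close> for \<open>0 < s < 1\<close>.\<close>

lemma convex_powr_nonneg:
  fixes x y t p :: real
  assumes "1 \<le> p" "0 \<le> x" "0 \<le> y" "0 < t" "t < 1"
  shows "(t * x + (1 - t) * y) powr p \<le> t * x powr p + (1 - t) * y powr p"
proof -
  have shrink: "(s * z) powr p \<le> s * z powr p" if "0 < s" "s < 1" "0 \<le> z" for s z :: real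
  proof -
    have "s powr p \<le> s powr 1" using that assms by (intro powr_mono') auto
    then show ?thesis using that by (simp add: powr_mult mult_right_mono)
  qed
  show ?thesis
  proof (cases "x = 0 \<or> y = 0")
    case True
    then show ?thesis using assms shrink[of t x] shrink[of "1 - t" y] by auto
  next
    case False
    then show ?thesis
      using convex_onD[OF powr_convex[OF assms(1)], of "1 - t" x y] assms by auto
  qed
qed

text \<open>Young's inequality for \<open>a\<close> and \<open>s powr (p - 1)\<close>, multiplied by
  \<open>p\<close>. Geometrically, the graph of \<open>t powr p\<close> lies above its tangent at
  \<open>s\<close>.\<close>

lemma powr_tangent:
  fixes a s p :: real
  assumes "1 < p" "0 \<le> a" "0 < s"
  shows "p * s powr (p - 1) * a \<le> a powr p + (p - 1) * s powr p"
proof -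
  define q where "q = p / (p - 1)"
  have q: "1 < q" "1 / p + 1 / q = 1" using assms by (auto simp: q_def field_simps)
  have "a * s powr (p - 1) \<le> a powr p / p + (s powr (p - 1)) powr q / q"
    using assms q by (intro Youngs_inequality) auto
  also have "(s powr (p - 1)) powr q = s powr p" using assms by (simp add: powr_powr q_def)
  finally show ?thesis using assms by (simp add: q_def field_simps)
qed

section \<open>Extended \<open>L\<^sup>p\<close> norms: scaling, Minkowski's inequality, Fatou's
  lemma\<close>

lemma Lp_enorm_le_iff:
  assumes "0 < p" "0 \<le> C"
  shows "Lp_enorm p M f \<le> ennreal C \<longleftrightarrow> (\<integral>\<^sup>+ x. ennreal (norm (f x) powr p) \<partial>M) \<le> ennreal (C powr p)"
proof (cases "\<integral>\<^sup>+ x. ennreal (norm (f x) powr p) \<partial>M")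
  case top
  then show ?thesis by (simp add: Lp_enorm_def top_unique)
next
  case (real r)
  have "r powr (1/p) \<le> C \<longleftrightarrow> r \<le> C powr p"
  proof
    assume "r powr (1/p) \<le> C"
    then have "(r powr (1/p)) powr p \<le> C powr p" using assms by (intro powr_mono2) auto
    then show "r \<le> C powr p" using assms real by (simp add: powr_powr)
  next
    assume "r \<le> C powr p"
    then have "r powr (1/p) \<le> (C powr p) powr (1/p)" using assms real by (intro powr_mono2) auto
    then show "r powr (1/p) \<le> C" using assms by (simp add: powr_powr)
  qed
  then show ?thesis using real assms by (simp add: Lp_enorm_def)
qed

lemma Lp_enorm_finite_iff:
  "Lp_enorm p M f < \<infinity> \<longleftrightarrow> (\<integral>\<^sup>+ x. ennreal (norm (f x) powr p) \<partial>M) < \<infinity>"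
  by (auto simp: Lp_enorm_def Let_def less_top[symmetric])

lemma Lp_enorm_mono_AE:
  assumes "0 < p" "AE x in M. norm (f x) \<le> norm (g x)"
  shows "Lp_enorm p M f \<le> Lp_enorm p M g"
proof -
  have I: "(\<integral>\<^sup>+ x. ennreal (norm (f x) powr p) \<partial>M) \<le> (\<integral>\<^sup>+ x. ennreal (norm (g x) powr p) \<partial>M)"
    using assms by (intro nn_integral_mono_AE) (auto elim!: eventually_mono intro!: ennreal_leI powr_mono2)
  show ?thesis
  proof (cases "(\<integral>\<^sup>+ x. ennreal (norm (g x) powr p) \<partial>M) = \<infinity>")
    case False
    then have "(\<integral>\<^sup>+ x. ennreal (norm (f x) powr p) \<partial>M) \<noteq> \<infinity>" using I by (auto simp: top_unique)
    moreover have "enn2real (\<integral>\<^sup>+ x. ennreal (norm (f x) powr p) \<partial>M)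
        \<le> enn2real (\<integral>\<^sup>+ x. ennreal (norm (g x) powr p) \<partial>M)"
      using I False by (intro enn2real_mono) (auto simp: less_top)
    ultimately show ?thesis using False assms
      by (auto simp: Lp_enorm_def Let_def intro!: ennreal_leI powr_mono2)
  qed (simp add: Lp_enorm_def)
qed

lemma Lp_enorm_cong_AE:
  assumes "AE x in M. norm (f x) = norm (g x)"
  shows "Lp_enorm p M f = Lp_enorm p M g"
proof -
  have "(\<integral>\<^sup>+ x. ennreal (norm (f x) powr p) \<partial>M) = (\<integral>\<^sup>+ x. ennreal (norm (g x) powr p) \<partial>M)"
    using assms by (intro nn_integral_cong_AE) (auto elim!: eventually_mono)
  then show ?thesis by (simp add: Lp_enorm_def)
qed

lemma Lp_enorm_ennreal_cases:
  obtains (top) "Lp_enorm p M f = top" | (real) C where "0 \<le> C" "Lp_enorm p M f = ennreal C"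
  by (cases "Lp_enorm p M f") auto

lemma Lp_enorm_powr:
  assumes "0 < p" "0 \<le> C" "Lp_enorm p M f = ennreal C"
  shows "(\<integral>\<^sup>+ x. ennreal (norm (f x) powr p) \<partial>M) = ennreal (C powr p)"
proof (cases "\<integral>\<^sup>+ x. ennreal (norm (f x) powr p) \<partial>M")
  case top
  then show ?thesis using assms by (simp add: Lp_enorm_def)
next
  case (real r)
  then have "C = r powr (1/p)" using assms by (simp add: Lp_enorm_def)
  then show ?thesis using real assms by (simp add: powr_powr)
qed

lemma Lp_enorm_zero: "Lp_enorm p M (\<lambda>_. 0) = 0"
  by (simp add: Lp_enorm_def)

lemma Lp_enorm_cmult_le:
  assumes "0 < p" "f \<in> borel_measurable M"
  shows "Lp_enorm p M (\<lambda>x. a * f x) \<le> ennreal (norm a) * Lp_enorm p M f"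
proof (cases "a = 0")
  case True
  then show ?thesis by (simp add: Lp_enorm_zero)
next
  case False
  show ?thesis
  proof (cases p M f rule: Lp_enorm_ennreal_cases)
    case top
    then show ?thesis using False by (simp add: ennreal_mult_top)
  next
    case (real C)
    have "(\<integral>\<^sup>+ x. ennreal (norm (a * f x) powr p) \<partial>M)
        = (\<integral>\<^sup>+ x. ennreal (norm a powr p) * ennreal (norm (f x) powr p) \<partial>M)"
      by (simp add: norm_mult powr_mult ennreal_mult)
    also have "\<dots> = ennreal (norm a powr p) * (\<integral>\<^sup>+ x. ennreal (norm (f x) powr p) \<partial>M)"
      using assms by (intro nn_integral_cmult) measurable
    also have "\<dots> = ennreal ((norm a * C) powr p)"
      using assms real by (simp add: Lp_enorm_powr powr_mult ennreal_mult)
    finally have "Lp_enorm p M (\<lambda>x. a * f x) \<le> ennreal (norm a * C)"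
      using assms real by (subst Lp_enorm_le_iff) auto
    then show ?thesis using real by (simp add: ennreal_mult)
  qed
qed

text \<open>The reverse inequality is \<open>Lp_enorm_cmult_le\<close> for the function
  \<open>a * f x\<close> and the factor \<open>inverse a\<close>.\<close>

lemma Lp_enorm_cmult:
  assumes "0 < p" "f \<in> borel_measurable M"
  shows "Lp_enorm p M (\<lambda>x. a * f x) = ennreal (norm a) * Lp_enorm p M f"
proof (cases "a = 0")
  case True
  then show ?thesis by (simp add: Lp_enorm_zero)
next
  case False
  have "ennreal (norm a) * Lp_enorm p M f
      = ennreal (norm a) * Lp_enorm p M (\<lambda>x. inverse a * (a * f x))"
    using False by (intro arg_cong2[where f="(*)"] refl
      arg_cong[where f="Lp_enorm p M"] ext) simp
  also have "\<dots> \<le> ennreal (norm a) * (ennreal (norm (inverse a)) * Lp_enorm p M (\<lambda>x. a * f x))"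
    using assms by (intro mult_left_mono Lp_enorm_cmult_le) auto
  also have "\<dots> = Lp_enorm p M (\<lambda>x. a * f x)"
    using False by (simp add: mult.assoc[symmetric] ennreal_mult[symmetric] norm_inverse)
  finally show ?thesis using Lp_enorm_cmult_le[OF assms, of a] by simp
qed

text \<open>\<open>f + g\<close> is a convex combination of \<open>f\<close> and \<open>g\<close> scaled to the \<open>L\<^sup>p\<close> sphere of radius
  \<open>a + b\<close>, and \<open>t \<mapsto> t powr p\<close> is convex.\<close>

lemma Lp_enorm_triangle_le:
  assumes "1 \<le> p" "f \<in> borel_measurable M" "g \<in> borel_measurable M"
    and "0 < a" "0 < b" "Lp_enorm p M f \<le> ennreal a" "Lp_enorm p M g \<le> ennreal b"
  shows "Lp_enorm p M (\<lambda>x. f x + g x) \<le> ennreal (a + b)"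
proof -
  define t where "t = a / (a + b)"
  have t: "0 < t" "t < 1" "1 - t = b / (a + b)" using assms by (auto simp: t_def field_simps)
  \<comment> \<open>With these weights \<open>A * a powr p + B * b powr p\<close> is exactly
    \<open>(a + b) powr p\<close>.\<close>
  define A B where "A = t * ((a + b) / a) powr p" and "B = (1 - t) * ((a + b) / b) powr p"
  have AB: "0 \<le> A" "0 \<le> B" using t(1,2) unfolding A_def B_def by (auto intro!: mult_nonneg_nonneg)
  have pt: "norm (f x + g x) powr p \<le> A * norm (f x) powr p + B * norm (g x) powr p" for x
  proof -
    have "norm (f x + g x) powr p \<le> (norm (f x) + norm (g x)) powr p"
      using assms by (intro powr_mono2 norm_triangle_ineq) auto
    also have "norm (f x) + norm (g x)
        = t * ((a + b) / a * norm (f x)) + (1 - t) * ((a + b) / b * norm (g x))"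
      using assms unfolding t(3) by (simp add: t_def)
    also have "\<dots> powr p \<le> t * ((a + b) / a * norm (f x)) powr p
        + (1 - t) * ((a + b) / b * norm (g x)) powr p"
      using assms t by (intro convex_powr_nonneg) auto
    also have "\<dots> = A * norm (f x) powr p + B * norm (g x) powr p"
      unfolding A_def B_def by (simp only: powr_mult mult.assoc)
    finally show ?thesis .
  qed
  have "(\<integral>\<^sup>+ x. ennreal (norm (f x + g x) powr p) \<partial>M)
      \<le> (\<integral>\<^sup>+ x. ennreal A * ennreal (norm (f x) powr p) + ennreal B * ennreal (norm (g x) powr p) \<partial>M)"
    using pt AB by (intro nn_integral_mono)
      (simp add: ennreal_mult[symmetric] ennreal_plus[symmetric] del: ennreal_plus)
  also have "\<dots> = ennreal A * (\<integral>\<^sup>+ x. ennreal (norm (f x) powr p) \<partial>M)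
      + ennreal B * (\<integral>\<^sup>+ x. ennreal (norm (g x) powr p) \<partial>M)"
    using assms by (subst nn_integral_add) (auto simp: nn_integral_cmult)
  also have "\<dots> \<le> ennreal A * ennreal (a powr p) + ennreal B * ennreal (b powr p)"
    using assms by (intro add_mono mult_left_mono) (auto simp: Lp_enorm_le_iff)
  also have "\<dots> = ennreal (A * a powr p + B * b powr p)"
    using AB by (simp add: ennreal_mult)
  also have "A * a powr p + B * b powr p = (a + b) powr p"
  proof -
    have "((a + b) / a) powr p * a powr p = (a + b) powr p" "((a + b) / b) powr p * b powr p = (a + b) powr p"
      using assms by (auto simp: powr_divide)
    then have "A * a powr p + B * b powr p = t * (a + b) powr p + (1 - t) * (a + b) powr p"
      by (simp only: A_def B_def mult.assoc)
    then show ?thesis by (simp add: left_diff_distrib)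
  qed
  finally show ?thesis using assms by (subst Lp_enorm_le_iff) auto
qed

lemma Lp_enorm_triangle:
  assumes "1 \<le> p" "f \<in> borel_measurable M" "g \<in> borel_measurable M"
  shows "Lp_enorm p M (\<lambda>x. f x + g x) \<le> Lp_enorm p M f + Lp_enorm p M g"
proof (cases p M f rule: Lp_enorm_ennreal_cases)
  case (real a)
  note a = real
  show ?thesis
  proof (cases p M g rule: Lp_enorm_ennreal_cases)
    case (real b)
    \<comment> \<open>\<open>Lp_enorm_triangle_le\<close> wants positive radii, so each of
      \<open>a\<close> and \<open>b\<close> is enlarged by \<open>e/2\<close>.\<close>
    have "Lp_enorm p M (\<lambda>x. f x + g x) \<le> ennreal (a + b) + ennreal e" if "0 < e" for e
    proof -
      have "Lp_enorm p M (\<lambda>x. f x + g x) \<le> ennreal ((a + e/2) + (b + e/2))"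
        using assms a real that by (intro Lp_enorm_triangle_le) (auto simp: ennreal_leI)
      moreover have "(a + e/2) + (b + e/2) = (a + b) + e" by simp
      moreover have "ennreal (a + b + e) = ennreal (a + b) + ennreal e"
        using a real that by (intro ennreal_plus) auto
      ultimately show ?thesis by simp
    qed
    then have "Lp_enorm p M (\<lambda>x. f x + g x) \<le> ennreal (a + b)"
      by (rule ennreal_le_epsilon)
    then show ?thesis using a real by simp
  qed simp
qed simp

text \<open>Norm bounds survive pointwise limits without any convergence in norm. This serves for
  truncations and for limits of Cauchy sequences; in the latter only late terms are bounded, hence
  the bound is required only eventually.\<close>

lemma Lp_enorm_Fatou:
  assumes "0 < p" "0 \<le> C" "\<And>n. f n \<in> borel_measurable M"
    and lim: "AE x in M. (\<lambda>n. f n x) \<longlonglongrightarrow> g x"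
    and le: "\<forall>\<^sub>F n in sequentially. Lp_enorm p M (f n) \<le> ennreal C"
  shows "Lp_enorm p M g \<le> ennreal C"
proof -
  have "(\<integral>\<^sup>+ x. ennreal (norm (g x) powr p) \<partial>M)
      = (\<integral>\<^sup>+ x. liminf (\<lambda>n. ennreal (norm (f n x) powr p)) \<partial>M)"
  proof (rule nn_integral_cong_AE, use lim in eventually_elim)
    fix x assume "(\<lambda>n. f n x) \<longlonglongrightarrow> g x"
    then have "(\<lambda>n. ennreal (norm (f n x) powr p)) \<longlonglongrightarrow> ennreal (norm (g x) powr p)"
      using assms by (intro tendsto_ennrealI tendsto_powr2 tendsto_norm) auto
    then show "ennreal (norm (g x) powr p) = liminf (\<lambda>n. ennreal (norm (f n x) powr p))"
      by (rule lim_imp_Liminf[OF sequentially_bot, symmetric])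
  qed
  also have "\<dots> \<le> liminf (\<lambda>n. \<integral>\<^sup>+ x. ennreal (norm (f n x) powr p) \<partial>M)"
    using assms by (intro nn_integral_liminf) measurable
  also have "\<dots> \<le> liminf (\<lambda>n. ennreal (C powr p))"
    using le assms by (intro Liminf_mono) (auto elim!: eventually_mono simp: Lp_enorm_le_iff)
  also have "\<dots> = ennreal (C powr p)" by (simp add: Liminf_const)
  finally show ?thesis using assms by (simp add: Lp_enorm_le_iff)
qed

lemma Lp_spaceI:
  "f \<in> borel_measurable M \<Longrightarrow> Lp_enorm p M f < \<infinity> \<Longrightarrow> f \<in> Lp_space p M"
  by (simp add: Lp_space_def)

lemma Lp_space_measurable: "f \<in> Lp_space p M \<Longrightarrow> f \<in> borel_measurable M"
  and Lp_space_finite: "f \<in> Lp_space p M \<Longrightarrow> Lp_enorm p M f < \<infinity>"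
  by (auto simp: Lp_space_def)

lemma Lp_space_add:
  assumes "1 \<le> p" "f \<in> Lp_space p M" "g \<in> Lp_space p M"
  shows "(\<lambda>x. f x + g x) \<in> Lp_space p M"
  using assms Lp_enorm_triangle[of p f M g]
  by (auto simp: Lp_space_def intro: le_less_trans)

lemma Lp_space_cmult:
  assumes "0 < p" "f \<in> Lp_space p M"
  shows "(\<lambda>x. a * f x) \<in> Lp_space p M"
  using assms by (auto simp: Lp_space_def Lp_enorm_cmult ennreal_mult_less_top)

text \<open>Integrate the tangent line of \<open>t \<mapsto> t powr p\<close> at the mean \<open>i / W\<close>.\<close>

lemma nn_integral_powr_Jensen:
  fixes a w :: "'a \<Rightarrow> real"
  assumes p: "1 < p" and [measurable]: "a \<in> borel_measurable M" "w \<in> borel_measurable M"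
    and nn: "\<And>x. 0 \<le> a x" "\<And>x. 0 \<le> w x" "0 \<le> i" "0 < W"
    and i: "(\<integral>\<^sup>+ x. ennreal (a x * w x) \<partial>M) = ennreal i"
    and W: "(\<integral>\<^sup>+ x. ennreal (w x) \<partial>M) = ennreal W"
  shows "ennreal (i powr p) \<le> ennreal (W powr (p - 1)) * (\<integral>\<^sup>+ x. ennreal (a x powr p * w x) \<partial>M)"
proof (cases "\<integral>\<^sup>+ x. ennreal (a x powr p * w x) \<partial>M")
  case top
  then show ?thesis using nn by (simp add: ennreal_mult_top)
next
  case (real J)
  show ?thesis
  proof (cases "i = 0")
    case False
    define s where "s = i / W"
    have s: "0 < s" "s * W = i" using nn False by (auto simp: s_def)
    have "ennreal (p * s powr (p - 1) * i) = ennreal (p * s powr (p - 1)) * ennreal i"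
      using p nn by (simp add: ennreal_mult)
    also have "\<dots> = (\<integral>\<^sup>+ x. ennreal (p * s powr (p - 1)) * ennreal (a x * w x) \<partial>M)"
      unfolding i[symmetric] by (rule nn_integral_cmult[symmetric]) measurable
    also have "\<dots> \<le> (\<integral>\<^sup>+ x. ennreal (a x powr p * w x) + ennreal ((p - 1) * s powr p) * ennreal (w x) \<partial>M)"
    proof (intro nn_integral_mono)
      fix x
      have "p * s powr (p - 1) * a x * w x \<le> (a x powr p + (p - 1) * s powr p) * w x"
        using powr_tangent[OF p, of "a x" s] s nn by (intro mult_right_mono) auto
      then have "ennreal (p * s powr (p - 1) * (a x * w x))
          \<le> ennreal (a x powr p * w x + (p - 1) * s powr p * w x)"
        by (intro ennreal_leI) (simp add: distrib_right mult.assoc)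
      also have "\<dots> = ennreal (a x powr p * w x) + ennreal ((p - 1) * s powr p) * ennreal (w x)"
        using p nn by (simp add: ennreal_mult)
      finally show "ennreal (p * s powr (p - 1)) * ennreal (a x * w x)
          \<le> ennreal (a x powr p * w x) + ennreal ((p - 1) * s powr p) * ennreal (w x)"
        using p nn by (simp add: ennreal_mult)
    qed
    also have "\<dots> = ennreal J + ennreal ((p - 1) * s powr p) * ennreal W"
      using p by (subst nn_integral_add) (auto simp: nn_integral_cmult real W)
    also have "\<dots> = ennreal (J + (p - 1) * s powr p * W)"
      using p nn real by (simp add: ennreal_mult)
    finally have "p * s powr (p - 1) * i \<le> J + (p - 1) * s powr p * W"
      using p nn real by (subst (asm) ennreal_le_iff) auto
    moreover have "s powr (p - 1) * i = s powr p * W"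
      unfolding s(2)[symmetric] using s(1) by (simp add: powr_diff)
    ultimately have "p * (s powr p * W) \<le> J + (p - 1) * (s powr p * W)" by (simp add: mult.assoc)
    then have "s powr p * W \<le> J" by (simp add: left_diff_distrib)
    then have "W powr (p - 1) * (s powr p * W) \<le> W powr (p - 1) * J"
      by (intro mult_left_mono) auto
    moreover have "W powr (p - 1) * (s powr p * W) = i powr p"
      unfolding s(2)[symmetric] using nn(4) s(1) by (simp add: powr_diff powr_mult)
    ultimately show ?thesis using real nn by (simp add: ennreal_mult[symmetric])
  qed (use p in simp)
qed

section \<open>Haar measure and Tonelli's theorem\<close>

text \<open>A compact set is covered by finitely many open boxes inside \<open>W\<close>. Their
  union is measurable for the product \<sigma>-algebra, which \<open>W\<close> itself need not
  be.\<close>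

lemma compact_inside_open_Times:
  fixes W :: "('a::topological_space \<times> 'b::topological_space) set"
  assumes "compact C" "open W" "C \<subseteq> W"
  obtains R where "R \<in> sets (borel \<Otimes>\<^sub>M borel)" "C \<subseteq> R" "R \<subseteq> W"
proof -
  define F where "F = {A \<times> B |A B. open A \<and> open B \<and> A \<times> B \<subseteq> W}"
  have "C \<subseteq> \<Union>F"
  proof
    fix z assume "z \<in> C"
    then have "z \<in> W" using assms by auto
    then obtain A B where "open A" "open B" "z \<in> A \<times> B" "A \<times> B \<subseteq> W"
      using bspec[OF iffD1[OF open_prod_def assms(2)]] by metis
    then show "z \<in> \<Union>F" unfolding F_def by blast
  qed
  moreover have "open B" if "B \<in> F" for B
    using that by (auto simp: F_def open_Times)
  ultimately obtain F' where F': "F' \<subseteq> F" "finite F'" "C \<subseteq> \<Union>F'"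
    using compactE[OF assms(1)] by metis
  show thesis
  proof
    show "\<Union>F' \<in> sets (borel \<Otimes>\<^sub>M borel)"
      using F' by (intro sets.finite_Union) (auto simp: F_def)
    show "\<Union>F' \<subseteq> W" using F' by (auto simp: F_def)
  qed (use F' in auto)
qed

text \<open>The tube lemma. Later it makes a lower bound for a bump on a compact set uniform under
  small translations.\<close>

lemma compact_tube:
  fixes K :: "'b::topological_space set" and W :: "('a::topological_space \<times> 'b) set"
  assumes K: "compact K" and W: "open W" "{a} \<times> K \<subseteq> W"
  obtains V where "open V" "a \<in> V" "V \<times> K \<subseteq> W"
proof -
  \<comment> \<open>Points outside \<open>K\<close> get a trivial box, so that choice yields total
    functions \<open>A\<close> and \<open>B\<close>.\<close>
  have "\<exists>A B. open A \<and> open B \<and> a \<in> A \<and> x \<in> B \<and> (x \<in> K \<longrightarrow> A \<times> B \<subseteq> W)" for x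
  proof (cases "x \<in> K")
    case False
    then show ?thesis by (intro exI[of _ UNIV]) simp
  next
    case True
    then have "(a, x) \<in> W" using W by auto
    then obtain A B where "open A" "open B" "(a, x) \<in> A \<times> B" "A \<times> B \<subseteq> W"
      using bspec[OF iffD1[OF open_prod_def W(1)]] by metis
    then show ?thesis by (intro exI[of _ A] exI[of _ B]) simp
  qed
  then obtain A B where AB: "\<And>x. open (A x)" "\<And>x. open (B x)"
    "\<And>x. a \<in> A x" "\<And>x. x \<in> B x" "\<And>x. x \<in> K \<Longrightarrow> A x \<times> B x \<subseteq> W" by metis
  have "K \<subseteq> (\<Union>x\<in>K. B x)" using AB by auto
  then obtain D where D: "D \<subseteq> K" "finite D" "K \<subseteq> (\<Union>x\<in>D. B x)"
    by (rule compactE_image[OF K AB(2)])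
  show thesis
  proof
    show "open (\<Inter>x\<in>D. A x)" using D AB by (intro open_INT) auto
    show "a \<in> (\<Inter>x\<in>D. A x)" using D AB by auto
    show "(\<Inter>x\<in>D. A x) \<times> K \<subseteq> W" using D AB(5) by fastforce
  qed
qed

text \<open>Without second countability a continuous function of two variables need not be measurable for
  the product of the Borel \<open>\<sigma>\<close>-algebras, but it is on compact rectangles: there its superlevel sets
  are countable unions of compact sets, each of which can be separated from the complement of the
  superlevel set by finitely many open rectangles.\<close>

lemma borel_measurable_continuous_compact_Times:
  fixes k :: "'a::t2_space \<times> 'b::t2_space \<Rightarrow> real"
  assumes k: "continuous_on UNIV k" and KL: "compact K" "compact L"
  shows "(\<lambda>z. indicator (K \<times> L) z * k z) \<in> borel_measurable (borel \<Otimes>\<^sub>M borel)"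
proof -
  have [measurable]: "K \<in> sets borel" "L \<in> sets borel"
    using KL by (auto intro: borel_closed compact_imp_closed)
  have KLm: "K \<times> L \<in> sets (borel \<Otimes>\<^sub>M borel)" by measurable
  have sup: "{z \<in> K \<times> L. a < k z} \<in> sets (borel \<Otimes>\<^sub>M borel)" for a
  proof -
    have "\<exists>R. R \<in> sets (borel \<Otimes>\<^sub>M borel) \<and> {z \<in> K \<times> L. a + inverse (real (Suc n)) \<le> k z} \<subseteq> R \<and> R \<subseteq> {z. a < k z}"
      for n
    proof -
      have "closed {z. a + inverse (real (Suc n)) \<le> k z}"
        using k by (intro closed_Collect_le) auto
      then have "compact ((K \<times> L) \<inter> {z. a + inverse (real (Suc n)) \<le> k z})"
        using KL by (intro compact_Int_closed compact_Times)
      moreover have "open {z. a < k z}" using k by (intro open_Collect_less) auto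
      moreover have "(K \<times> L) \<inter> {z. a + inverse (real (Suc n)) \<le> k z} \<subseteq> {z. a < k z}"
        by (auto intro: less_le_trans[rotated])
      ultimately obtain R where "R \<in> sets (borel \<Otimes>\<^sub>M borel)"
        "(K \<times> L) \<inter> {z. a + inverse (real (Suc n)) \<le> k z} \<subseteq> R" "R \<subseteq> {z. a < k z}"
        by (rule compact_inside_open_Times)
      then show ?thesis by blast
    qed
    then have "\<exists>R. \<forall>n. R n \<in> sets (borel \<Otimes>\<^sub>M borel) \<and>
        {z \<in> K \<times> L. a + inverse (real (Suc n)) \<le> k z} \<subseteq> R n \<and> R n \<subseteq> {z. a < k z}"
      by (intro choice) blast
    then obtain R where R: "\<And>n. R n \<in> sets (borel \<Otimes>\<^sub>M borel)"
      "\<And>n. {z \<in> K \<times> L. a + inverse (real (Suc n)) \<le> k z} \<subseteq> R n" "\<And>n. R n \<subseteq> {z. a < k z}"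
      by blast
    have "{z \<in> K \<times> L. a < k z} = (K \<times> L) \<inter> (\<Union>n. R n)"
    proof (intro equalityI subsetI)
      fix z assume z: "z \<in> {z \<in> K \<times> L. a < k z}"
      then obtain n where "inverse (real (Suc n)) < k z - a"
        using reals_Archimedean[of "k z - a"] by auto
      then have "z \<in> R n" using z R(2)[of n] by (auto simp: subset_eq)
      then show "z \<in> (K \<times> L) \<inter> (\<Union>n. R n)" using z by auto
    qed (use R(3) in auto)
    then show ?thesis using R(1) KLm by auto
  qed
  show ?thesis
  proof (subst borel_measurable_iff_greater, intro allI)
    fix a :: real
    \<comment> \<open>Off the rectangle the function is 0, so the complement lies in the superlevel
      set exactly when \<open>a < 0\<close>.\<close>
    have "{w \<in> space (borel \<Otimes>\<^sub>M borel). a < indicator (K \<times> L) w * k w}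
        = (if a < 0 then {z \<in> K \<times> L. a < k z} \<union> - (K \<times> L) else {z \<in> K \<times> L. a < k z})"
      by (auto simp: space_pair_measure indicator_def)
    also have "\<dots> \<in> sets (borel \<Otimes>\<^sub>M borel)"
      using sup KLm sets.compl_sets[OF KLm] by (auto simp: space_pair_measure Compl_eq_Diff_UNIV)
    finally show "{w \<in> space (borel \<Otimes>\<^sub>M borel). a < indicator (K \<times> L) w * k w} \<in> sets (borel \<Otimes>\<^sub>M borel)" .
  qed
qed

text \<open>Only compact sets of \<open>y\<close> are constrained: the function integrated against
  \<open>k\<close> lives in the variable \<open>y\<close>, and its \<sigma>-compact carrier is
  passed on to \<open>x\<close>.\<close>

definition properly_supported :: "('a::topological_space \<times> 'b::topological_space \<Rightarrow> real) \<Rightarrow> bool" where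
  "properly_supported k \<longleftrightarrow> continuous_on UNIV k \<and>
     (\<forall>L. compact L \<longrightarrow> (\<exists>K. compact K \<and> (\<forall>x. \<forall>y\<in>L. k (x, y) \<noteq> 0 \<longrightarrow> x \<in> K)))"

text \<open>Over a compact set of \<open>y\<close> the kernel vanishes off a compact rectangle, so
  the function is a limit of functions covered by
  \<open>borel_measurable_continuous_compact_Times\<close>.\<close>

lemma borel_measurable_properly_supported:
  fixes k :: "'a::t2_space \<times> 'b::t2_space \<Rightarrow> real" and L :: "nat \<Rightarrow> 'b set"
  assumes k: "properly_supported k" and L: "\<And>n. compact (L n)"
  shows "(\<lambda>z. indicator (\<Union>n. L n) (snd z) * k z) \<in> borel_measurable (borel \<Otimes>\<^sub>M borel)"
proof -
  \<comment> \<open>Increasing unions: once \<open>snd z\<close> has entered, the approximating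
    sequence is constant at \<open>z\<close>.\<close>
  define L' where "L' n = (\<Union>i\<le>n. L i)" for n
  have L': "compact (L' n)" for n unfolding L'_def using L by (intro compact_UN) auto
  then have "\<exists>K. compact K \<and> (\<forall>x. \<forall>y\<in>L' n. k (x, y) \<noteq> 0 \<longrightarrow> x \<in> K)" for n
    using k by (auto simp: properly_supported_def)
  then obtain K where K: "\<And>n. compact (K n)" "\<And>n x y. y \<in> L' n \<Longrightarrow> k (x, y) \<noteq> 0 \<Longrightarrow> x \<in> K n" by metis
  have "(\<lambda>z. indicator (K n \<times> L' n) z * k z) \<in> borel_measurable (borel \<Otimes>\<^sub>M borel)" for n
    using k K L' by (intro borel_measurable_continuous_compact_Times) (auto simp: properly_supported_def)
  moreover have "(\<lambda>n. indicator (K n \<times> L' n) z * k z) \<longlonglongrightarrow> indicator (\<Union>n. L n) (snd z) * k z" for z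
  proof (cases "snd z \<in> (\<Union>n. L n)")
    case True
    then obtain m where m: "snd z \<in> L m" by auto
    have "indicator (K n \<times> L' n) z * k z = k z" if "m \<le> n" for n
    proof -
      have "snd z \<in> L' n" using m that by (auto simp: L'_def)
      then show ?thesis using K(2)[of "snd z" n "fst z"] by (cases z) (auto simp: indicator_def)
    qed
    then have "\<forall>\<^sub>F n in sequentially. indicator (K n \<times> L' n) z * k z = indicator (\<Union>n. L n) (snd z) * k z"
      using True by (intro eventually_sequentiallyI[of m]) auto
    then show ?thesis by (rule tendsto_eventually)
  next
    case False
    then have "(\<lambda>n. indicator (K n \<times> L' n) z * k z) = (\<lambda>n. 0)"
      by (cases z) (auto simp: L'_def indicator_def)
    then show ?thesis using False by simp
  qed
  ultimately show ?thesis by (rule borel_measurable_LIMSEQ_real[rotated])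
qed

definition compactly_supported :: "('a::topological_space \<Rightarrow> real) \<Rightarrow> bool" where
  "compactly_supported f \<longleftrightarrow> continuous_on UNIV f \<and> (\<exists>C. compact C \<and> (\<forall>x. f x \<noteq> 0 \<longrightarrow> x \<in> C))"

lemma image_add_left: "(\<lambda>x. a + x) ` A = (\<lambda>x. - a + x) -` (A :: 'a::group_add set)"
  by (force simp: image_iff add.assoc[symmetric] intro: bexI[of _ "- a + _"])

lemma image_add_right: "(\<lambda>x. x + a) ` A = (\<lambda>x. x + - a) -` (A :: 'a::group_add set)"
  by (force simp: image_iff add.assoc intro: bexI[of _ "_ + - a"])

lemma image_uminus_vimage: "(\<lambda>x. - x) ` A = (\<lambda>x. - x) -` (A :: 'a::group_add set)"
  by (force simp: image_iff intro: bexI[of _ "- _"])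

section \<open>Regularity of Haar measure and \<sigma>-finite restrictions\<close>

locale haar_group =
  fixes M :: "'a::{topological_group_add, t2_space} measure"
  assumes lc: "locally_compact_space (euclidean :: 'a topology)"
    and haar: "left_haar_measure M"
begin

lemma sets_M[measurable_cong, simp]: "sets M = sets borel"
  using haar by (simp add: left_haar_measure_def)

lemma space_M[simp]: "space M = UNIV"
  using sets_eq_imp_space_eq[OF sets_M] by simp

lemma measurable_M[simp]: "measurable M N = measurable borel N" "measurable N M = measurable N borel"
  by (rule measurable_cong_sets; simp)+

lemma compact_borel: "compact K \<Longrightarrow> K \<in> sets (borel :: 'a measure)"
  by (auto intro: borel_closed compact_imp_closed)

lemma compact_finite: "compact K \<Longrightarrow> emeasure M K < \<infinity>"
  using haar by (simp add: left_haar_measure_def)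

lemma outer_regular: "A \<in> sets borel \<Longrightarrow> emeasure M A = (INF U\<in>{U. open U \<and> A \<subseteq> U}. emeasure M U)"
  using haar unfolding left_haar_measure_def by blast

lemma inner_regular: "open U \<Longrightarrow> emeasure M U = (SUP K\<in>{K. compact K \<and> K \<subseteq> U}. emeasure M K)"
  using haar unfolding left_haar_measure_def by blast

lemma left_inv: "A \<in> sets borel \<Longrightarrow> emeasure M ((\<lambda>x. a + x) ` A) = emeasure M A"
  using haar by (simp add: left_haar_measure_def)

lemma ex_open_between:
  assumes "A \<in> sets borel" "emeasure M A < c"
  obtains U where "open U" "A \<subseteq> U" "emeasure M U < c"
  using assms outer_regular[of A] by (auto simp: INF_less_iff)

lemma ex_compact_between:
  assumes "open U" "c < emeasure M U"
  obtains K where "compact K" "K \<subseteq> U" "c < emeasure M K"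
  using assms inner_regular[of U] by (auto simp: less_SUP_iff)

lemma ex_compact_nbhd:
  fixes x :: 'a
  obtains U K where "open U" "compact K" "x \<in> U" "U \<subseteq> K"
  using lc unfolding locally_compact_space_def by auto (metis that)

lemma ex_compact_nbhd_of_compact:
  fixes K :: "'a set"
  assumes "compact K"
  obtains U C where "open U" "compact C" "K \<subseteq> U" "U \<subseteq> C"
proof -
  obtain U C :: "'a \<Rightarrow> 'a set" where UC: "\<And>x. open (U x)" "\<And>x. compact (C x)" "\<And>x. x \<in> U x" "\<And>x. U x \<subseteq> C x"
  proof -
    have "\<exists>U C. open U \<and> compact C \<and> x \<in> U \<and> U \<subseteq> C" for x :: 'a
      by (rule ex_compact_nbhd[of x]) (intro exI conjI)
    then show thesis using that by metis
  qed
  obtain D where D: "D \<subseteq> K" "finite D" "K \<subseteq> (\<Union>x\<in>D. U x)"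
    using compactE_image[OF assms, of K U] UC by (metis UN_I subsetI)
  show thesis
    by (rule that[of "\<Union>x\<in>D. U x" "\<Union>x\<in>D. C x"]) (use D UC in \<open>auto intro!: compact_UN\<close>, blast)
qed

lemma translation_measurable [measurable]:
  "(\<lambda>x::'a. a + x) \<in> borel_measurable borel" "(\<lambda>x::'a. x + a) \<in> borel_measurable borel"
  "(\<lambda>x::'a. x - a) \<in> borel_measurable borel" "(\<lambda>x::'a. a - x) \<in> borel_measurable borel"
  "(\<lambda>x::'a. - x) \<in> borel_measurable borel" "(\<lambda>x::'a. - x + a) \<in> borel_measurable borel"
  by (intro borel_measurable_continuous_onI continuous_intros)+

lemma image_uminus_borel:
  "A \<in> sets borel \<Longrightarrow> (\<lambda>x. - x) ` A \<in> sets (borel :: 'a measure)"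
  unfolding image_uminus_vimage using measurable_sets[OF translation_measurable(5)] by fastforce

lemma distr_left: "distr M borel (\<lambda>x. a + x) = M"
proof (rule measure_eqI)
  fix A assume "A \<in> sets (distr M borel (\<lambda>x. a + x))"
  then have A: "A \<in> sets borel" by simp
  have "(\<lambda>x. a + x) -` A = (\<lambda>x. - a + x) ` A"
    by (force simp: image_iff add.assoc[symmetric] intro: bexI[of _ "a + _"])
  then show "emeasure (distr M borel (\<lambda>x. a + x)) A = emeasure M A"
    using A left_inv[OF A, of "- a"] by (subst emeasure_distr) auto
qed simp

lemma nn_integral_left:
  assumes "f \<in> borel_measurable borel"
  shows "(\<integral>\<^sup>+ x. f (a + x) \<partial>M) = (\<integral>\<^sup>+ x. f x \<partial>M)"
  using nn_integral_distr[of "\<lambda>x. a + x" M borel f] assms by (simp add: distr_left)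

text \<open>\<open>M\<close> need not be \<sigma>-finite, but compact sets have finite measure, so
  its restriction to a \<sigma>-compact set is.\<close>

lemma sigma_finite_restrict:
  assumes "\<And>n::nat. compact (L n)"
  shows "sigma_finite_measure (density M (\<lambda>x. ennreal (indicator (\<Union>n. L n) x)))"
proof -
  have [measurable]: "L n \<in> sets borel" for n using assms compact_borel by auto
  have fin: "emeasure (density M (\<lambda>x. ennreal (indicator (\<Union>n. L n) x))) (L n) \<noteq> \<infinity>" for n
  proof -
    have "emeasure (density M (\<lambda>x. ennreal (indicator (\<Union>n. L n) x))) (L n)
        \<le> (\<integral>\<^sup>+ x. indicator (L n) x \<partial>M)"
      by (subst emeasure_density, simp, simp, intro nn_integral_mono) (simp split: split_indicator)
    also have "\<dots> < \<infinity>" using compact_finite[OF assms[of n]] by simp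
    finally show ?thesis by simp
  qed
  \<comment> \<open>A countable cover of the whole group is required; the complement joins it as a
    null set.\<close>
  have "emeasure (density M (\<lambda>x. ennreal (indicator (\<Union>n. L n) x))) (- (\<Union>n. L n)) = 0"
  proof -
    have [measurable]: "- (\<Union>n. L n) \<in> sets borel" by (auto simp: Compl_eq_Diff_UNIV)
    have "emeasure (density M (\<lambda>x. ennreal (indicator (\<Union>n. L n) x))) (- (\<Union>n. L n)) = (\<integral>\<^sup>+ x. 0 \<partial>M)"
      by (subst emeasure_density, simp, simp, intro nn_integral_cong) (simp split: split_indicator)
    then show ?thesis by simp
  qed
  then show ?thesis
    using fin by (intro sigma_finite_measure.intro exI[of _ "insert (- (\<Union>n. L n)) (range L)"])
      (auto simp: Compl_eq_Diff_UNIV)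
qed

text \<open>Neither iterated integral changes when \<open>M\<close> is restricted to the
  \<sigma>-compact sets that carry \<open>f\<close>; for the restrictions the classical theorem
  applies.\<close>

lemma Tonelli_sigma_compact:
  fixes f :: "'a \<Rightarrow> 'a \<Rightarrow> ennreal" and K L :: "nat \<Rightarrow> 'a set"
  assumes f: "case_prod f \<in> borel_measurable (borel \<Otimes>\<^sub>M borel)"
    and KL: "\<And>n. compact (K n)" "\<And>n. compact (L n)"
    and supp: "\<And>x y. f x y \<noteq> 0 \<Longrightarrow> x \<in> (\<Union>n. K n) \<and> y \<in> (\<Union>n. L n)"
  shows "(\<integral>\<^sup>+ x. \<integral>\<^sup>+ y. f x y \<partial>M \<partial>M) = (\<integral>\<^sup>+ y. \<integral>\<^sup>+ x. f x y \<partial>M \<partial>M)"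
proof -
  define S T where "S = (\<Union>n. K n)" and "T = (\<Union>n. L n)"
  define N1 N2 where "N1 = density M (\<lambda>x. ennreal (indicator S x))" "N2 = density M (\<lambda>x. ennreal (indicator T x))"
  have [measurable]: "S \<in> sets borel" "T \<in> sets borel"
    unfolding S_def T_def using KL compact_borel by auto
  interpret N1: sigma_finite_measure N1 unfolding N1_N2_def S_def by (rule sigma_finite_restrict[OF KL(1)])
  interpret N2: sigma_finite_measure N2 unfolding N1_N2_def T_def by (rule sigma_finite_restrict[OF KL(2)])
  interpret pair_sigma_finite N1 N2 ..
  have [simp, measurable_cong]: "sets N1 = sets borel" "sets N2 = sets borel" by (auto simp: N1_N2_def)
  note f[measurable]
  have f12: "case_prod f \<in> borel_measurable (N1 \<Otimes>\<^sub>M N2)" by measurable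
  have m1[measurable]: "(\<lambda>x. \<integral>\<^sup>+ y. f x y \<partial>N2) \<in> borel_measurable borel" by measurable
  have m2[measurable]: "(\<lambda>y. \<integral>\<^sup>+ x. f x y \<partial>N1) \<in> borel_measurable borel" by measurable
  have i2: "(\<integral>\<^sup>+ y. f x y \<partial>N2) = (\<integral>\<^sup>+ y. f x y \<partial>M)" for x
    unfolding N1_N2_def
    by (subst nn_integral_density, simp, simp, intro nn_integral_cong)
      (use supp[of x] in \<open>fastforce simp: T_def split: split_indicator\<close>)
  have i1: "(\<integral>\<^sup>+ x. f x y \<partial>N1) = (\<integral>\<^sup>+ x. f x y \<partial>M)" for y
    unfolding N1_N2_def
    by (subst nn_integral_density, simp, simp, intro nn_integral_cong)
      (use supp[of _ y] in \<open>fastforce simp: S_def split: split_indicator\<close>)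
  have "(\<integral>\<^sup>+ x. \<integral>\<^sup>+ y. f x y \<partial>M \<partial>M) = (\<integral>\<^sup>+ x. \<integral>\<^sup>+ y. f x y \<partial>N2 \<partial>N1)"
  proof -
    have "(\<integral>\<^sup>+ y. f x y \<partial>N2) = 0" if "x \<notin> S" for x
    proof -
      have "f x y = 0" for y using supp[of x y] that by (auto simp: S_def)
      then show ?thesis by simp
    qed
    then show ?thesis
      unfolding i2[symmetric] N1_N2_def(1) using m1
      by (subst nn_integral_density) (auto intro!: nn_integral_cong split: split_indicator)
  qed
  also have "\<dots> = (\<integral>\<^sup>+ y. \<integral>\<^sup>+ x. f x y \<partial>N1 \<partial>N2)"
    using Fubini[OF f12] by simp
  also have "\<dots> = (\<integral>\<^sup>+ y. \<integral>\<^sup>+ x. f x y \<partial>M \<partial>M)"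
  proof -
    have "(\<integral>\<^sup>+ x. f x y \<partial>N1) = 0" if "y \<notin> T" for y
    proof -
      have "f x y = 0" for x using supp[of x y] that by (auto simp: T_def)
      then show ?thesis by simp
    qed
    then show ?thesis
      unfolding i1[symmetric] N1_N2_def(2) using m2
      by (subst nn_integral_density) (auto intro!: nn_integral_cong split: split_indicator)
  qed
  finally show ?thesis .
qed

text \<open>A locally compact Hausdorff space is completely regular. Separating \<open>K\<close>
  from the complement of \<open>U \<inter> V\<close>, where \<open>U\<close> lies in a compact set,
  gives both the support in \<open>V\<close> and its compactness.\<close>

lemma Urysohn_compactly_supported:
  assumes "compact K" "open V" "K \<subseteq> V"
  obtains f :: "'a \<Rightarrow> real" where "compactly_supported f" "\<And>x. 0 \<le> f x" "\<And>x. f x \<le> 1"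
    "\<And>x. x \<in> K \<Longrightarrow> f x = 1" "\<And>x. f x \<noteq> 0 \<Longrightarrow> x \<in> V"
proof -
  obtain U C where UC: "open U" "compact C" "K \<subseteq> U" "U \<subseteq> C"
    using ex_compact_nbhd_of_compact[OF assms(1)] by blast
  have "Hausdorff_space (euclidean :: 'a topology)"
    unfolding Hausdorff_space_def disjnt_def by simp (metis hausdorff)
  then have "completely_regular_space (euclidean :: 'a topology)"
    using lc by (intro locally_compact_regular_imp_completely_regular_space) auto
  moreover have "closedin euclidean (- (U \<inter> V))" using UC assms by (auto intro: closed_Compl)
  moreover have "disjnt K (- (U \<inter> V))" using UC assms by (auto simp: disjnt_def)
  ultimately obtain f where f: "continuous_map euclidean (subtopology euclidean {0..1::real}) f"
    "f ` (- (U \<inter> V)) \<subseteq> {0}" "f ` K \<subseteq> {1}"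
    using Urysohn_completely_regular_compact_closed[of 0 1 euclidean K "- (U \<inter> V)"] assms by auto
  show thesis
  proof
    have "continuous_on UNIV f" using f(1) by (auto simp: continuous_map_in_subtopology)
    moreover have "\<forall>x. f x \<noteq> 0 \<longrightarrow> x \<in> C" using f(2) UC by blast
    ultimately show "compactly_supported f" using UC(2) unfolding compactly_supported_def by blast
    show "0 \<le> f x" "f x \<le> 1" for x using f(1) by (auto simp: continuous_map_in_subtopology)
    show "x \<in> K \<Longrightarrow> f x = 1" for x using f(3) by auto
    show "f x \<noteq> 0 \<Longrightarrow> x \<in> V" for x using f(2) by blast
  qed
qed

text \<open>Translates of a null open set would make every compact set null, and then, by inner
  regularity of the whole group, the measure would be 0.\<close>

lemma open_positive:
  assumes "open U" "x \<in> U"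
  shows "0 < emeasure M U"
proof (rule ccontr)
  assume "\<not> 0 < emeasure M U"
  then have U0: "emeasure M U = 0" by simp
  \<comment> \<open>The translate of \<open>U\<close> that carries \<open>x\<close> to
    \<open>a\<close>.\<close>
  define T where "T a = (\<lambda>z. (a - x) + z) ` U" for a
  have T: "T a = (\<lambda>z. - (a - x) + z) -` U" for a
    unfolding T_def by (rule image_add_left)
  have oT: "open (T a)" for a
    unfolding T by (intro open_vimage assms(1) continuous_intros)
  have aT: "a \<in> T a" for a using assms(2) by (force simp: T_def intro: image_eqI[of _ _ x])
  have mT: "emeasure M (T a) = 0" for a
    unfolding T_def using left_inv[of U "a - x"] U0 assms by simp
  have K0: "emeasure M K = 0" if K: "compact K" for K
  proof -
    have "K \<subseteq> (\<Union>a\<in>K. T a)" using aT by auto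
    then obtain D where D: "D \<subseteq> K" "finite D" "K \<subseteq> (\<Union>a\<in>D. T a)"
      by (rule compactE_image[OF K oT])
    have "emeasure M K \<le> emeasure M (\<Union>a\<in>D. T a)"
      using D oT by (intro emeasure_mono) auto
    also have "\<dots> \<le> (\<Sum>a\<in>D. emeasure M (T a))"
      using D oT by (intro emeasure_subadditive_finite) auto
    finally show ?thesis using mT by simp
  qed
  have "emeasure M UNIV \<le> 0"
    unfolding inner_regular[OF open_UNIV] using K0 by (intro SUP_least) auto
  then show False using haar by (simp add: left_haar_measure_def)
qed

text \<open>Inner regularity is available for open sets only. So \<open>A\<close> is first enclosed
  in an open set \<open>U\<close> of finite measure, and the compact sets exhaust \<open>U\<close>
  up to a null set.\<close>

lemma finite_measure_sigma_compact:
  assumes A: "A \<in> sets borel" "emeasure M A < \<infinity>"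
  obtains L :: "nat \<Rightarrow> 'a set" where "\<And>n. compact (L n)" "AE x in M. x \<in> A \<longrightarrow> x \<in> (\<Union>n. L n)"
proof -
  obtain U where U: "open U" "A \<subseteq> U" "emeasure M U < \<infinity>" using ex_open_between[OF A] by blast
  have "{K. compact K \<and> K \<subseteq> U} \<noteq> {}" by blast
  then obtain f :: "nat \<Rightarrow> ennreal" where f: "range f \<subseteq> emeasure M ` {K. compact K \<and> K \<subseteq> U}"
    "(SUP K\<in>{K. compact K \<and> K \<subseteq> U}. emeasure M K) = (SUP n. f n)"
    using ennreal_SUP_countable_SUP[of "{K. compact K \<and> K \<subseteq> U}" "emeasure M"] by metis
  have "\<forall>n. \<exists>K. compact K \<and> K \<subseteq> U \<and> f n = emeasure M K" using f(1) by blast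
  then obtain L where L: "\<And>n. compact (L n)" "\<And>n. L n \<subseteq> U" "\<And>n. f n = emeasure M (L n)" by metis
  have [measurable]: "L n \<in> sets borel" for n using L compact_borel by auto
  have "emeasure M U = (SUP n. emeasure M (L n))" using inner_regular[OF U(1)] f(2) L(3) by simp
  also have "\<dots> \<le> emeasure M (\<Union>n. L n)" by (intro SUP_least emeasure_mono) auto
  finally have "emeasure M U \<le> emeasure M (\<Union>n. L n)" .
  moreover have "emeasure M (\<Union>n. L n) \<le> emeasure M U" using L U by (intro emeasure_mono) auto
  ultimately have eq: "emeasure M (\<Union>n. L n) = emeasure M U" by simp
  then have "emeasure M (U - (\<Union>n. L n)) = 0"
    using U L by (subst emeasure_Diff) auto
  then have "U - (\<Union>n. L n) \<in> null_sets M" using U by (intro null_setsI) auto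
  then have "AE x in M. x \<notin> U - (\<Union>n. L n)" by (rule AE_not_in)
  then have "AE x in M. x \<in> A \<longrightarrow> x \<in> (\<Union>n. L n)" using U by (auto elim!: eventually_mono)
  then show thesis using L that by blast
qed

text \<open>By Markov's inequality each set where \<open>1 \<le> n * h\<close> has finite measure,
  and these sets exhaust the set where \<open>h\<close> does not vanish.\<close>

lemma integrable_sigma_compact:
  fixes h :: "'a \<Rightarrow> ennreal"
  assumes h[measurable]: "h \<in> borel_measurable borel" and fin: "(\<integral>\<^sup>+ x. h x \<partial>M) < \<infinity>"
  shows "\<exists>L :: nat \<Rightarrow> 'a set. (\<forall>n. compact (L n)) \<and> (AE x in M. h x \<noteq> 0 \<longrightarrow> x \<in> (\<Union>n. L n))"
proof -
  define A where "A n = {x. 1 \<le> of_nat n * h x}" for n :: nat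
  have A: "A n \<in> sets borel" for n
  proof -
    have "{x\<in>space borel. 1 \<le> of_nat n * h x} \<in> sets borel" by measurable
    then show ?thesis by (simp add: A_def)
  qed
  have "emeasure M (A n) < \<infinity>" for n
  proof -
    have "emeasure M (A n) \<le> of_nat n * (\<integral>\<^sup>+ x. h x * indicator UNIV x \<partial>M)"
      using nn_integral_Markov_inequality[of h UNIV M "of_nat n"] h by (auto simp: A_def)
    also have "\<dots> < \<infinity>" using fin by (simp add: ennreal_mult_less_top of_nat_less_top)
    finally show ?thesis .
  qed
  then have "\<exists>L :: nat \<Rightarrow> 'a set. (\<forall>i. compact (L i)) \<and> (AE x in M. x \<in> A n \<longrightarrow> x \<in> (\<Union>i. L i))" for n
    using finite_measure_sigma_compact[OF A[of n]] by metis
  then obtain L :: "nat \<Rightarrow> nat \<Rightarrow> 'a set" where L: "\<And>n i. compact (L n i)"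
    "\<And>n. AE x in M. x \<in> A n \<longrightarrow> x \<in> (\<Union>i. L n i)" by metis
  have "AE x in M. \<forall>n. x \<in> A n \<longrightarrow> x \<in> (\<Union>i. L n i)" using L(2) by (simp add: AE_all_countable)
  then have "AE x in M. h x \<noteq> 0 \<longrightarrow> x \<in> (\<Union>n. case prod_decode n of (i, j) \<Rightarrow> L i j)"
  proof eventually_elim
    case (elim x)
    show ?case
    proof
      assume "h x \<noteq> 0"
      then have "\<exists>n::nat. 1 \<le> of_nat n * h x"
      proof (cases "h x")
        case (real r)
        then obtain n :: nat where "1 / r < real n" using reals_Archimedean2 by blast
        then have "1 \<le> real n * r" using real \<open>h x \<noteq> 0\<close> by (simp add: field_simps)
        then have "ennreal 1 \<le> ennreal (real n * r)" by (rule ennreal_leI)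
        then show ?thesis using real by (auto simp: ennreal_mult ennreal_of_nat_eq_real_of_nat)
      next
        case top
        then show ?thesis by (intro exI[of _ 1]) simp
      qed
      then obtain n i where "x \<in> L n i" using elim by (auto simp: A_def)
      then show "x \<in> (\<Union>n. case prod_decode n of (i, j) \<Rightarrow> L i j)"
        by (intro UN_I[of "prod_encode (n, i)"]) auto
    qed
  qed
  moreover have "compact (case prod_decode n of (i, j) \<Rightarrow> L i j)" for n
    using L by (simp split: prod.split)
  ultimately show ?thesis by (intro exI conjI allI)
qed

lemma properly_supported_sigma_compact:
  fixes L :: "nat \<Rightarrow> 'a set" and k :: "'a \<times> 'a \<Rightarrow> real"
  assumes "properly_supported k" "\<And>n. compact (L n)"
  shows "\<exists>K :: nat \<Rightarrow> 'a set. (\<forall>n. compact (K n)) \<and>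
    (\<forall>x y. k (x, y) \<noteq> 0 \<longrightarrow> y \<in> (\<Union>n. L n) \<longrightarrow> x \<in> (\<Union>n. K n))"
proof -
  have "\<exists>K. compact K \<and> (\<forall>x. \<forall>y\<in>L n. k (x, y) \<noteq> 0 \<longrightarrow> x \<in> K)" for n
    using assms by (simp add: properly_supported_def)
  then obtain K where "\<And>n. compact (K n)" "\<And>n x y. y \<in> L n \<Longrightarrow> k (x, y) \<noteq> 0 \<Longrightarrow> x \<in> K n" by metis
  then show ?thesis by (intro exI[of _ K]) blast
qed

lemma properly_supported_section:
  fixes k :: "'a \<times> 'a \<Rightarrow> real"
  assumes "properly_supported k"
  shows "(\<lambda>y. k (x, y)) \<in> borel_measurable borel" "(\<lambda>x. k (x, y)) \<in> borel_measurable borel"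
proof -
  have k: "continuous_on UNIV k" using assms by (simp add: properly_supported_def)
  show "(\<lambda>y. k (x, y)) \<in> borel_measurable borel" "(\<lambda>x. k (x, y)) \<in> borel_measurable borel"
    by (intro borel_measurable_continuous_onI continuous_on_compose2[OF k] continuous_intros; simp)+
qed

text \<open>Integrability of \<open>h\<close> provides the \<sigma>-compact set for
  \<open>y\<close>, proper support the one for \<open>x\<close>.\<close>

lemma Tonelli_properly_supported:
  fixes h :: "'a \<Rightarrow> ennreal" and k :: "'a \<times> 'a \<Rightarrow> real"
  assumes k: "properly_supported k"
    and h[measurable]: "h \<in> borel_measurable borel" and fin: "(\<integral>\<^sup>+ x. h x \<partial>M) < \<infinity>"
  shows "(\<integral>\<^sup>+ x. \<integral>\<^sup>+ y. h y * ennreal (k (x, y)) \<partial>M \<partial>M) = (\<integral>\<^sup>+ y. h y * (\<integral>\<^sup>+ x. ennreal (k (x, y)) \<partial>M) \<partial>M)"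
proof -
  obtain L :: "nat \<Rightarrow> 'a set" where L': "\<forall>n. compact (L n)" and
      L2: "AE x in M. h x \<noteq> 0 \<longrightarrow> x \<in> (\<Union>n. L n)"
    using integrable_sigma_compact[OF h fin] by (elim exE conjE)
  note L = L'[rule_format] L2
  define S where "S = (\<Union>n. L n)"
  obtain K :: "nat \<Rightarrow> 'a set" where K': "\<forall>n. compact (K n)"
      "\<forall>x y. k (x, y) \<noteq> 0 \<longrightarrow> y \<in> (\<Union>n. L n) \<longrightarrow> x \<in> (\<Union>n. K n)"
    using properly_supported_sigma_compact[of k L, OF k L(1)] by (elim exE conjE)
  then have K: "\<And>n. compact (K n)" "\<And>x y. k (x, y) \<noteq> 0 \<Longrightarrow> y \<in> S \<Longrightarrow> x \<in> (\<Union>n. K n)"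
    unfolding S_def by (auto simp del: UN_iff)
  note [measurable] = properly_supported_section[OF k]
  have km: "(\<lambda>z. indicator S (snd z) * k z) \<in> borel_measurable (borel \<Otimes>\<^sub>M borel)"
    unfolding S_def by (rule borel_measurable_properly_supported[OF k L(1)])
  \<comment> \<open>The indicator is free of charge because \<open>h\<close> vanishes almost
    everywhere off \<open>S\<close>; only with it is the kernel known to be jointly
    measurable.\<close>
  have "(\<integral>\<^sup>+ x. \<integral>\<^sup>+ y. h y * ennreal (k (x, y)) \<partial>M \<partial>M)
      = (\<integral>\<^sup>+ x. \<integral>\<^sup>+ y. h y * ennreal (indicator S y * k (x, y)) \<partial>M \<partial>M)"
    using L(2) by (intro nn_integral_cong nn_integral_cong_AE)
      (auto simp: S_def elim!: eventually_mono split: split_indicator)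
  also have "\<dots> = (\<integral>\<^sup>+ y. \<integral>\<^sup>+ x. h y * ennreal (indicator S y * k (x, y)) \<partial>M \<partial>M)"
  proof (rule Tonelli_sigma_compact[OF _ K(1) L(1)])
    have "(\<lambda>z. h (snd z) * ennreal (indicator S (snd z) * k z)) \<in> borel_measurable (borel \<Otimes>\<^sub>M borel)"
      using km by measurable
    then show "(\<lambda>(x, y). h y * ennreal (indicator S y * k (x, y))) \<in> borel_measurable (borel \<Otimes>\<^sub>M borel)"
      by (simp add: case_prod_beta')
    show "x \<in> (\<Union>n. K n) \<and> y \<in> (\<Union>n. L n)" if "h y * ennreal (indicator S y * k (x, y)) \<noteq> 0" for x y
    proof -
      have "y \<in> S" "k (x, y) \<noteq> 0" using that by (auto split: split_indicator_asm)
      then show ?thesis using K(2)[of x y] by (auto simp: S_def)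
    qed
  qed
  also have "\<dots> = (\<integral>\<^sup>+ y. h y * (\<integral>\<^sup>+ x. ennreal (k (x, y)) \<partial>M) \<partial>M)"
  proof (rule nn_integral_cong_AE, use L(2) in eventually_elim)
    fix y assume y: "h y \<noteq> 0 \<longrightarrow> y \<in> (\<Union>n. L n)"
    have "(\<integral>\<^sup>+ x. h y * ennreal (indicator S y * k (x, y)) \<partial>M) = (\<integral>\<^sup>+ x. h y * ennreal (k (x, y)) \<partial>M)"
      using y by (intro nn_integral_cong) (auto simp: S_def split: split_indicator)
    then show "(\<integral>\<^sup>+ x. h y * ennreal (indicator S y * k (x, y)) \<partial>M) = h y * (\<integral>\<^sup>+ x. ennreal (k (x, y)) \<partial>M)"
      by (simp add: nn_integral_cmult)
  qed
  finally show ?thesis .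
qed

text \<open>Parameter integrals are measurable over \<sigma>-finite measures. Restricting
  \<open>M\<close> to the \<sigma>-compact carrier \<open>S\<close> of \<open>u\<close> provides
  such a measure and leaves the integral unchanged.\<close>

lemma measurable_properly_supported_integral:
  fixes u :: "'a \<Rightarrow> complex" and k :: "'a \<times> 'a \<Rightarrow> real"
  assumes k: "properly_supported k" and u: "u \<in> Lp_space p M"
  shows "(\<lambda>x. LINT y|M. u y * of_real (k (x, y))) \<in> borel_measurable borel"
proof -
  have um[measurable]: "u \<in> borel_measurable borel" using Lp_space_measurable[OF u] by simp
  have "(\<lambda>x. ennreal (norm (u x) powr p)) \<in> borel_measurable borel" by measurable
  from integrable_sigma_compact[OF this iffD1[OF Lp_enorm_finite_iff Lp_space_finite[OF u]]]
  obtain L :: "nat \<Rightarrow> 'a set" where L': "\<forall>n. compact (L n)" and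
    L2: "AE x in M. ennreal (norm (u x) powr p) \<noteq> 0 \<longrightarrow> x \<in> (\<Union>n. L n)"
    by (elim exE conjE)
  note L = L'[rule_format] L2
  define S where "S = (\<Union>n. L n)"
  have [measurable]: "S \<in> sets borel" unfolding S_def using L compact_borel by auto
  note [measurable] = properly_supported_section[OF k]
  have km: "(\<lambda>z. indicator S (snd z) * k z) \<in> borel_measurable (borel \<Otimes>\<^sub>M borel)"
    unfolding S_def by (rule borel_measurable_properly_supported[OF k L(1)])
  interpret N: sigma_finite_measure "density M (\<lambda>x. ennreal (indicator S x))"
    unfolding S_def by (rule sigma_finite_restrict[OF L(1)])
  have "(\<lambda>z. u (snd z) * of_real (indicator S (snd z) * k z)) \<in> borel_measurable (borel \<Otimes>\<^sub>M borel)"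
    using km by measurable
  then have "(\<lambda>(x, y). u y * of_real (indicator S y * k (x, y)))
      \<in> borel_measurable (borel \<Otimes>\<^sub>M density M (\<lambda>x. ennreal (indicator S x)))"
    by (simp add: case_prod_beta' cong: measurable_cong_sets)
  then have "(\<lambda>x. LINT y|density M (\<lambda>x. ennreal (indicator S x)). u y * of_real (indicator S y * k (x, y)))
      \<in> borel_measurable borel"
    by (rule N.borel_measurable_lebesgue_integral)
  moreover have "(LINT y|density M (\<lambda>x. ennreal (indicator S x)). u y * of_real (indicator S y * k (x, y)))
      = (LINT y|M. u y * of_real (k (x, y)))" for x
  proof -
    have "(LINT y|density M (\<lambda>x. ennreal (indicator S x)). u y * of_real (indicator S y * k (x, y)))
        = (LINT y|M. indicator S y *\<^sub>R (u y * of_real (indicator S y * k (x, y))))"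
      by (rule integral_density) auto
    also have "\<dots> = (LINT y|M. u y * of_real (k (x, y)))"
      using L(2)[folded S_def] by (intro integral_cong_AE) (auto split: split_indicator)
    finally show ?thesis .
  qed
  ultimately show ?thesis by simp
qed

text \<open>Jensen's inequality for the measure with density \<open>k (x, y)\<close> in
  \<open>y\<close> costs \<open>W powr (p - 1)\<close>; Tonelli and the integral in \<open>x\<close>
  contribute one more factor \<open>W\<close>, in total \<open>W powr p\<close>.\<close>

lemma Lp_enorm_kernel_le:
  fixes u :: "'a \<Rightarrow> complex" and k :: "'a \<times> 'a \<Rightarrow> real"
  assumes p: "1 < p" and k: "properly_supported k" "\<And>z. 0 \<le> k z" and u: "u \<in> Lp_space p M"
    and W: "0 < W" "\<And>x. (\<integral>\<^sup>+ y. ennreal (k (x, y)) \<partial>M) = ennreal W"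
      "\<And>y. (\<integral>\<^sup>+ x. ennreal (k (x, y)) \<partial>M) = ennreal W"
  shows "Lp_enorm p M (\<lambda>x. LINT y|M. u y * of_real (k (x, y))) \<le> ennreal W * Lp_enorm p M u"
proof -
  have um[measurable]: "u \<in> borel_measurable borel" using Lp_space_measurable[OF u] by simp
  note [measurable] = properly_supported_section[OF k(1)]
  obtain C where C: "0 \<le> C" "Lp_enorm p M u = ennreal C"
    using Lp_space_finite[OF u] by (cases p M u rule: Lp_enorm_ennreal_cases) auto
  define J where "J x = (\<integral>\<^sup>+ y. ennreal (norm (u y) powr p * k (x, y)) \<partial>M)" for x
  have pt: "ennreal (norm (LINT y|M. u y * of_real (k (x, y))) powr p) \<le> ennreal (W powr (p - 1)) * J x" for x
  proof (cases "J x = \<infinity>")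
    case True
    then show ?thesis using W by (simp add: ennreal_mult_top)
  next
    case False
    \<comment> \<open>The first moment is finite because \<open>t \<le> 1 + t powr p\<close> and the
      kernel has total mass \<open>W\<close>.\<close>
    have "(\<integral>\<^sup>+ y. ennreal (norm (u y) * k (x, y)) \<partial>M)
        \<le> (\<integral>\<^sup>+ y. ennreal (k (x, y)) + ennreal (norm (u y) powr p * k (x, y)) \<partial>M)"
    proof (intro nn_integral_mono)
      fix y
      have "norm (u y) \<le> 1 + norm (u y) powr p"
        using p by (intro le_one_plus_powr) auto
      then have "norm (u y) * k (x, y) \<le> (1 + norm (u y) powr p) * k (x, y)"
        using k by (intro mult_right_mono) auto
      then have "ennreal (norm (u y) * k (x, y)) \<le> ennreal (k (x, y) + norm (u y) powr p * k (x, y))"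
        by (intro ennreal_leI) (simp add: distrib_right)
      then show "ennreal (norm (u y) * k (x, y)) \<le> ennreal (k (x, y)) + ennreal (norm (u y) powr p * k (x, y))"
        using k by simp
    qed
    also have "\<dots> = ennreal W + J x" unfolding J_def using W by (subst nn_integral_add) auto
    also have "\<dots> < \<infinity>" using False by (simp add: less_top)
    finally obtain i where i: "0 \<le> i" "(\<integral>\<^sup>+ y. ennreal (norm (u y) * k (x, y)) \<partial>M) = ennreal i"
      by (cases "(\<integral>\<^sup>+ y. ennreal (norm (u y) * k (x, y)) \<partial>M)") auto
    \<comment> \<open>Without integrability the Bochner integral is 0 by convention, and the bound
      is trivial.\<close>
    have "ennreal (norm (LINT y|M. u y * of_real (k (x, y)))) \<le> (\<integral>\<^sup>+ y. ennreal (norm (u y * of_real (k (x, y)))) \<partial>M)"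
    proof (cases "integrable M (\<lambda>y. u y * of_real (k (x, y)))")
      case True
      then show ?thesis by (rule integral_norm_bound_ennreal)
    qed (simp add: not_integrable_integral_eq)
    also have "\<dots> = ennreal i" using k by (simp add: norm_mult i)
    finally have "norm (LINT y|M. u y * of_real (k (x, y))) \<le> i" using i by simp
    then have "ennreal (norm (LINT y|M. u y * of_real (k (x, y))) powr p) \<le> ennreal (i powr p)"
      using p by (intro ennreal_leI powr_mono2) auto
    also have "\<dots> \<le> ennreal (W powr (p - 1)) * J x"
      unfolding J_def using p k W i by (intro nn_integral_powr_Jensen) auto
    finally show ?thesis .
  qed
  define h where "h y = ennreal (W powr (p - 1)) * ennreal (norm (u y) powr p)" for y
  have [measurable]: "h \<in> borel_measurable borel" unfolding h_def by measurable
  have J: "ennreal (W powr (p - 1)) * J x = (\<integral>\<^sup>+ y. h y * ennreal (k (x, y)) \<partial>M)" for x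
    unfolding J_def h_def using k by (simp add: ennreal_mult nn_integral_cmult mult.assoc)
  have hI: "(\<integral>\<^sup>+ y. h y \<partial>M) = ennreal (W powr (p - 1) * C powr p)"
    unfolding h_def using C p by (simp add: nn_integral_cmult Lp_enorm_powr ennreal_mult)
  have "(\<integral>\<^sup>+ x. ennreal (norm (LINT y|M. u y * of_real (k (x, y))) powr p) \<partial>M)
      \<le> (\<integral>\<^sup>+ x. \<integral>\<^sup>+ y. h y * ennreal (k (x, y)) \<partial>M \<partial>M)"
    using pt unfolding J by (intro nn_integral_mono)
  also have "\<dots> = (\<integral>\<^sup>+ y. h y * (\<integral>\<^sup>+ x. ennreal (k (x, y)) \<partial>M) \<partial>M)"
    by (rule Tonelli_properly_supported[OF k(1)]) (auto simp: hI)
  also have "\<dots> = (\<integral>\<^sup>+ y. h y * ennreal W \<partial>M)" by (simp add: W(3))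
  also have "\<dots> = ennreal (W powr (p - 1) * C powr p * W)"
    using C W p by (simp add: nn_integral_multc hI ennreal_mult)
  also have "W powr (p - 1) * C powr p * W = (W * C) powr p"
    using W C by (simp add: powr_mult powr_diff)
  finally have "Lp_enorm p M (\<lambda>x. LINT y|M. u y * of_real (k (x, y))) \<le> ennreal (W * C)"
    using W C p by (subst Lp_enorm_le_iff) auto
  then show ?thesis using W C by (simp add: ennreal_mult)
qed

end

section \<open>Compactly supported functions and their translation kernels\<close>

lemma compact_plus:
  fixes A B :: "'a::topological_monoid_add set"
  assumes "compact A" "compact B"
  shows "compact ((\<lambda>(x, y). x + y) ` (A \<times> B))"
  using assms by (intro compact_continuous_image compact_Times)
    (auto simp: case_prod_beta' intro!: continuous_intros)

lemma compactly_supported_bounded: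
  assumes "compactly_supported f"
  obtains B where "0 < B" "\<And>x. \<bar>f x\<bar> \<le> B"
proof -
  obtain C where C: "compact C" "\<And>x. f x \<noteq> 0 \<Longrightarrow> x \<in> C" and f: "continuous_on UNIV f"
    using assms by (auto simp: compactly_supported_def)
  have "compact (f ` C)" using C f by (intro compact_continuous_image) (auto intro: continuous_on_subset)
  then obtain B where B: "0 < B" "\<And>y. y \<in> f ` C \<Longrightarrow> norm y \<le> B"
    using compact_imp_bounded bounded_pos by metis
  have "\<bar>f x\<bar> \<le> B" for x
    using B(2)[of "f x"] C(2)[of x] B(1) by (cases "f x = 0") auto
  then show thesis using B(1) that by blast
qed

text \<open>For \<open>y\<close> in \<open>L\<close> the admissible \<open>x\<close> lie in
  \<open>L + C\<close>, \<open>C + L\<close> and \<open>- L + C\<close>. The first two are the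
  kernels of convolution with \<open>f\<close> on the right and on the left; the third serves the
  proof of invariance under inversion.\<close>

lemma compactly_supported_proper:
  fixes f :: "'a::topological_group_add \<Rightarrow> real"
  assumes "compactly_supported f"
  shows "properly_supported (\<lambda>(x, y). f (- y + x))" "properly_supported (\<lambda>(x, y). f (x - y))"
    "properly_supported (\<lambda>(x, y). f (y + x))"
proof -
  obtain C where C: "compact C" "\<And>x. f x \<noteq> 0 \<Longrightarrow> x \<in> C" and f: "continuous_on UNIV f"
    using assms by (auto simp: compactly_supported_def)
  have cont: "continuous_on UNIV (\<lambda>(x, y). f (- y + x))" "continuous_on UNIV (\<lambda>(x, y). f (x - y))"
    "continuous_on UNIV (\<lambda>(x, y). f (y + x))"
    unfolding case_prod_beta'
    by (intro continuous_on_compose2[OF f] continuous_intros; simp)+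
  have L: "compact ((\<lambda>x. - x) ` L)" if "compact L" for L :: "'a set"
    using that by (intro compact_continuous_image continuous_intros)
  show "properly_supported (\<lambda>(x, y). f (- y + x))"
    unfolding properly_supported_def
  proof (intro conjI allI impI cont)
    fix L :: "'a set" assume "compact L"
    moreover have "x \<in> (\<lambda>(x, y). x + y) ` (L \<times> C)" if "y \<in> L" "f (- y + x) \<noteq> 0" for x y
      using that C(2)[of "- y + x"] by (intro image_eqI[of _ _ "(y, - y + x)"]) (auto simp: add.assoc[symmetric])
    ultimately show "\<exists>K. compact K \<and> (\<forall>x. \<forall>y\<in>L. (case (x, y) of (x, y) \<Rightarrow> f (- y + x)) \<noteq> 0 \<longrightarrow> x \<in> K)"
      using compact_plus[of L C] C(1) by (intro exI[of _ "(\<lambda>(x, y). x + y) ` (L \<times> C)"]) auto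
  qed
  show "properly_supported (\<lambda>(x, y). f (x - y))"
    unfolding properly_supported_def
  proof (intro conjI allI impI cont)
    fix L :: "'a set" assume "compact L"
    moreover have "x \<in> (\<lambda>(x, y). x + y) ` (C \<times> L)" if "y \<in> L" "f (x - y) \<noteq> 0" for x y
      using that C(2)[of "x - y"] by (intro image_eqI[of _ _ "(x - y, y)"]) auto
    ultimately show "\<exists>K. compact K \<and> (\<forall>x. \<forall>y\<in>L. (case (x, y) of (x, y) \<Rightarrow> f (x - y)) \<noteq> 0 \<longrightarrow> x \<in> K)"
      using compact_plus[of C L] C(1) by (intro exI[of _ "(\<lambda>(x, y). x + y) ` (C \<times> L)"]) auto
  qed
  show "properly_supported (\<lambda>(x, y). f (y + x))"
    unfolding properly_supported_def
  proof (intro conjI allI impI cont)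
    fix L :: "'a set" assume cL: "compact L"
    moreover have "x \<in> (\<lambda>(x, y). x + y) ` ((\<lambda>x. - x) ` L \<times> C)" if "y \<in> L" "f (y + x) \<noteq> 0" for x y
      using that C(2)[of "y + x"] by (intro image_eqI[of _ _ "(- y, y + x)"]) (auto simp: add.assoc[symmetric])
    ultimately show "\<exists>K. compact K \<and> (\<forall>x. \<forall>y\<in>L. (case (x, y) of (x, y) \<Rightarrow> f (y + x)) \<noteq> 0 \<longrightarrow> x \<in> K)"
      using compact_plus[OF L[OF cL] C(1)]
      by (intro exI[of _ "(\<lambda>(x, y). x + y) ` ((\<lambda>x. - x) ` L \<times> C)"]) auto
  qed
qed

context haar_group begin

lemma compactly_supported_measurable [measurable_dest]:
  "compactly_supported (f :: 'a \<Rightarrow> real) \<Longrightarrow> f \<in> borel_measurable borel"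
  by (auto simp: compactly_supported_def intro: borel_measurable_continuous_onI)

lemma compactly_supported_finite:
  fixes f :: "'a \<Rightarrow> real"
  assumes "compactly_supported f"
  shows "(\<integral>\<^sup>+ x. ennreal (f x) \<partial>M) < \<infinity>"
proof -
  obtain C where C: "compact C" "\<And>x. f x \<noteq> 0 \<Longrightarrow> x \<in> C"
    using assms by (auto simp: compactly_supported_def)
  obtain B where B: "0 < B" "\<And>x. \<bar>f x\<bar> \<le> B" using compactly_supported_bounded[OF assms] by blast
  have "(\<integral>\<^sup>+ x. ennreal (f x) \<partial>M) \<le> (\<integral>\<^sup>+ x. ennreal B * indicator C x \<partial>M)"
  proof (intro nn_integral_mono)
    fix x
    show "ennreal (f x) \<le> ennreal B * indicator C x"
      using C(2)[of x] B(2)[of x] by (cases "f x = 0") (auto simp: abs_le_iff intro!: ennreal_leI)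
  qed
  also have "\<dots> = ennreal B * emeasure M C" using C compact_borel by (intro nn_integral_cmult_indicator) auto
  also have "\<dots> < \<infinity>" using compact_finite[OF C(1)] by (simp add: ennreal_mult_less_top)
  finally show ?thesis .
qed

text \<open>\<open>f\<close> exceeds \<open>f a / 2\<close> on a nonempty open set, which has
  positive measure.\<close>

lemma compactly_supported_positive:
  fixes f :: "'a \<Rightarrow> real"
  assumes f: "compactly_supported f" and "0 < f a"
  shows "0 < (\<integral>\<^sup>+ x. ennreal (f x) \<partial>M)"
proof -
  have o: "open {x. f a / 2 < f x}"
    using f by (intro open_Collect_less) (auto simp: compactly_supported_def)
  have "0 < ennreal (f a / 2) * emeasure M {x. f a / 2 < f x}"
    using open_positive[OF o, of a] assms by (simp add: ennreal_zero_less_mult_iff)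
  also have "\<dots> = (\<integral>\<^sup>+ x. ennreal (f a / 2) * indicator {x. f a / 2 < f x} x \<partial>M)"
    using o by (intro nn_integral_cmult_indicator[symmetric]) auto
  also have "\<dots> \<le> (\<integral>\<^sup>+ x. ennreal (f x) \<partial>M)"
    by (intro nn_integral_mono) (auto intro!: ennreal_leI split: split_indicator)
  finally show ?thesis .
qed

end

section \<open>Convolution on unimodular groups\<close>

locale unimodular_haar_group = haar_group +
  assumes unimod: "unimodular M"
begin

lemma distr_right: "distr M borel (\<lambda>x. x + a) = M"
proof (rule measure_eqI)
  fix A assume "A \<in> sets (distr M borel (\<lambda>x. x + a))"
  then have A: "A \<in> sets borel" by simp
  have "(\<lambda>x. x + a) -` A = (\<lambda>x. x + - a) ` A" using image_add_right[of "- a" A] by simp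
  moreover have "emeasure M ((\<lambda>x. x + - a) ` A) = emeasure M A"
    using A unimod unfolding unimodular_def by blast
  ultimately show "emeasure (distr M borel (\<lambda>x. x + a)) A = emeasure M A"
    using A by (subst emeasure_distr) simp_all
qed simp

lemma nn_integral_right:
  assumes "f \<in> borel_measurable borel"
  shows "(\<integral>\<^sup>+ x. f (x + a) \<partial>M) = (\<integral>\<^sup>+ x. f x \<partial>M)"
  using nn_integral_distr[of "\<lambda>x. x + a" M borel f] assms by (simp add: distr_right)

text \<open>Both sides are computed from \<open>\<integral>\<integral> f (- x) g (x + y) dx dy\<close>.\<close>

lemma nn_integral_uminus_compactly_supported:
  fixes f :: "'a \<Rightarrow> real"
  assumes f: "compactly_supported f" and f0: "\<And>x. 0 \<le> f x"
  shows "(\<integral>\<^sup>+ x. ennreal (f (- x)) \<partial>M) = (\<integral>\<^sup>+ x. ennreal (f x) \<partial>M)"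
proof -
  obtain g :: "'a \<Rightarrow> real" where g: "compactly_supported g" "\<And>x. 0 \<le> g x" "g 0 = 1"
    by (metis Urysohn_compactly_supported[of "{0}" UNIV] compact_sing open_UNIV subset_UNIV singletonI)
  define G where "G = (\<integral>\<^sup>+ x. ennreal (g x) \<partial>M)"
  have G: "0 < G" "G < \<infinity>"
    unfolding G_def using compactly_supported_positive[OF g(1), of 0] g compactly_supported_finite by auto
  have [measurable]: "f \<in> borel_measurable borel" "g \<in> borel_measurable borel"
    using f g compactly_supported_measurable by auto
  have fm: "compactly_supported (\<lambda>x. f (- x))"
  proof -
    obtain C where C: "compact C" "\<And>x. f x \<noteq> 0 \<Longrightarrow> x \<in> C" and fc: "continuous_on UNIV f"
      using f by (auto simp: compactly_supported_def)
    have "compact ((\<lambda>x. - x) ` C)" using C by (intro compact_continuous_image continuous_intros)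
    moreover have "x \<in> (\<lambda>x. - x) ` C" if "f (- x) \<noteq> 0" for x
      using C(2)[OF that] by (intro image_eqI[of _ _ "- x"]) auto
    moreover have "continuous_on UNIV (\<lambda>x. f (- x))"
      by (intro continuous_on_compose2[OF fc] continuous_intros) auto
    ultimately show ?thesis unfolding compactly_supported_def by blast
  qed
  \<comment> \<open>By left invariance the inner integral of \<open>g (x + y)\<close> over
    \<open>y\<close> is \<open>G\<close> for every \<open>x\<close>.\<close>
  have "(\<integral>\<^sup>+ x. ennreal (f (- x)) \<partial>M) * G = (\<integral>\<^sup>+ x. ennreal (f (- x)) * (\<integral>\<^sup>+ y. ennreal (g (x + y)) \<partial>M) \<partial>M)"
    unfolding G_def by (simp add: nn_integral_left[of "\<lambda>x. ennreal (g x)"] nn_integral_multc)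
  also have "\<dots> = (\<integral>\<^sup>+ y. \<integral>\<^sup>+ x. ennreal (f (- x)) * ennreal (g (x + y)) \<partial>M \<partial>M)"
    using Tonelli_properly_supported[OF compactly_supported_proper(3)[OF g(1)], of "\<lambda>x. ennreal (f (- x))"]
      compactly_supported_finite[OF fm] by simp
  \<comment> \<open>Replacing \<open>x\<close> by \<open>x - y\<close>, by right invariance, moves
    \<open>y\<close> from \<open>g\<close> to \<open>f\<close>.\<close>
  also have "\<dots> = (\<integral>\<^sup>+ y. \<integral>\<^sup>+ x. ennreal (g x) * ennreal (f (y - x)) \<partial>M \<partial>M)"
  proof (rule nn_integral_cong)
    fix y
    have "(\<integral>\<^sup>+ x. ennreal (f (- x)) * ennreal (g (x + y)) \<partial>M)
        = (\<integral>\<^sup>+ x. ennreal (f (- (x + - y))) * ennreal (g ((x + - y) + y)) \<partial>M)"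
      by (subst nn_integral_right) auto
    also have "\<dots> = (\<integral>\<^sup>+ x. ennreal (g x) * ennreal (f (y - x)) \<partial>M)"
      by (simp add: minus_add mult.commute)
    finally show "(\<integral>\<^sup>+ x. ennreal (f (- x)) * ennreal (g (x + y)) \<partial>M)
        = (\<integral>\<^sup>+ x. ennreal (g x) * ennreal (f (y - x)) \<partial>M)" .
  qed
  also have "\<dots> = (\<integral>\<^sup>+ x. ennreal (g x) * (\<integral>\<^sup>+ y. ennreal (f (y - x)) \<partial>M) \<partial>M)"
    using Tonelli_properly_supported[OF compactly_supported_proper(2)[OF f], of "\<lambda>x. ennreal (g x)"]
      G unfolding G_def by simp
  also have "\<dots> = G * (\<integral>\<^sup>+ x. ennreal (f x) \<partial>M)"
    unfolding G_def diff_conv_add_uminus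
    by (simp add: nn_integral_right[of "\<lambda>x. ennreal (f x)"] nn_integral_multc del: add_uminus_conv_diff)
  finally show ?thesis using G by (auto simp: mult.commute ennreal_mult_cancel_left)
qed

text \<open>A bump that is 1 on \<open>K\<close> and supported in \<open>U\<close> is reflected to
  one supported in \<open>- U\<close> with the same integral.\<close>

lemma emeasure_uminus_open_le:
  fixes U :: "'a set"
  assumes "open U" shows "emeasure M U \<le> emeasure M ((\<lambda>x. - x) ` U)"
  unfolding inner_regular[OF assms]
proof (rule SUP_least)
  fix K assume "K \<in> {K. compact K \<and> K \<subseteq> U}"
  then obtain f :: "'a \<Rightarrow> real" where f: "compactly_supported f" "\<And>x. 0 \<le> f x" "\<And>x. f x \<le> 1"
    "\<And>x. x \<in> K \<Longrightarrow> f x = 1" "\<And>x. f x \<noteq> 0 \<Longrightarrow> x \<in> U" and K: "compact K"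
    using Urysohn_compactly_supported[of K U] assms by auto
  have "emeasure M K = (\<integral>\<^sup>+ x. indicator K x \<partial>M)" using K compact_borel by simp
  also have "\<dots> \<le> (\<integral>\<^sup>+ x. ennreal (f x) \<partial>M)"
    using f by (intro nn_integral_mono) (auto split: split_indicator)
  also have "\<dots> = (\<integral>\<^sup>+ x. ennreal (f (- x)) \<partial>M)"
    using f by (simp add: nn_integral_uminus_compactly_supported)
  also have "\<dots> \<le> (\<integral>\<^sup>+ x. indicator ((\<lambda>x. - x) ` U) x \<partial>M)"
  proof (intro nn_integral_mono)
    fix x
    have "x \<in> (\<lambda>x. - x) ` U" if "f (- x) \<noteq> 0"
      using f(5)[OF that] by (intro image_eqI[of _ _ "- x"]) auto
    then show "ennreal (f (- x)) \<le> indicator ((\<lambda>x. - x) ` U) x"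
      using f(3)[of "- x"] by (cases "f (- x) = 0") (auto simp: ennreal_le_1)
  qed
  also have "\<dots> = emeasure M ((\<lambda>x. - x) ` U)"
    using image_uminus_borel[of U] assms by (intro nn_integral_indicator) auto
  finally show "emeasure M K \<le> emeasure M ((\<lambda>x. - x) ` U)" .
qed

text \<open>Outer regularity reduces this to open \<open>U\<close>, where the previous inequality is
  applied to \<open>- U\<close>.\<close>

lemma emeasure_uminus_le:
  fixes A :: "'a set"
  assumes "A \<in> sets borel" shows "emeasure M ((\<lambda>x. - x) ` A) \<le> emeasure M A"
  unfolding outer_regular[OF assms]
proof (rule INF_greatest)
  fix U assume U: "U \<in> {U. open U \<and> A \<subseteq> U}"
  then have "open ((\<lambda>x. - x) ` U)"
    unfolding image_uminus_vimage by (intro open_vimage continuous_intros) auto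
  then have "emeasure M ((\<lambda>x. - x) ` U) \<le> emeasure M U"
    using emeasure_uminus_open_le[of "(\<lambda>x. - x) ` U"] by (simp add: image_image)
  moreover have "emeasure M ((\<lambda>x. - x) ` A) \<le> emeasure M ((\<lambda>x. - x) ` U)"
    using U image_uminus_borel[of U] by (intro emeasure_mono image_mono) auto
  ultimately show "emeasure M ((\<lambda>x. - x) ` A) \<le> emeasure M U" by simp
qed

text \<open>Inversion is an involution, so the inequality for \<open>- A\<close> is the reverse of
  the one for \<open>A\<close>.\<close>

lemma emeasure_uminus:
  fixes A :: "'a set"
  assumes "A \<in> sets borel" shows "emeasure M ((\<lambda>x. - x) ` A) = emeasure M A"
  using emeasure_uminus_le[OF assms] emeasure_uminus_le[OF image_uminus_borel[OF assms]]
  by (simp add: image_image)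

lemma distr_uminus: "distr M borel (\<lambda>x. - x) = M"
proof (rule measure_eqI)
  fix A assume "A \<in> sets (distr M borel (\<lambda>x. - x))"
  then have A: "A \<in> sets borel" by simp
  then show "emeasure (distr M borel (\<lambda>x. - x)) A = emeasure M A"
    using emeasure_uminus[OF A] by (subst emeasure_distr) (auto simp: image_uminus_vimage)
qed simp

lemma distr_reflect: "distr M borel (\<lambda>y. - y + x) = M" "distr M borel (\<lambda>y. x - y) = M"
proof -
  have "distr M borel (\<lambda>y. - y + x) = distr (distr M borel (\<lambda>y. - y)) borel (\<lambda>y. y + x)"
    by (subst distr_distr) (auto simp: o_def)
  then show "distr M borel (\<lambda>y. - y + x) = M" by (simp add: distr_uminus distr_right)
  have "distr M borel (\<lambda>y. x - y) = distr (distr M borel (\<lambda>y. - y)) borel (\<lambda>y. x + y)"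
    by (subst distr_distr) (auto simp: o_def)
  then show "distr M borel (\<lambda>y. x - y) = M" by (simp add: distr_uminus distr_left)
qed

lemma nn_integral_reflect:
  assumes "f \<in> borel_measurable borel"
  shows "(\<integral>\<^sup>+ y. f (- y + x) \<partial>M) = (\<integral>\<^sup>+ x. f x \<partial>M)" "(\<integral>\<^sup>+ y. f (x - y) \<partial>M) = (\<integral>\<^sup>+ x. f x \<partial>M)"
  using nn_integral_distr[of "\<lambda>y. - y + x" M borel f] nn_integral_distr[of "\<lambda>y. x - y" M borel f] assms
  by (simp_all add: distr_reflect)

text \<open>The map \<open>y \<mapsto> - y + x\<close> preserves the measure, so null sets pull back
  to null sets. Hence changing the right factor on a null set affects the convolution at no point at
  all.\<close>

lemma haar_conv_cong_AE:
  fixes f f' g :: "'a \<Rightarrow> complex"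
  assumes [measurable]: "g \<in> borel_measurable M" "f \<in> borel_measurable M" "f' \<in> borel_measurable M"
    and ae: "AE x in M. f x = f' x"
  shows "haar_conv M g f x = haar_conv M g f' x"
    "integrable M (\<lambda>y. g y * f (- y + x)) \<longleftrightarrow> integrable M (\<lambda>y. g y * f' (- y + x))"
proof -
  have [measurable]: "g \<in> borel_measurable borel" "f \<in> borel_measurable borel" "f' \<in> borel_measurable borel"
    using assms by auto
  have "AE y in distr M borel (\<lambda>y. - y + x). f y = f' y" using ae by (subst distr_reflect)
  then have "AE y in M. f (- y + x) = f' (- y + x)" by (rule AE_distrD[rotated]) simp
  then have ae': "AE y in M. g y * f (- y + x) = g y * f' (- y + x)" by eventually_elim simp
  show "haar_conv M g f x = haar_conv M g f' x"
    unfolding haar_conv_def by (intro integral_cong_AE ae') auto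
  show "integrable M (\<lambda>y. g y * f (- y + x)) \<longleftrightarrow> integrable M (\<lambda>y. g y * f' (- y + x))"
    by (intro integrable_cong_AE ae') auto
qed

lemma LpT_enorm_cong_AE:
  assumes "f \<in> borel_measurable M" "f' \<in> borel_measurable M" "AE x in M. f x = f' x"
  shows "LpT_enorm p M f = LpT_enorm p M f'"
proof -
  have "haar_conv M g f = haar_conv M g f'" if "g \<in> Lp_space p M" for g
    using haar_conv_cong_AE(1)[OF Lp_space_measurable[OF that] assms] by auto
  then show ?thesis unfolding LpT_enorm_def by (intro SUP_cong) auto
qed

text \<open>The integrand is dominated by \<open>w + B * norm u powr p\<close>, since
  \<open>t \<le> 1 + t powr p\<close>.\<close>

lemma integrable_mult_bounded:
  fixes u :: "'a \<Rightarrow> complex" and w :: "'a \<Rightarrow> real"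
  assumes p: "1 < p" and u: "u \<in> Lp_space p M" and w[measurable]: "w \<in> borel_measurable borel"
    and wB: "\<And>x. 0 \<le> w x" "\<And>x. w x \<le> B" and fin: "(\<integral>\<^sup>+ x. ennreal (w x) \<partial>M) < \<infinity>"
  shows "integrable M (\<lambda>y. u y * of_real (w y))"
proof (rule integrableI_bounded)
  have um[measurable]: "u \<in> borel_measurable borel" using Lp_space_measurable[OF u] by simp
  show "(\<lambda>y. u y * of_real (w y)) \<in> borel_measurable M" by simp
  have B: "0 \<le> B" using wB[of undefined] by simp
  have "(\<integral>\<^sup>+ y. ennreal (norm (u y * of_real (w y))) \<partial>M)
      \<le> (\<integral>\<^sup>+ y. ennreal (w y) + ennreal B * ennreal (norm (u y) powr p) \<partial>M)"
  proof (intro nn_integral_mono)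
    fix y
    have "norm (u y) \<le> 1 + norm (u y) powr p"
      using p by (intro le_one_plus_powr) auto
    then have "norm (u y) * w y \<le> (1 + norm (u y) powr p) * w y"
      using wB by (intro mult_right_mono) auto
    also have "\<dots> \<le> w y + B * norm (u y) powr p"
      using mult_right_mono[OF wB(2)[of y], of "norm (u y) powr p"] by (simp add: algebra_simps)
    finally have "ennreal (norm (u y) * w y) \<le> ennreal (w y + B * norm (u y) powr p)"
      by (intro ennreal_leI)
    then show "ennreal (norm (u y * of_real (w y))) \<le> ennreal (w y) + ennreal B * ennreal (norm (u y) powr p)"
      using wB B by (simp add: norm_mult ennreal_mult)
  qed
  also have "\<dots> = (\<integral>\<^sup>+ y. ennreal (w y) \<partial>M) + ennreal B * (\<integral>\<^sup>+ y. ennreal (norm (u y) powr p) \<partial>M)"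
    by (subst nn_integral_add) (auto simp: nn_integral_cmult)
  also have "\<dots> < \<infinity>" using fin Lp_space_finite[OF u] unfolding Lp_enorm_finite_iff
    by (simp add: ennreal_mult_less_top)
  finally show "(\<integral>\<^sup>+ y. ennreal (norm (u y * of_real (w y))) \<partial>M) < \<infinity>" .
qed

section \<open>Convolution with nonnegative compactly supported functions\<close>

lemma conv_compactly_supported_right:
  fixes f :: "'a \<Rightarrow> real" and g :: "'a \<Rightarrow> complex"
  assumes p: "1 < p" and f: "compactly_supported f" "\<And>x. 0 \<le> f x"
    and W: "(\<integral>\<^sup>+ x. ennreal (f x) \<partial>M) = ennreal W" "0 < W" and g: "g \<in> Lp_space p M"
  shows "integrable M (\<lambda>y. g y * of_real (f (- y + x)))"
    "haar_conv M g (\<lambda>x. of_real (f x)) \<in> borel_measurable borel"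
    "Lp_enorm p M (haar_conv M g (\<lambda>x. of_real (f x))) \<le> ennreal W * Lp_enorm p M g"
proof -
  have [measurable]: "f \<in> borel_measurable borel" using f compactly_supported_measurable by auto
  obtain B where B: "\<And>x. \<bar>f x\<bar> \<le> B" using compactly_supported_bounded[OF f(1)] by blast
  have W1: "(\<integral>\<^sup>+ y. ennreal (f (- y + x)) \<partial>M) = ennreal W" for x
    using nn_integral_reflect(1)[of "\<lambda>x. ennreal (f x)" x] W by simp
  have W2: "(\<integral>\<^sup>+ x. ennreal (f (- y + x)) \<partial>M) = ennreal W" for y
    using nn_integral_left[of "\<lambda>x. ennreal (f x)" "- y"] W by simp
  show "integrable M (\<lambda>y. g y * of_real (f (- y + x)))"
    using B f W1[of x] by (intro integrable_mult_bounded[OF p g, of _ B]) (auto simp: abs_le_iff)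
  have eq: "haar_conv M g (\<lambda>x. of_real (f x))
      = (\<lambda>x. LINT y|M. g y * of_real (case (x, y) of (x, y) \<Rightarrow> f (- y + x)))"
    by (auto simp: haar_conv_def)
  show "haar_conv M g (\<lambda>x. of_real (f x)) \<in> borel_measurable borel"
    unfolding eq by (rule measurable_properly_supported_integral[OF compactly_supported_proper(1)[OF f(1)] g])
  show "Lp_enorm p M (haar_conv M g (\<lambda>x. of_real (f x))) \<le> ennreal W * Lp_enorm p M g"
    unfolding eq using f W W1 W2
    by (intro Lp_enorm_kernel_le[OF p compactly_supported_proper(1)[OF f(1)] _ g]) auto
qed

text \<open>Substituting \<open>x - y\<close> for \<open>y\<close> turns the convolution into an
  integral of \<open>u y\<close> against the kernel \<open>g (x - y)\<close>, whose mass is constant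
  in \<open>y\<close> by reflection and in \<open>x\<close> by right invariance.\<close>

lemma conv_compactly_supported_left:
  fixes g :: "'a \<Rightarrow> real" and u :: "'a \<Rightarrow> complex"
  assumes p: "1 < p" and g: "compactly_supported g" "\<And>x. 0 \<le> g x"
    and W: "(\<integral>\<^sup>+ x. ennreal (g x) \<partial>M) = ennreal W" "0 < W" and u: "u \<in> Lp_space p M"
  shows "integrable M (\<lambda>y. of_real (g y) * u (- y + x))"
    "haar_conv M (\<lambda>x. of_real (g x)) u \<in> borel_measurable borel"
    "Lp_enorm p M (haar_conv M (\<lambda>x. of_real (g x)) u) \<le> ennreal W * Lp_enorm p M u"
proof -
  have [measurable]: "g \<in> borel_measurable borel" "u \<in> borel_measurable borel"
    using g compactly_supported_measurable Lp_space_measurable[OF u] by auto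
  obtain B where B: "\<And>x. \<bar>g x\<bar> \<le> B" using compactly_supported_bounded[OF g(1)] by blast
  have W1: "(\<integral>\<^sup>+ y. ennreal (g (x - y)) \<partial>M) = ennreal W" for x
    using nn_integral_reflect(2)[of "\<lambda>x. ennreal (g x)" x] W by simp
  have W2: "(\<integral>\<^sup>+ x. ennreal (g (x - y)) \<partial>M) = ennreal W" for y
    using nn_integral_right[of "\<lambda>x. ennreal (g x)" "- y"] W by simp
  have int: "integrable M (\<lambda>y. u y * of_real (g (x - y)))" for x
    using B g W1[of x] by (intro integrable_mult_bounded[OF p u, of _ B]) (auto simp: abs_le_iff)
  have flip: "of_real (g (x - y)) * u (- (x - y) + x) = u y * of_real (g (x - y))" for x y
    by (simp add: mult.commute)
  have "integrable (distr M borel (\<lambda>y. x - y)) (\<lambda>y. of_real (g y) * u (- y + x))"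
    using int[of x] by (subst integrable_distr_eq, simp, simp) (simp only: flip)
  then show "integrable M (\<lambda>y. of_real (g y) * u (- y + x))" by (simp add: distr_reflect)
  have "haar_conv M (\<lambda>x. of_real (g x)) u x = (LINT y|M. u y * of_real (g (x - y)))" for x
  proof -
    have "haar_conv M (\<lambda>x. of_real (g x)) u x
        = (LINT y|distr M borel (\<lambda>y. x - y). of_real (g y) * u (- y + x))"
      by (simp add: haar_conv_def distr_reflect)
    also have "\<dots> = (LINT y|M. of_real (g (x - y)) * u (- (x - y) + x))"
      by (rule integral_distr) auto
    finally show ?thesis by (simp only: flip)
  qed
  then have eq: "haar_conv M (\<lambda>x. of_real (g x)) u
      = (\<lambda>x. LINT y|M. u y * of_real (case (x, y) of (x, y) \<Rightarrow> g (x - y)))"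
    by auto
  show "haar_conv M (\<lambda>x. of_real (g x)) u \<in> borel_measurable borel"
    unfolding eq by (rule measurable_properly_supported_integral[OF compactly_supported_proper(2)[OF g(1)] u])
  show "Lp_enorm p M (haar_conv M (\<lambda>x. of_real (g x)) u) \<le> ennreal W * Lp_enorm p M u"
    unfolding eq using g W W1 W2
    by (intro Lp_enorm_kernel_le[OF p compactly_supported_proper(2)[OF g(1)] _ u]) auto
qed

end

section \<open>Nondiscrete groups\<close>

lemma haar_conv_cmult_left: "haar_conv M (\<lambda>x. a * g x) f = (\<lambda>x. a * haar_conv M g f x)"
  by (rule ext) (simp add: haar_conv_def mult.assoc)

lemma haar_conv_cmult_right: "haar_conv M g (\<lambda>x. a * f x) = (\<lambda>x. a * haar_conv M g f x)"
  by (rule ext) (simp add: haar_conv_def mult.left_commute[of _ a])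

lemma haar_conv_add_right:
  assumes "integrable M (\<lambda>y. g y * f (- y + x))" "integrable M (\<lambda>y. g y * f' (- y + x))"
  shows "haar_conv M g (\<lambda>x. f x + f' x) x = haar_conv M g f x + haar_conv M g f' x"
  using assms by (simp add: haar_conv_def distrib_left)

text \<open>Scale \<open>g\<close> to norm 1. If its norm is 0, then \<open>g\<close> vanishes
  almost everywhere and the convolution is 0 at every point.\<close>

lemma Lp_enorm_haar_conv_le:
  assumes p: "0 < p" and g: "g \<in> Lp_space p M" and meas: "haar_conv M g f \<in> borel_measurable M"
  shows "Lp_enorm p M (haar_conv M g f) \<le> LpT_enorm p M f * Lp_enorm p M g"
proof -
  note gm[measurable] = Lp_space_measurable[OF g]
  obtain C where C: "0 \<le> C" "Lp_enorm p M g = ennreal C"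
    using Lp_space_finite[OF g] by (cases p M g rule: Lp_enorm_ennreal_cases) auto
  show ?thesis
  proof (cases "C = 0")
    case True
    then have "(\<integral>\<^sup>+ x. ennreal (norm (g x) powr p) \<partial>M) = 0"
      using Lp_enorm_powr[OF p C] by simp
    then have "AE x in M. ennreal (norm (g x) powr p) = 0"
      by (subst (asm) nn_integral_0_iff_AE) auto
    then have "AE y in M. g y = 0" by eventually_elim simp
    then have "haar_conv M g f x = 0" for x
      unfolding haar_conv_def by (intro integral_eq_zero_AE) (auto elim: eventually_mono)
    then have "haar_conv M g f = (\<lambda>_. 0)" by auto
    then show ?thesis by (simp add: Lp_enorm_zero)
  next
    case False
    define g' where "g' = (\<lambda>x. of_real (inverse C) * g x)"
    have "Lp_enorm p M g' = 1"
      unfolding g'_def using p C False by (subst Lp_enorm_cmult) (auto simp: ennreal_mult[symmetric] norm_inverse)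
    then have g': "g' \<in> {g \<in> Lp_space p M. Lp_enorm p M g \<le> 1}"
      unfolding g'_def using Lp_space_cmult[OF p g] by auto
    have "haar_conv M g f = (\<lambda>x. of_real C * haar_conv M g' f x)"
      unfolding g'_def haar_conv_cmult_left using False by (auto simp: mult.assoc[symmetric])
    then have "Lp_enorm p M (haar_conv M g f) = Lp_enorm p M (\<lambda>x. of_real C * haar_conv M g' f x)" by simp
    also have "\<dots> = ennreal C * Lp_enorm p M (haar_conv M g' f)"
      using p C meas unfolding g'_def haar_conv_cmult_left by (subst Lp_enorm_cmult) auto
    also have "\<dots> \<le> ennreal C * LpT_enorm p M f"
      unfolding LpT_enorm_def using g' by (intro mult_left_mono SUP_upper) auto
    finally show ?thesis using C by (simp add: mult.commute)
  qed
qed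

lemma LpT_enorm_uminus: "LpT_enorm p M (\<lambda>x. - f x) = LpT_enorm p M f"
proof -
  have "Lp_enorm p M (haar_conv M g (\<lambda>x. - f x)) = Lp_enorm p M (haar_conv M g f)" for g
    using haar_conv_cmult_right[of M g "-1" f] by (intro Lp_enorm_cong_AE) auto
  then show ?thesis by (simp add: LpT_enorm_def)
qed

section \<open>Classes modulo null sets\<close>

lemma ae_rep_class:
  assumes "f \<in> borel_measurable M"
  shows "ae_rep (ae_class M f) \<in> borel_measurable M" "AE x in M. ae_rep (ae_class M f) x = f x"
proof -
  have "f \<in> ae_class M f" using assms by (simp add: ae_class_def)
  then have "ae_rep (ae_class M f) \<in> ae_class M f" unfolding ae_rep_def by (rule someI[of "\<lambda>h. h \<in> ae_class M f"])
  then show "ae_rep (ae_class M f) \<in> borel_measurable M" "AE x in M. ae_rep (ae_class M f) x = f x"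
    by (auto simp: ae_class_def)
qed

lemma ae_class_cong:
  assumes "AE x in M. f x = f' x"
  shows "ae_class M f = ae_class M f'"
proof -
  have "(AE x in M. h x = f x) \<longleftrightarrow> (AE x in M. h x = f' x)" for h
  proof
    show "AE x in M. h x = f' x" if "AE x in M. h x = f x" using that assms by eventually_elim simp
    show "AE x in M. h x = f x" if "AE x in M. h x = f' x" using that assms by eventually_elim simp
  qed
  then show ?thesis by (simp add: ae_class_def)
qed

text \<open>The left side is the difference of two classes exactly as the completeness axiom of
  \<open>complex_banach_algebra\<close> writes it.\<close>

lemma ae_class_diff:
  fixes f g :: "'a \<Rightarrow> complex"
  assumes [measurable]: "f \<in> borel_measurable M" "g \<in> borel_measurable M"
  shows "ae_class M (\<lambda>x. ae_rep (ae_class M f) x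
      + ae_rep (ae_class M (\<lambda>x. - 1 * ae_rep (ae_class M g) x)) x) = ae_class M (\<lambda>x. f x - g x)"
proof (rule ae_class_cong)
  note [measurable] = ae_rep_class(1)[OF assms(2)]
  have m: "(\<lambda>x. - 1 * ae_rep (ae_class M g) x) \<in> borel_measurable M" by measurable
  show "AE x in M. ae_rep (ae_class M f) x
      + ae_rep (ae_class M (\<lambda>x. - 1 * ae_rep (ae_class M g) x)) x = f x - g x"
    using ae_rep_class(2)[OF assms(1)] ae_rep_class(2)[OF assms(2)] ae_rep_class(2)[OF m]
    by eventually_elim simp
qed

lemma compactly_supported_cmult:
  assumes "compactly_supported f" shows "compactly_supported (\<lambda>x. c * f x)"
  using assms unfolding compactly_supported_def by (auto intro!: continuous_intros)

lemma compactly_supported_add: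
  assumes "compactly_supported f" "compactly_supported g"
  shows "compactly_supported (\<lambda>x. f x + g x)"
proof -
  obtain C D where "compact C" "\<forall>x. f x \<noteq> 0 \<longrightarrow> x \<in> C" "compact D" "\<forall>x. g x \<noteq> 0 \<longrightarrow> x \<in> D"
    using assms by (auto simp: compactly_supported_def)
  then have "compact (C \<union> D) \<and> (\<forall>x. f x + g x \<noteq> 0 \<longrightarrow> x \<in> C \<union> D)"
    by (auto simp: compact_Un) (metis add_0)
  moreover have "continuous_on UNIV (\<lambda>x. f x + g x)"
    using assms unfolding compactly_supported_def by (auto intro!: continuous_intros)
  ultimately show ?thesis unfolding compactly_supported_def by blast
qed

lemma compactly_supported_sum:
  assumes "\<And>i. i \<in> I \<Longrightarrow> compactly_supported (f i)"
  shows "compactly_supported (\<lambda>x. \<Sum>i\<in>I. f i x)"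
  using assms
proof (induction I rule: infinite_finite_induct)
  case (insert i I)
  then show ?case using compactly_supported_add[of "f i" "\<lambda>x. \<Sum>i\<in>I. f i x"] by simp
qed (auto simp: compactly_supported_def)

context haar_group begin

text \<open>If \<open>{0}\<close> had positive measure, all points would have the same positive
  measure. Compact neighbourhoods would then be finite and, the space being Hausdorff, points open.
  So \<open>{0}\<close> is null, and outer regularity gives \<open>U\<close>.\<close>

lemma not_discrete_small_open:
  assumes nd: "(euclidean :: 'a topology) \<noteq> discrete_topology UNIV" and e: "0 < e"
  obtains U :: "'a set" where "open U" "0 \<in> U" "emeasure M U < e"
proof -
  have z: "emeasure M {0} = 0"
  proof (rule ccontr)
    assume pos: "emeasure M {0} \<noteq> 0"
    obtain U K where UK: "open U" "compact K" "(0::'a) \<in> U" "U \<subseteq> K" by (rule ex_compact_nbhd)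
    have pt: "emeasure M {a} = emeasure M {0}" for a
      using left_inv[of "{0}" a] by simp
    have "finite K"
    proof (rule ccontr)
      assume inf: "infinite K"
      have "of_nat n * emeasure M {0} \<le> emeasure M K" for n :: nat
      proof -
        obtain F where F: "finite F" "card F = n" "F \<subseteq> K"
          using infinite_arbitrarily_large[OF inf, of n] by blast
        have "of_nat n * emeasure M {0} = (\<Sum>a\<in>F. emeasure M {0})" using F by simp
        also have "\<dots> = (\<Sum>a\<in>F. emeasure M {a})" by (intro sum.cong refl pt[symmetric])
        also have "\<dots> = emeasure M F" using F by (intro emeasure_eq_sum_singleton[symmetric]) auto
        also have "\<dots> \<le> emeasure M K" using F UK compact_borel by (intro emeasure_mono) auto
        finally show ?thesis .
      qed
      then have "(SUP n. of_nat n * emeasure M {0}) \<le> emeasure M K" by (intro SUP_least)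
      then have "(SUP n::nat. of_nat n) * emeasure M {0} \<le> emeasure M K" by (simp add: SUP_mult_right_ennreal)
      then have "emeasure M K = \<infinity>" using pos by (simp add: ennreal_SUP_of_nat_eq_top ennreal_top_mult top_unique)
      then show False using compact_finite[OF UK(2)] by simp
    qed
    then have "finite U" using UK finite_subset by auto
    then have "open (U - (U - {0}))" using UK by (intro open_Diff finite_imp_closed) auto
    moreover have "U - (U - {0}) = {0}" using UK by auto
    ultimately have o0: "open {0::'a}" by simp
    have oa: "open {a}" for a :: 'a
    proof -
      have "open ((\<lambda>z. - a + z) -` {0})" by (intro open_vimage o0 continuous_intros)
      also have "(\<lambda>z. - a + z) -` {0} = {a}" by (auto dest: minus_unique)
      finally show ?thesis .
    qed
    have "open S" for S :: "'a set" using open_UN[of S "\<lambda>a. {a}"] oa by simp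
    then have "(euclidean :: 'a topology) = discrete_topology UNIV"
      by (simp add: topology_eq)
    then show False using nd by simp
  qed
  then show thesis using ex_open_between[of "{0}" e] e that by auto
qed

text \<open>With \<open>f = c \<cdot> \<phi>\<close>, where \<open>\<phi>\<close> is a bump function with support of small measure \<open>m\<close>, the
  \<open>L\<^sup>1\<close> norm of \<open>f\<close> is about \<open>c \<cdot> m\<close> and the \<open>p\<close>-th power of its \<open>L\<^sup>p\<close> norm about \<open>c\<^sup>p \<cdot> m\<close>.\<close>

lemma ex_tall_bump:
  assumes nd: "(euclidean :: 'a topology) \<noteq> discrete_topology UNIV"
    and p: "1 < p" and eta: "0 < \<eta>" and N: "0 < N"
  obtains f :: "'a \<Rightarrow> real" and W c K V where "compactly_supported f" "\<And>x. 0 \<le> f x"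
    "(\<integral>\<^sup>+ x. ennreal (f x) \<partial>M) = ennreal W" "0 < W" "W \<le> \<eta>" "0 < c" "compact K"
    "ennreal N \<le> ennreal (c powr p) * emeasure M K" "open V" "0 \<in> V"
    "\<And>x y. x \<in> K \<Longrightarrow> y \<in> V \<Longrightarrow> c \<le> f (- y + x)"
proof -
  \<comment> \<open>Solves \<open>(d / 2) powr p * (m / 2) = N\<close> for \<open>m\<close>, where
    \<open>d = \<eta> / m\<close>; a smaller \<open>m\<close> makes the left side larger.\<close>
  define e where "e = (\<eta> powr p / (N * 2 powr (p + 1))) powr (1 / (p - 1))"
  have e: "0 < e" using eta N by (simp add: e_def)
  have "0 < ennreal e" using e by simp
  then obtain U :: "'a set" where U: "open U" "0 \<in> U" "emeasure M U < ennreal e"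
    by (rule not_discrete_small_open[OF nd])
  obtain m where m: "0 \<le> m" "emeasure M U = ennreal m" using U by (cases "emeasure M U") auto
  have m0: "0 < m" "m < e" using open_positive[OF U(1,2)] U(3) m by (auto simp: ennreal_less_iff)
  \<comment> \<open>\<open>K\<close> is to carry at least half of the measure of
    \<open>U\<close>.\<close>
  have "ennreal (m / 2) < emeasure M U" using m0 m by (simp add: ennreal_less_iff)
  then obtain K where K: "compact K" "K \<subseteq> U" "ennreal (m / 2) < emeasure M K"
    by (rule ex_compact_between[OF U(1)])
  obtain \<phi> :: "'a \<Rightarrow> real" where \<phi>: "compactly_supported \<phi>" "\<And>x. 0 \<le> \<phi> x" "\<And>x. \<phi> x \<le> 1"
    "\<And>x. x \<in> K \<Longrightarrow> \<phi> x = 1" "\<And>x. \<phi> x \<noteq> 0 \<Longrightarrow> x \<in> U"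
    by (rule Urysohn_compactly_supported[OF K(1) U(1) K(2)], rule that)
  have [measurable]: "\<phi> \<in> borel_measurable borel" using \<phi> compactly_supported_measurable by auto
  have \<phi>c: "continuous_on UNIV \<phi>" using \<phi> by (simp add: compactly_supported_def)
  \<comment> \<open>\<open>\<phi>\<close> is 1 on \<open>K\<close>, so the threshold 1/2 leaves an
    open set of pairs around \<open>{0} \<times> K\<close>. The guaranteed height is halved in
    return, which is why \<open>c\<close> will be \<open>d / 2\<close>.\<close>
  have "open {z. 1 / 2 < \<phi> (- fst z + snd z)}"
    by (intro open_Collect_less continuous_on_compose2[OF \<phi>c] continuous_intros) auto
  moreover have "{0} \<times> K \<subseteq> {z. 1 / 2 < \<phi> (- fst z + snd z)}" using \<phi>(4) by auto
  ultimately obtain V where V: "open V" "0 \<in> V" "V \<times> K \<subseteq> {z. 1 / 2 < \<phi> (- fst z + snd z)}"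
    by (rule compact_tube[OF K(1)])
  have "(\<integral>\<^sup>+ x. ennreal (\<phi> x) \<partial>M) \<le> (\<integral>\<^sup>+ x. indicator U x \<partial>M)"
  proof (intro nn_integral_mono)
    fix x show "ennreal (\<phi> x) \<le> indicator U x"
      using \<phi>(3)[of x] \<phi>(5)[of x] by (cases "\<phi> x = 0") auto
  qed
  also have "\<dots> = ennreal m" using U m by simp
  finally obtain w where w: "0 \<le> w" "(\<integral>\<^sup>+ x. ennreal (\<phi> x) \<partial>M) = ennreal w" "w \<le> m"
    by (cases "(\<integral>\<^sup>+ x. ennreal (\<phi> x) \<partial>M)") (auto simp: m top_unique)
  have "K \<noteq> {}" using K(3) by auto
  then obtain a where "a \<in> K" by auto
  then have w0: "0 < w" using compactly_supported_positive[OF \<phi>(1), of a] \<phi>(4)[of a] w by auto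
  \<comment> \<open>The integral of \<open>d * \<phi>\<close> is at most
    \<open>d * m = \<eta>\<close>.\<close>
  define d where "d = \<eta> / m"
  have d: "0 < d" using eta m0 by (simp add: d_def)
  have "d * w \<le> d * m" using w d by (intro mult_left_mono) auto
  then have dw: "d * w \<le> \<eta>" using m0 by (simp add: d_def)
  have "m powr (p - 1) \<le> e powr (p - 1)" using m0 p by (intro powr_mono2) auto
  also have "\<dots> = \<eta> powr p / (N * 2 powr (p + 1))" using p eta N by (simp add: e_def powr_powr)
  finally have "N * (2 powr (p + 1) * m powr (p - 1)) \<le> \<eta> powr p" using N by (simp add: field_simps)
  then have "N \<le> \<eta> powr p / (2 powr (p + 1) * m powr (p - 1))" using m0 by (simp add: pos_le_divide_eq)
  also have "\<dots> = (d / 2) powr p * (m / 2)"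
    using m0 eta by (simp add: d_def powr_divide powr_mult powr_add powr_diff)
  finally have "ennreal N \<le> ennreal ((d / 2) powr p * (m / 2))" by (rule ennreal_leI)
  also have "\<dots> = ennreal ((d / 2) powr p) * ennreal (m / 2)" using m0 by (intro ennreal_mult) auto
  also have "\<dots> \<le> ennreal ((d / 2) powr p) * emeasure M K" using K by (intro mult_left_mono) auto
  finally have NK: "ennreal N \<le> ennreal ((d / 2) powr p) * emeasure M K" .
  have low: "d / 2 \<le> d * \<phi> (- y + x)" if "x \<in> K" "y \<in> V" for x y
  proof -
    have "(y, x) \<in> {z. 1 / 2 < \<phi> (- fst z + snd z)}" using V(3) that by blast
    then show ?thesis using d by simp
  qed
  show thesis
  proof (rule that[OF compactly_supported_cmult[OF \<phi>(1), of d] _ _ _ dw _ K(1) NK V(1,2) low])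
    show "0 \<le> d * \<phi> x" for x using d \<phi> by simp
    show "(\<integral>\<^sup>+ x. ennreal (d * \<phi> x) \<partial>M) = ennreal (d * w)"
      using d \<phi> w by (simp add: ennreal_mult nn_integral_cmult)
    show "0 < d * w" "0 < d / 2" using d w0 by simp_all
  qed
qed

end

context unimodular_haar_group begin

lemma compactly_supported_Lp:
  fixes f :: "'a \<Rightarrow> real"
  assumes p: "1 < p" and f: "compactly_supported f" "\<And>x. 0 \<le> f x"
  shows "(\<lambda>x. complex_of_real (f x)) \<in> Lp_space p M"
proof (rule Lp_spaceI)
  have [measurable]: "f \<in> borel_measurable borel" using f compactly_supported_measurable by auto
  show "(\<lambda>x. complex_of_real (f x)) \<in> borel_measurable M" by simp
  obtain B where B: "0 < B" "\<And>x. \<bar>f x\<bar> \<le> B" using compactly_supported_bounded[OF f(1)] by blast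
  have "(\<integral>\<^sup>+ x. ennreal (norm (complex_of_real (f x)) powr p) \<partial>M)
      \<le> (\<integral>\<^sup>+ x. ennreal (B powr (p - 1)) * ennreal (f x) \<partial>M)"
  proof (intro nn_integral_mono)
    fix x
    have "f x powr p = f x powr (p - 1) * f x"
      using f(2)[of x] p by (cases "f x = 0") (auto simp: powr_diff)
    also have "\<dots> \<le> B powr (p - 1) * f x"
      using f(2)[of x] B(2)[of x] p by (intro mult_right_mono powr_mono2) auto
    finally show "ennreal (norm (complex_of_real (f x)) powr p) \<le> ennreal (B powr (p - 1)) * ennreal (f x)"
      using f(2)[of x] by (simp add: ennreal_mult[symmetric])
  qed
  also have "\<dots> < \<infinity>"
    using compactly_supported_finite[OF f(1)] by (simp add: nn_integral_cmult ennreal_mult_less_top)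
  finally show "Lp_enorm p M (\<lambda>x. complex_of_real (f x)) < \<infinity>" by (simp only: Lp_enorm_finite_iff)
qed

lemma compactly_supported_LpT:
  fixes f :: "'a \<Rightarrow> real"
  assumes p: "1 < p" and f: "compactly_supported f" "\<And>x. 0 \<le> f x"
    and W: "(\<integral>\<^sup>+ x. ennreal (f x) \<partial>M) = ennreal W" "0 \<le> W"
  shows "(\<lambda>x. complex_of_real (f x)) \<in> LpT_space p M"
    "LpT_enorm p M (\<lambda>x. complex_of_real (f x)) \<le> ennreal W"
proof -
  have *: "haar_conv_exists M g (\<lambda>x. complex_of_real (f x)) \<and>
      Lp_enorm p M (haar_conv M g (\<lambda>x. complex_of_real (f x))) \<le> ennreal W * Lp_enorm p M g"
    if g: "g \<in> Lp_space p M" for g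
  \<comment> \<open>\<open>W = 0\<close> occurs for empty partial sums, while the kernel estimate
    assumes positive mass. In this case \<open>f\<close> vanishes identically.\<close>
  proof (cases "W = 0")
    case True
    then have "f x = 0" for x
      using compactly_supported_positive[OF f(1), of x] f(2)[of x] W(1) by (cases "f x = 0") auto
    then show ?thesis by (simp add: haar_conv_exists_def haar_conv_def[abs_def] Lp_enorm_zero)
  next
    case False
    then show ?thesis
      using conv_compactly_supported_right[OF p f W(1) _ g] W(2) by (simp add: haar_conv_exists_def)
  qed
  show le: "LpT_enorm p M (\<lambda>x. complex_of_real (f x)) \<le> ennreal W"
    unfolding LpT_enorm_def
  proof (rule SUP_least)
    fix g assume g: "g \<in> {g \<in> Lp_space p M. Lp_enorm p M g \<le> 1}"
    then have "Lp_enorm p M (haar_conv M g (\<lambda>x. complex_of_real (f x))) \<le> ennreal W * Lp_enorm p M g"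
      using * by auto
    also have "\<dots> \<le> ennreal W * 1" using g by (intro mult_left_mono) auto
    finally show "Lp_enorm p M (haar_conv M g (\<lambda>x. complex_of_real (f x))) \<le> ennreal W" by simp
  qed
  have "LpT_enorm p M (\<lambda>x. complex_of_real (f x)) < \<infinity>" using le by (rule le_less_trans) simp
  then show "(\<lambda>x. complex_of_real (f x)) \<in> LpT_space p M"
    using compactly_supported_Lp[OF p f] * by (simp add: LpT_space_def)
qed

text \<open>Take a bump of integral at most 1, so that the operator norm is at most 1, while the
  \<open>p\<close>-th power of the \<open>L\<^sup>p\<close> norm is at least
  \<open>K powr p + 1\<close>.\<close>

lemma not_discrete_Lp_norm_unbounded:
  assumes nd: "(euclidean :: 'a topology) \<noteq> discrete_topology UNIV" and p: "1 < p" and K: "0 < K"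
  shows "\<exists>f\<in>LpT_space p M. K * LpT_norm p M f < Lp_norm p M f"
proof -
  obtain f :: "'a \<Rightarrow> real" and W c C V where f: "compactly_supported f" "\<And>x. 0 \<le> f x"
    "(\<integral>\<^sup>+ x. ennreal (f x) \<partial>M) = ennreal W" "0 < W" "W \<le> 1" "0 < c" "compact C"
    "ennreal (K powr p + 1) \<le> ennreal (c powr p) * emeasure M C" "open V" "0 \<in> V"
    "\<And>x y. x \<in> C \<Longrightarrow> y \<in> V \<Longrightarrow> c \<le> f (- y + x)"
  proof (rule ex_tall_bump[OF nd p])
    show "0 < (1::real)" "0 < K powr p + 1" using K by (auto intro: add_nonneg_pos)
  qed (rule that)
  define F where "F x = complex_of_real (f x)" for x
  have F: "F \<in> LpT_space p M" "LpT_enorm p M F \<le> ennreal W"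
    using compactly_supported_LpT[OF p f(1-3)] f(4) unfolding F_def[abs_def] by auto
  have T: "LpT_norm p M F \<le> 1"
    using F(2) f(4,5) unfolding LpT_norm_def by (intro enn2real_leI) (auto intro: order_trans ennreal_leI)
  have cf: "c \<le> f x" if "x \<in> C" for x using f(11)[OF that f(10)] by simp
  have "\<not> Lp_enorm p M F \<le> ennreal K"
  proof
    assume "Lp_enorm p M F \<le> ennreal K"
    then have "(\<integral>\<^sup>+ x. ennreal (norm (F x) powr p) \<partial>M) \<le> ennreal (K powr p)"
      using p K by (subst (asm) Lp_enorm_le_iff) auto
    moreover have "ennreal (c powr p) * emeasure M C = (\<integral>\<^sup>+ x. ennreal (c powr p) * indicator C x \<partial>M)"
      using f(7) compact_borel by (intro nn_integral_cmult_indicator[symmetric]) auto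
    moreover have "\<dots> \<le> (\<integral>\<^sup>+ x. ennreal (norm (F x) powr p) \<partial>M)"
      using cf f(2,6) p unfolding F_def
      by (intro nn_integral_mono) (auto intro!: ennreal_leI powr_mono2 split: split_indicator)
    ultimately have "ennreal (K powr p + 1) \<le> ennreal (K powr p)"
      by (metis (no_types, lifting) f(8) order_trans)
    then show False by (subst (asm) ennreal_le_iff) auto
  qed
  moreover have "Lp_enorm p M F < \<infinity>" using F by (auto simp: LpT_space_def Lp_space_def)
  ultimately have "K < Lp_norm p M F"
    unfolding Lp_norm_def by (cases "Lp_enorm p M F") (use K in \<open>auto simp: not_le ennreal_less_iff\<close>)
  moreover have "K * LpT_norm p M F \<le> K" using T K by (simp add: mult_left_le)
  ultimately show ?thesis using F(1) by (intro bexI[of _ F]) auto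
qed

text \<open>If the partial sums \<open>s\<close> of a series of tall bumps converge to \<open>u\<close> in \<open>L\<^sub>p\<^sup>T\<close>, then
  convolving with a narrow bump \<open>g\<close> near \<open>0\<close> shows that \<open>\<parallel>u\<parallel>\<^sub>p\<close> dominates the height of every single
  summand.\<close>

lemma LpT_limit_dominates:
  fixes h :: "'a \<Rightarrow> real" and u :: "'a \<Rightarrow> complex" and s :: "nat \<Rightarrow> 'a \<Rightarrow> real"
  assumes p: "1 < p" and u: "u \<in> Lp_space p M"
    and V: "open V" "0 \<in> V" and C: "compact C" and c: "0 < c"
    and s: "\<And>n. compactly_supported (s n)" "\<And>n x. 0 \<le> s n x"
    and low: "\<And>n x y. n0 \<le> n \<Longrightarrow> x \<in> C \<Longrightarrow> y \<in> V \<Longrightarrow> c \<le> s n (- y + x)"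
    and lim: "(\<lambda>n. LpT_enorm p M (\<lambda>x. of_real (s n x) - u x)) \<longlonglongrightarrow> 0"
    and R: "Lp_enorm p M u = ennreal R" "0 \<le> R"
  shows "ennreal (c powr p) * emeasure M C \<le> ennreal (R powr p)"
proof -
  obtain g :: "'a \<Rightarrow> real" where g: "compactly_supported g" "\<And>x. 0 \<le> g x" "g 0 = 1" "\<And>x. g x \<noteq> 0 \<Longrightarrow> x \<in> V"
    by (metis Urysohn_compactly_supported[of "{0}" V] V compact_sing singletonI empty_subsetI insert_subset)
  have [measurable]: "g \<in> borel_measurable borel" "u \<in> borel_measurable borel" "s n \<in> borel_measurable borel" for n
    using g s compactly_supported_measurable Lp_space_measurable[OF u] by auto
  obtain \<gamma> where \<gamma>: "(\<integral>\<^sup>+ x. ennreal (g x) \<partial>M) = ennreal \<gamma>" "0 < \<gamma>"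
    using compactly_supported_positive[OF g(1), of 0] compactly_supported_finite[OF g(1)] g(3)
    by (cases "(\<integral>\<^sup>+ x. ennreal (g x) \<partial>M)") auto
  define G where "G x = complex_of_real (g x)" for x
  have Gp: "G \<in> Lp_space p M" unfolding G_def using compactly_supported_Lp[OF p g(1,2)] .
  obtain D where D: "0 \<le> D" "Lp_enorm p M G = ennreal D"
    using Lp_space_finite[OF Gp] by (cases p M G rule: Lp_enorm_ennreal_cases) auto
  note left = conv_compactly_supported_left[OF p g(1,2) \<gamma>, folded G_def]
  define S where "S n x = complex_of_real (s n x)" for n x
  have Sp: "S n \<in> Lp_space p M" for n unfolding S_def using compactly_supported_Lp[OF p s] .
  have dp: "(\<lambda>x. S n x - u x) \<in> Lp_space p M" for n
    using Lp_space_add[OF _ Sp[of n] Lp_space_cmult[OF _ u, of "-1"]] p by simp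
  \<comment> \<open>The lower bound for the convolution of \<open>G\<close> with every late
    \<open>S n\<close>; it does not depend on \<open>n\<close>.\<close>
  define X where "X = Lp_enorm p M (\<lambda>x. complex_of_real (\<gamma> * c * indicator C x))"
  have gi: "integrable M g" "integral\<^sup>L M g = \<gamma>"
    using g \<gamma> by (auto intro!: integrableI_nn_integral_finite integral_eq_nn_integral simp: integral_eq_nn_integral)
  have bound: "X \<le> ennreal (\<gamma> * R) + LpT_enorm p M (\<lambda>x. S n x - u x) * ennreal D" if n: "n0 \<le> n" for n
  proof -
    have conv: "haar_conv M G (S n) x = haar_conv M G u x + haar_conv M G (\<lambda>x. S n x - u x) x" for x
      using haar_conv_add_right[OF left(1)[OF u] left(1)[OF dp[of n]], of x] by simp
    have "X \<le> Lp_enorm p M (haar_conv M G (S n))"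
      unfolding X_def
    proof (rule Lp_enorm_mono_AE, use p in simp, intro AE_I2)
      fix x
      \<comment> \<open>For \<open>x\<close> in \<open>C\<close>, \<open>g y\<close> is nonzero only
        for \<open>y\<close> in \<open>V\<close>, where \<open>s n (- y + x)\<close> is at least
        \<open>c\<close>; integrating against \<open>g\<close> gives
        \<open>\<gamma> * c\<close>.\<close>
      show "norm (complex_of_real (\<gamma> * c * indicator C x)) \<le> norm (haar_conv M G (S n) x)"
      proof (cases "x \<in> C")
        case True
        have int: "integrable M (\<lambda>y. g y * s n (- y + x))"
          using left(1)[OF Sp[of n], of x]
          unfolding G_def S_def of_real_mult[symmetric] complex_of_real_integrable_eq .
        have "c * \<gamma> = (LINT y|M. g y * c)" using gi by (simp add: mult.commute)
        also have "\<dots> \<le> (LINT y|M. g y * s n (- y + x))"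
        proof (rule integral_mono)
          show "integrable M (\<lambda>y. g y * c)" using gi by simp
          show "g y * c \<le> g y * s n (- y + x)" for y
            using low[OF n True, of y] g(2)[of y] g(4)[of y] by (cases "g y = 0") (auto intro: mult_left_mono)
        qed (rule int)
        finally have "c * \<gamma> \<le> (LINT y|M. g y * s n (- y + x))" .
        moreover have "haar_conv M G (S n) x = complex_of_real (LINT y|M. g y * s n (- y + x))"
          unfolding haar_conv_def G_def S_def by (simp flip: of_real_mult)
        ultimately show ?thesis using c \<gamma> True by (simp add: mult.commute del: of_real_mult)
      qed simp
    qed
    also have "\<dots> = Lp_enorm p M (\<lambda>x. haar_conv M G u x + haar_conv M G (\<lambda>x. S n x - u x) x)"
      by (intro arg_cong[where f="Lp_enorm p M"] ext conv)
    also have "\<dots> \<le> Lp_enorm p M (haar_conv M G u) + Lp_enorm p M (haar_conv M G (\<lambda>x. S n x - u x))"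
      using p left(2)[OF u] left(2)[OF dp[of n]] by (intro Lp_enorm_triangle) auto
    also have "\<dots> \<le> ennreal \<gamma> * Lp_enorm p M u + LpT_enorm p M (\<lambda>x. S n x - u x) * Lp_enorm p M G"
      using p left(3)[OF u] left(2)[OF dp[of n]] Gp by (intro add_mono Lp_enorm_haar_conv_le) auto
    also have "\<dots> = ennreal (\<gamma> * R) + LpT_enorm p M (\<lambda>x. S n x - u x) * ennreal D"
      using R D \<gamma> by (simp add: ennreal_mult)
    finally show ?thesis .
  qed
  have "(\<lambda>n. ennreal (\<gamma> * R) + ennreal D * LpT_enorm p M (\<lambda>x. S n x - u x)) \<longlonglongrightarrow> ennreal (\<gamma> * R) + ennreal D * 0"
    using lim unfolding S_def by (intro tendsto_add tendsto_const ennreal_tendsto_cmult) auto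
  then have "X \<le> ennreal (\<gamma> * R) + ennreal D * 0"
    by (rule LIMSEQ_le_const) (use bound in \<open>auto simp: mult.commute\<close>)
  then have "X \<le> ennreal (\<gamma> * R)" by simp
  then have "(\<integral>\<^sup>+ x. ennreal (norm (complex_of_real (\<gamma> * c * indicator C x)) powr p) \<partial>M) \<le> ennreal ((\<gamma> * R) powr p)"
    unfolding X_def using p \<gamma> R by (subst (asm) Lp_enorm_le_iff) auto
  moreover have "(\<integral>\<^sup>+ x. ennreal (norm (complex_of_real (\<gamma> * c * indicator C x)) powr p) \<partial>M)
      = (\<integral>\<^sup>+ x. ennreal ((\<gamma> * c) powr p) * indicator C x \<partial>M)"
    using \<gamma> c by (intro nn_integral_cong) (auto simp: norm_mult split: split_indicator)
  moreover have "\<dots> = ennreal ((\<gamma> * c) powr p) * emeasure M C"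
    using C compact_borel by (intro nn_integral_cmult_indicator) auto
  \<comment> \<open>Both sides carry \<open>\<gamma> powr p\<close>, so the bound does not depend on
    how narrow \<open>g\<close> is.\<close>
  ultimately have "ennreal (\<gamma> powr p) * (ennreal (c powr p) * emeasure M C) \<le> ennreal (\<gamma> powr p) * ennreal (R powr p)"
    using \<gamma> c R by (simp add: powr_mult ennreal_mult mult.assoc)
  then show ?thesis
    using \<gamma> by (subst (asm) ennreal_mult_le_mult_iff) auto
qed

text \<open>The bumps have integrals at most \<open>(1 / 2) ^ Suc j\<close> and
  \<open>L\<^sup>p\<close> size at least \<open>Suc j\<close>. The former makes the partial sums
  Cauchy; by the latter, a limit of norm \<open>R\<close> would satisfy
  \<open>Suc j \<le> R powr p\<close> for every \<open>j\<close>.\<close>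

lemma banach_algebra_imp_discrete:
  assumes p: "1 < p" and ba: "LpT_banach_algebra p M"
  shows "(euclidean :: 'a topology) = discrete_topology UNIV"
proof (rule ccontr)
  assume nd: "(euclidean :: 'a topology) \<noteq> discrete_topology UNIV"
  define P where "P j f W c C V \<longleftrightarrow> compactly_supported f \<and> (\<forall>x. 0 \<le> f x) \<and>
    (\<integral>\<^sup>+ x. ennreal (f x) \<partial>M) = ennreal W \<and> 0 < W \<and> W \<le> (1 / 2) ^ Suc j \<and> 0 < c \<and> compact C \<and>
    ennreal (real (Suc j)) \<le> ennreal (c powr p) * emeasure M C \<and> open V \<and> 0 \<in> V \<and>
    (\<forall>x\<in>C. \<forall>y\<in>V. c \<le> f (- y + x))" for j and f :: "'a \<Rightarrow> real" and W c C V
  have "\<exists>f W c C V. P j f W c C V" for j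
  proof (rule ex_tall_bump[OF nd p])
    show "0 < (1 / 2 :: real) ^ Suc j" "0 < real (Suc j)" by simp_all
    fix f W c C V
    assume "compactly_supported f" "\<And>x. 0 \<le> f x" "(\<integral>\<^sup>+ x. ennreal (f x) \<partial>M) = ennreal W" "0 < W"
      "W \<le> (1 / 2) ^ Suc j" "0 < c" "compact C" "ennreal (real (Suc j)) \<le> ennreal (c powr p) * emeasure M C"
      "open V" "0 \<in> V" "\<And>x y. x \<in> C \<Longrightarrow> y \<in> V \<Longrightarrow> c \<le> f (- y + x)"
    then show "\<exists>f W c C V. P j f W c C V" unfolding P_def by blast
  qed
  then obtain f W c C V where "\<And>j. P j (f j) (W j) (c j) (C j) (V j)" by metis
  then have f: "\<And>j. compactly_supported (f j)" "\<And>j x. 0 \<le> f j x"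
    "\<And>j. (\<integral>\<^sup>+ x. ennreal (f j x) \<partial>M) = ennreal (W j)" "\<And>j. 0 < W j" "\<And>j. W j \<le> (1 / 2) ^ Suc j"
    "\<And>j. 0 < c j" "\<And>j. compact (C j)" "\<And>j. ennreal (real (Suc j)) \<le> ennreal (c j powr p) * emeasure M (C j)"
    "\<And>j. open (V j)" "\<And>j. 0 \<in> V j" "\<And>j x y. x \<in> C j \<Longrightarrow> y \<in> V j \<Longrightarrow> c j \<le> f j (- y + x)"
    unfolding P_def by blast+
  have fm[measurable]: "f j \<in> borel_measurable borel" for j using f(1) compactly_supported_measurable by auto
  have cs: "compactly_supported (\<lambda>x. \<Sum>i\<in>I. f i x)" "\<And>x. 0 \<le> (\<Sum>i\<in>I. f i x)" for I
    using f(1,2) by (auto intro: compactly_supported_sum sum_nonneg)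
  have sumW: "(\<integral>\<^sup>+ x. ennreal (\<Sum>i\<in>I. f i x) \<partial>M) = ennreal (\<Sum>i\<in>I. W i)" "0 \<le> (\<Sum>i\<in>I. W i)" for I
  proof -
    have "(\<integral>\<^sup>+ x. ennreal (\<Sum>i\<in>I. f i x) \<partial>M) = (\<integral>\<^sup>+ x. (\<Sum>i\<in>I. ennreal (f i x)) \<partial>M)"
      by (intro nn_integral_cong sum_ennreal[symmetric] f(2))
    also have "\<dots> = (\<Sum>i\<in>I. \<integral>\<^sup>+ x. ennreal (f i x) \<partial>M)"
      by (intro nn_integral_sum) simp
    also have "\<dots> = ennreal (\<Sum>i\<in>I. W i)"
      unfolding f(3) by (intro sum_ennreal less_imp_le f(4))
    finally show "(\<integral>\<^sup>+ x. ennreal (\<Sum>i\<in>I. f i x) \<partial>M) = ennreal (\<Sum>i\<in>I. W i)" .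
    show "0 \<le> (\<Sum>i\<in>I. W i)" using f(4) by (simp add: sum_nonneg less_imp_le)
  qed
  define s where "s n x = (\<Sum>i<n. f i x)" for n x
  define S where "S n x = complex_of_real (s n x)" for n x
  have LpT: "S n \<in> LpT_space p M" for n
    using compactly_supported_LpT(1)[OF p cs sumW, of "{..<n}"] unfolding S_def s_def .
  have Sm[measurable]: "S n \<in> borel_measurable M" for n
    using LpT[of n] by (simp add: LpT_space_def Lp_space_def)
  have geo: "(\<Sum>i\<in>{m..<n}. W i) \<le> (1 / 2) ^ m" if "m \<le> n" for m n
  proof -
    have "(\<Sum>i\<in>{m..<n}. W i) \<le> (\<Sum>i\<in>{m..<n}. (1 / 2) ^ Suc i)" by (intro sum_mono f(5))
    also have "\<dots> = (1 / 2) ^ m - (1 / 2) ^ n" using that by (induction n rule: dec_induct) auto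
    finally show ?thesis by (rule order_trans) simp
  qed
  have tail: "LpT_enorm p M (\<lambda>x. S n x - S m x) \<le> ennreal ((1 / 2) ^ m)" if "m \<le> n" for m n
  proof -
    have "s n x - s m x = (\<Sum>i\<in>{m..<n}. f i x)" for x
      using that sum_diff_nat_ivl[of 0 m n "\<lambda>i. f i x"] by (simp add: s_def atLeast0LessThan)
    then have "(\<lambda>x. S n x - S m x) = (\<lambda>x. complex_of_real (\<Sum>i\<in>{m..<n}. f i x))"
      unfolding S_def of_real_diff[symmetric] by simp
    then have "LpT_enorm p M (\<lambda>x. S n x - S m x) \<le> ennreal (\<Sum>i\<in>{m..<n}. W i)"
      using compactly_supported_LpT(2)[OF p cs sumW, of "{m..<n}"] by simp
    also have "\<dots> \<le> ennreal ((1 / 2) ^ m)" using geo[OF that] by (rule ennreal_leI)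
    finally show ?thesis .
  qed
  define F where "F n = ae_class M (S n)" for n
  interpret complex_banach_algebra "ae_class M ` LpT_space p M"
    "\<lambda>F G. ae_class M (\<lambda>x. ae_rep F x + ae_rep G x)" "ae_class M (\<lambda>_. 0)"
    "\<lambda>a F. ae_class M (\<lambda>x. a * ae_rep F x)" "\<lambda>F G. ae_class M (haar_conv M (ae_rep F) (ae_rep G))"
    "\<lambda>F. LpT_norm p M (ae_rep F)"
    using ba unfolding LpT_banach_algebra_def .
  \<comment> \<open>Translates the distance of two classes in the algebra into the operator norm of
    a difference of functions.\<close>
  have dist: "LpT_norm p M (ae_rep (ae_class M (\<lambda>x. ae_rep (ae_class M g) x
      + ae_rep (ae_class M (\<lambda>x. - 1 * ae_rep (ae_class M h) x)) x))) = enn2real (LpT_enorm p M (\<lambda>x. g x - h x))"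
    if [measurable]: "g \<in> borel_measurable M" "h \<in> borel_measurable M" for g h
  proof -
    have m: "(\<lambda>x. g x - h x) \<in> borel_measurable M" by measurable
    show ?thesis
      unfolding ae_class_diff[OF that] LpT_norm_def
      using LpT_enorm_cong_AE[OF ae_rep_class(1)[OF m] m ae_rep_class(2)[OF m]] by simp
  qed
  have "range F \<subseteq> ae_class M ` LpT_space p M" using LpT by (auto simp: F_def)
  moreover have "\<forall>e>0. \<exists>N. \<forall>m\<ge>N. \<forall>n\<ge>N. LpT_norm p M (ae_rep (ae_class M (\<lambda>x. ae_rep (F m) x
      + ae_rep (ae_class M (\<lambda>x. - 1 * ae_rep (F n) x)) x))) < e"
  proof (intro allI impI)
    fix e :: real assume "0 < e"
    then obtain N where N: "(1 / 2) ^ N < e" using real_arch_pow_inv[of e "1 / 2"] by auto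
    have "enn2real (LpT_enorm p M (\<lambda>x. S m x - S n x)) < e" if "N \<le> m" "N \<le> n" for m n
    proof -
      have "LpT_enorm p M (\<lambda>x. S m x - S n x) \<le> ennreal ((1 / 2) ^ N)"
      proof (cases "n \<le> m")
        case True
        have "LpT_enorm p M (\<lambda>x. S m x - S n x) \<le> ennreal ((1 / 2) ^ n)" by (rule tail[OF True])
        also have "\<dots> \<le> ennreal ((1 / 2) ^ N)" using that by (intro ennreal_leI power_decreasing) auto
        finally show ?thesis .
      next
        case False
        have "LpT_enorm p M (\<lambda>x. S m x - S n x) = LpT_enorm p M (\<lambda>x. - (S n x - S m x))" by simp
        also have "\<dots> \<le> ennreal ((1 / 2) ^ m)" unfolding LpT_enorm_uminus using False by (intro tail) simp
        also have "\<dots> \<le> ennreal ((1 / 2) ^ N)" using that by (intro ennreal_leI power_decreasing) auto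
        finally show ?thesis .
      qed
      then have "enn2real (LpT_enorm p M (\<lambda>x. S m x - S n x)) \<le> (1 / 2) ^ N" by (intro enn2real_leI) auto
      then show ?thesis using N by simp
    qed
    then show "\<exists>N. \<forall>m\<ge>N. \<forall>n\<ge>N. LpT_norm p M (ae_rep (ae_class M (\<lambda>x. ae_rep (F m) x
        + ae_rep (ae_class M (\<lambda>x. - 1 * ae_rep (F n) x)) x))) < e"
      unfolding F_def dist[OF Sm Sm] by blast
  qed
  ultimately obtain U where U: "U \<in> ae_class M ` LpT_space p M"
    "(\<lambda>n. LpT_norm p M (ae_rep (ae_class M (\<lambda>x. ae_rep (F n) x
      + ae_rep (ae_class M (\<lambda>x. - 1 * ae_rep U x)) x)))) \<longlonglongrightarrow> 0"
    using complete[of F] by blast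
  obtain u where u: "u \<in> LpT_space p M" "U = ae_class M u" using U(1) by blast
  have up: "u \<in> Lp_space p M" and um[measurable]: "u \<in> borel_measurable M"
    using u by (auto simp: LpT_space_def Lp_space_def)
  \<comment> \<open>\<open>LpT_norm\<close> sends an infinite value to 0, so convergence of the real
    norms says something only once finiteness is known. It follows because the carrier is closed
    under differences.\<close>
  have "LpT_enorm p M (\<lambda>x. S n x - u x) < \<infinity>" for n
  proof -
    have "F n \<in> ae_class M ` LpT_space p M" using LpT by (auto simp: F_def)
    then have "ae_class M (\<lambda>x. ae_rep (F n) x + ae_rep (ae_class M (\<lambda>x. - 1 * ae_rep U x)) x)
        \<in> ae_class M ` LpT_space p M"
      by (intro add_closed smult_closed U(1))
    then obtain v where v: "v \<in> LpT_space p M" "ae_class M (\<lambda>x. S n x - u x) = ae_class M v"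
      unfolding F_def u(2) ae_class_diff[OF Sm um] by blast
    have vm: "v \<in> borel_measurable M" using v by (simp add: LpT_space_def Lp_space_def)
    have m: "(\<lambda>x. S n x - u x) \<in> borel_measurable M" by measurable
    have "(\<lambda>x. S n x - u x) \<in> ae_class M v" unfolding v(2)[symmetric] using m by (simp add: ae_class_def)
    then have "AE x in M. S n x - u x = v x" by (simp add: ae_class_def)
    from LpT_enorm_cong_AE[OF m vm this] show ?thesis using v(1) by (simp add: LpT_space_def)
  qed
  then have "LpT_enorm p M (\<lambda>x. S n x - u x) = ennreal (enn2real (LpT_enorm p M (\<lambda>x. S n x - u x)))" for n
    by (simp add: less_top)
  moreover have "(\<lambda>n. ennreal (enn2real (LpT_enorm p M (\<lambda>x. S n x - u x)))) \<longlonglongrightarrow> ennreal 0"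
    using U(2) unfolding F_def u(2) dist[OF Sm um] by (rule tendsto_ennrealI)
  ultimately have lim: "(\<lambda>n. LpT_enorm p M (\<lambda>x. complex_of_real (s n x) - u x)) \<longlonglongrightarrow> 0"
    unfolding S_def by simp
  obtain R where R: "0 \<le> R" "Lp_enorm p M u = ennreal R"
    using Lp_space_finite[OF up] by (cases p M u rule: Lp_enorm_ennreal_cases) auto
  have "ennreal (real (Suc j)) \<le> ennreal (R powr p)" for j
  proof -
    \<comment> \<open>All bumps are nonnegative, so the \<open>j\<close>-th one lies below every
      partial sum that contains it, that is from \<open>n = Suc j\<close> on.\<close>
    have low: "c j \<le> s n (- y + x)" if "Suc j \<le> n" "x \<in> C j" "y \<in> V j" for n x y
    proof -
      have "c j \<le> f j (- y + x)" using f(11) that by simp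
      also have "\<dots> \<le> s n (- y + x)"
        unfolding s_def using that f(2) by (intro member_le_sum) auto
      finally show ?thesis .
    qed
    have "ennreal (c j powr p) * emeasure M (C j) \<le> ennreal (R powr p)"
      by (rule LpT_limit_dominates[OF p up f(9) f(10) f(7) f(6) _ _ low lim R(2,1)])
        (use cs in \<open>auto simp: s_def\<close>)
    then show ?thesis using f(8)[of j] by (rule order_trans[rotated])
  qed
  then have "real (Suc j) \<le> R powr p" for j by (metis ennreal_le_iff powr_ge_zero)
  moreover obtain j :: nat where "R powr p < real j" using reals_Archimedean2 by blast
  ultimately show False by (metis less_irrefl less_le_trans of_nat_Suc less_add_same_cancel2 less_trans zero_less_one)
qed

end

section \<open>Discrete groups\<close>

locale discrete_haar_group = haar_group M
  for M :: "'a::{topological_group_add, t2_space} measure" +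
  assumes disc: "(euclidean :: 'a topology) = discrete_topology UNIV"
begin

text \<open>On a discrete group Haar measure is this multiple of counting measure; it is not
  normalised to 1.\<close>

definition cell :: real where "cell = measure M {0}"

lemma open_any: "open (S :: 'a set)"
  using openin_discrete_topology[of UNIV S] by (simp add: disc[symmetric])

lemma sets_any: "S \<in> sets (borel :: 'a measure)"
  by (simp add: open_any)

lemma measurable_any [simp]: "f \<in> borel_measurable (borel :: 'a measure)" "f \<in> borel_measurable M"
  by (simp_all add: measurable_def sets_any)

lemma emeasure_singleton: "emeasure M {a} = ennreal cell"
proof -
  have "emeasure M {a} = emeasure M {0}" using left_inv[of "{0}" a] by simp
  then show ?thesis using compact_finite[of "{0}"] by (simp add: cell_def emeasure_eq_ennreal_measure)
qed

lemma cell_pos: "0 < cell"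
  using open_positive[OF open_any, of 0 "{0}"] emeasure_singleton[of 0] by simp

lemma AE_all: "(AE x in M. P x) \<longleftrightarrow> (\<forall>x. P x)"
proof
  assume "AE x in M. P x"
  then obtain N where N: "{x \<in> space M. \<not> P x} \<subseteq> N" "emeasure M N = 0" "N \<in> sets M" by (rule AE_E)
  show "\<forall>x. P x"
  proof (rule allI, rule ccontr)
    fix x assume "\<not> P x"
    then have "emeasure M {x} \<le> emeasure M N" using N by (intro emeasure_mono) auto
    then show False using N emeasure_singleton[of x] cell_pos by simp
  qed
qed simp

lemma compact_imp_finite_discrete: "compact (K :: 'a set) \<Longrightarrow> finite K"
  using compactin_discrete_topology[of UNIV K] by (simp add: disc[symmetric])

lemma ae_class_discrete: "ae_class M f = {f}"
  by (auto simp: ae_class_def AE_all measurable_any)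

lemma ae_rep_singleton: "ae_rep {f} = f"
  by (simp add: ae_rep_def)

lemma integral_finite_support:
  fixes u :: "'a \<Rightarrow> complex"
  assumes F: "finite F" "\<And>y. y \<notin> F \<Longrightarrow> u y = 0"
  shows "integrable M u" "(LINT y|M. u y) = (\<Sum>y\<in>F. of_real cell * u y)"
proof -
  have u: "u = (\<lambda>x. \<Sum>y\<in>F. indicator {y} x *\<^sub>R u y)"
  proof
    fix x
    have "(\<Sum>y\<in>F. indicator {y} x *\<^sub>R u y) = (\<Sum>y\<in>F. if x = y then u y else 0)"
      by (intro sum.cong) (auto split: split_indicator)
    then show "u x = (\<Sum>y\<in>F. indicator {y} x *\<^sub>R u y)" using F by simp
  qed
  have i: "integrable M (indicator {y} :: 'a \<Rightarrow> real)" for y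
    using emeasure_singleton[of y] by (intro integrable_real_indicator) (auto simp: sets_any)
  have m: "measure M {y} = cell" for y
    using emeasure_singleton[of y] cell_pos by (simp add: measure_def)
  show "integrable M u"
    by (subst u) (intro Bochner_Integration.integrable_sum integrable_scaleR_left i)
  have "(LINT y|M. u y) = (LINT x|M. (\<Sum>y\<in>F. indicator {y} x *\<^sub>R u y))" using u by simp
  also have "\<dots> = (\<Sum>y\<in>F. (LINT x|M. indicator {y} x *\<^sub>R u y))"
    by (intro Bochner_Integration.integral_sum integrable_scaleR_left i)
  also have "\<dots> = (\<Sum>y\<in>F. of_real cell * u y)"
    using i by (intro sum.cong) (auto simp: m scaleR_conv_of_real)
  finally show "(LINT y|M. u y) = (\<Sum>y\<in>F. of_real cell * u y)" .
qed

lemma haar_conv_finite_support: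
  assumes "finite F" "\<And>y. y \<notin> F \<Longrightarrow> g y = 0"
  shows "haar_conv M g f x = (\<Sum>y\<in>F. of_real cell * (g y * f (- y + x)))"
  unfolding haar_conv_def by (rule integral_finite_support(2)) (use assms in auto)

text \<open>The single point \<open>x\<close> already contributes
  \<open>norm (f x) powr p * cell\<close> to the integral.\<close>

lemma Lp_point_bound:
  assumes p: "0 < p" and f: "Lp_enorm p M f \<le> ennreal C" "0 \<le> C"
  shows "norm (f x) \<le> C / cell powr (1 / p)"
proof -
  have "ennreal (norm (f x) powr p * cell) = (\<integral>\<^sup>+ y. ennreal (norm (f x) powr p) * indicator {x} y \<partial>M)"
    using cell_pos by (subst nn_integral_cmult_indicator) (auto simp: sets_any emeasure_singleton ennreal_mult)
  also have "\<dots> \<le> (\<integral>\<^sup>+ y. ennreal (norm (f y) powr p) \<partial>M)"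
    by (intro nn_integral_mono) (auto split: split_indicator)
  also have "\<dots> \<le> ennreal (C powr p)" using f p by (simp add: Lp_enorm_le_iff)
  finally have "norm (f x) powr p * cell \<le> C powr p" by (simp add: ennreal_le_iff)
  then have "(norm (f x) powr p * cell) powr (1 / p) \<le> (C powr p) powr (1 / p)"
    using p cell_pos by (intro powr_mono2) auto
  then have "norm (f x) * cell powr (1 / p) \<le> C"
    using p f cell_pos by (simp add: powr_mult powr_powr)
  then show ?thesis using cell_pos by (simp add: pos_le_divide_eq)
qed

text \<open>Compact sets are finite here, so an \<open>L\<^sup>p\<close> function vanishes off a
  countable set, even if the group is uncountable.\<close>

lemma finite_support_approx:
  assumes g: "g \<in> Lp_space p M"
  obtains F :: "nat \<Rightarrow> 'a set" where "\<And>n. finite (F n)"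
    "\<And>y. \<forall>\<^sub>F n in sequentially. g y \<noteq> 0 \<longrightarrow> y \<in> F n"
proof -
  have "(\<lambda>x. ennreal (norm (g x) powr p)) \<in> borel_measurable borel" using measurable_any by simp
  from integrable_sigma_compact[OF this iffD1[OF Lp_enorm_finite_iff Lp_space_finite[OF g]]]
  obtain L :: "nat \<Rightarrow> 'a set" where L: "\<forall>n. compact (L n)"
    "AE x in M. ennreal (norm (g x) powr p) \<noteq> 0 \<longrightarrow> x \<in> (\<Union>n. L n)"
    by (elim exE conjE)
  show thesis
  proof (rule that)
    show "finite (\<Union>i\<le>n. L i)" for n using L(1) compact_imp_finite_discrete by auto
    fix y
    show "\<forall>\<^sub>F n in sequentially. g y \<noteq> 0 \<longrightarrow> y \<in> (\<Union>i\<le>n. L i)"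
    proof (cases "g y = 0")
      case False
      then obtain i where "y \<in> L i" using L(2) by (auto simp: AE_all)
      then show ?thesis by (intro eventually_sequentiallyI[of i]) auto
    qed simp
  qed
qed

text \<open>Let \<open>d\<close> be the indicator of \<open>{0}\<close>. Convolution with
  \<open>d\<close> multiplies \<open>f\<close> by \<open>cell\<close>, and \<open>d\<close> has norm
  \<open>cell powr (1 / p)\<close>; the quotient is the constant.\<close>

lemma discrete_Lp_norm_le:
  assumes p: "1 < p"
  obtains K where "0 < K" "\<And>f. f \<in> LpT_space p M \<Longrightarrow> Lp_enorm p M f \<le> ennreal K * LpT_enorm p M f"
proof -
  define d :: "'a \<Rightarrow> complex" where "d = indicator {0}"
  have "(\<integral>\<^sup>+ x. ennreal (norm (d x) powr p) \<partial>M) = (\<integral>\<^sup>+ x. indicator {0} x \<partial>M)"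
    unfolding d_def using p by (intro nn_integral_cong) (auto split: split_indicator)
  also have "\<dots> = ennreal cell" by (simp add: sets_any emeasure_singleton)
  finally have "Lp_enorm p M d = ennreal (cell powr (1 / p))" using cell_pos by (simp add: Lp_enorm_def)
  moreover have "d \<in> Lp_space p M" using calculation measurable_any by (intro Lp_spaceI) auto
  moreover have "haar_conv M d f = (\<lambda>x. of_real cell * f x)" for f
    by (rule ext, subst haar_conv_finite_support[of "{0}"]) (auto simp: d_def)
  ultimately have le: "ennreal cell * Lp_enorm p M f \<le> LpT_enorm p M f * ennreal (cell powr (1 / p))" for f
    using Lp_enorm_haar_conv_le[of p d M f] p measurable_any cell_pos
    by (simp add: Lp_enorm_cmult)
  show thesis
  proof (rule that)
    show "0 < cell powr (1 / p) / cell" using cell_pos by simp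
    fix f
    have "Lp_enorm p M f = ennreal (inverse cell) * (ennreal cell * Lp_enorm p M f)"
      using cell_pos by (simp add: mult.assoc[symmetric] ennreal_mult[symmetric])
    also have "\<dots> \<le> ennreal (inverse cell) * (LpT_enorm p M f * ennreal (cell powr (1 / p)))"
      by (intro mult_left_mono le) simp
    also have "\<dots> = ennreal (inverse cell * cell powr (1 / p)) * LpT_enorm p M f"
      using cell_pos by (simp add: ennreal_mult mult_ac)
    finally show "Lp_enorm p M f \<le> ennreal (cell powr (1 / p) / cell) * LpT_enorm p M f"
      by (simp add: field_simps)
  qed
qed

end

locale discrete_unimodular_haar_group = discrete_haar_group + unimodular_haar_group
begin

section \<open>Existence and associativity of convolution on discrete unimodular groups\<close>

text \<open>Functions in \<open>L\<^sup>p\<close> are bounded here, and with exponent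
  \<open>2 - p \<ge> 0\<close> their squares are dominated by their \<open>p\<close>-th powers. The
  product is bounded by the sum of the two squares, and reflection preserves the integral of the
  second.\<close>

lemma Lp_integrable_conv:
  assumes p: "1 < p" "p \<le> 2" and g: "g \<in> Lp_space p M" and f: "f \<in> Lp_space p M"
  shows "integrable M (\<lambda>y. g y * f (- y + x))"
proof (rule integrableI_bounded)
  show "(\<lambda>y. g y * f (- y + x)) \<in> borel_measurable M" by (rule measurable_any)
  have sq: "\<exists>B. 0 \<le> B \<and> (\<forall>x. norm (u x) ^ 2 \<le> B * norm (u x) powr p)" if u: "u \<in> Lp_space p M" for u
  proof -
    obtain C where C: "0 \<le> C" "Lp_enorm p M u = ennreal C"
      using Lp_space_finite[OF u] by (cases p M u rule: Lp_enorm_ennreal_cases) auto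
    define b where "b = C / cell powr (1 / p)"
    have b: "norm (u x) \<le> b" for x unfolding b_def using C p by (intro Lp_point_bound) auto
    have "norm (u x) ^ 2 \<le> b powr (2 - p) * norm (u x) powr p" for x
    proof (cases "u x = 0")
      case False
      then have "norm (u x) ^ 2 = norm (u x) powr (2 - p) * norm (u x) powr p"
        by (simp add: powr_add[symmetric])
      also have "\<dots> \<le> b powr (2 - p) * norm (u x) powr p"
        using b[of x] p by (intro mult_right_mono powr_mono2) auto
      finally show ?thesis .
    qed simp
    then show ?thesis by (intro exI[of _ "b powr (2 - p)"]) auto
  qed
  obtain A where A: "0 \<le> A" "\<And>x. norm (g x) ^ 2 \<le> A * norm (g x) powr p" using sq[OF g] by blast
  obtain B where B: "0 \<le> B" "\<And>x. norm (f x) ^ 2 \<le> B * norm (f x) powr p" using sq[OF f] by blast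
  have "(\<integral>\<^sup>+ y. ennreal (norm (g y * f (- y + x))) \<partial>M)
      \<le> (\<integral>\<^sup>+ y. ennreal A * ennreal (norm (g y) powr p) + ennreal B * ennreal (norm (f (- y + x)) powr p) \<partial>M)"
  proof (intro nn_integral_mono)
    fix y
    have "2 * (norm (g y) * norm (f (- y + x))) \<le> norm (g y) ^ 2 + norm (f (- y + x)) ^ 2"
      using sum_squares_bound[of "norm (g y)" "norm (f (- y + x))"] by simp
    moreover have "0 \<le> norm (g y) * norm (f (- y + x))" by simp
    ultimately have "norm (g y) * norm (f (- y + x)) \<le> norm (g y) ^ 2 + norm (f (- y + x)) ^ 2" by linarith
    also have "\<dots> \<le> A * norm (g y) powr p + B * norm (f (- y + x)) powr p"
      by (intro add_mono A B)
    finally show "ennreal (norm (g y * f (- y + x)))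
        \<le> ennreal A * ennreal (norm (g y) powr p) + ennreal B * ennreal (norm (f (- y + x)) powr p)"
      using A B by (simp add: norm_mult ennreal_mult[symmetric] ennreal_plus[symmetric] ennreal_leI del: ennreal_plus)
  qed
  also have "\<dots> = ennreal A * (\<integral>\<^sup>+ y. ennreal (norm (g y) powr p) \<partial>M)
      + ennreal B * (\<integral>\<^sup>+ y. ennreal (norm (f (- y + x)) powr p) \<partial>M)"
    using measurable_any by (simp add: nn_integral_add nn_integral_cmult)
  also have "(\<integral>\<^sup>+ y. ennreal (norm (f (- y + x)) powr p) \<partial>M) = (\<integral>\<^sup>+ y. ennreal (norm (f y) powr p) \<partial>M)"
    using measurable_any by (intro nn_integral_reflect(1)[of "\<lambda>y. ennreal (norm (f y) powr p)"]) simp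
  also have "ennreal A * (\<integral>\<^sup>+ y. ennreal (norm (g y) powr p) \<partial>M)
      + ennreal B * (\<integral>\<^sup>+ y. ennreal (norm (f y) powr p) \<partial>M) < \<infinity>"
    using Lp_space_finite[OF f] Lp_space_finite[OF g] unfolding Lp_enorm_finite_iff
    by (simp add: ennreal_mult_less_top)
  finally show "(\<integral>\<^sup>+ y. ennreal (norm (g y * f (- y + x))) \<partial>M) < \<infinity>" .
qed

lemma LpT_space_discrete:
  assumes "1 < p" "p \<le> 2"
  shows "LpT_space p M = {f \<in> Lp_space p M. LpT_enorm p M f < \<infinity>}"
  using Lp_integrable_conv[OF assms] by (auto simp: LpT_space_def haar_conv_exists_def)

lemma truncation_conv_tendsto:
  assumes p: "1 < p" "p \<le> 2" and g: "g \<in> Lp_space p M" and f: "f \<in> Lp_space p M"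
    and F: "\<And>y. \<forall>\<^sub>F n in sequentially. g y \<noteq> 0 \<longrightarrow> y \<in> F n"
  shows "(\<lambda>n. haar_conv M (\<lambda>y. indicator (F n) y * g y) f x) \<longlonglongrightarrow> haar_conv M g f x"
  unfolding haar_conv_def
proof (rule integral_dominated_convergence)
  show "integrable M (\<lambda>y. norm (g y * f (- y + x)))"
    by (intro integrable_norm Lp_integrable_conv[OF p g f])
  show "AE y in M. (\<lambda>n. indicator (F n) y * g y * f (- y + x)) \<longlonglongrightarrow> g y * f (- y + x)"
  proof (intro AE_I2)
    fix y
    have "\<forall>\<^sub>F n in sequentially. indicator (F n) y * g y * f (- y + x) = g y * f (- y + x)"
      using F[of y] by eventually_elim (auto split: split_indicator)
    then show "(\<lambda>n. indicator (F n) y * g y * f (- y + x)) \<longlonglongrightarrow> g y * f (- y + x)"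
      by (rule tendsto_eventually)
  qed
  show "AE y in M. norm (indicator (F n) y * g y * f (- y + x)) \<le> norm (g y * f (- y + x))" for n
    by (intro AE_I2) (auto split: split_indicator)
qed (rule measurable_any)+

text \<open>Finitely supported test functions suffice: truncating \<open>g\<close> does not increase
  its norm, the convolutions converge pointwise, and Fatou's lemma passes the bound on.\<close>

lemma LpT_enorm_leI:
  assumes p: "1 < p" "p \<le> 2" and f: "f \<in> Lp_space p M" and C: "0 \<le> C"
    and le: "\<And>g. finite {y. g y \<noteq> 0} \<Longrightarrow> g \<in> Lp_space p M \<Longrightarrow> Lp_enorm p M g \<le> 1 \<Longrightarrow>
      Lp_enorm p M (haar_conv M g f) \<le> ennreal C"
  shows "f \<in> LpT_space p M" "LpT_enorm p M f \<le> ennreal C"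
proof -
  show 1: "LpT_enorm p M f \<le> ennreal C"
    unfolding LpT_enorm_def
  proof (rule SUP_least)
    fix g assume "g \<in> {g \<in> Lp_space p M. Lp_enorm p M g \<le> 1}"
    then have g: "g \<in> Lp_space p M" "Lp_enorm p M g \<le> 1" by auto
    obtain F :: "nat \<Rightarrow> 'a set" where F: "\<And>n. finite (F n)"
      "\<And>y. \<forall>\<^sub>F n in sequentially. g y \<noteq> 0 \<longrightarrow> y \<in> F n"
      using finite_support_approx[OF g(1)] by blast
    show "Lp_enorm p M (haar_conv M g f) \<le> ennreal C"
    proof (rule Lp_enorm_Fatou[OF _ C])
      show "AE x in M. (\<lambda>n. haar_conv M (\<lambda>y. indicator (F n) y * g y) f x) \<longlonglongrightarrow> haar_conv M g f x"
        by (intro AE_I2 truncation_conv_tendsto[OF p g(1) f F(2)])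
      have "Lp_enorm p M (haar_conv M (\<lambda>y. indicator (F n) y * g y) f) \<le> ennreal C" for n
      proof (rule le)
        show "finite {y. indicator (F n) y * g y \<noteq> 0}"
          by (rule finite_subset[OF _ F(1)[of n]]) (auto split: split_indicator_asm)
        have *: "Lp_enorm p M (\<lambda>y. indicator (F n) y * g y) \<le> Lp_enorm p M g"
          using p by (intro Lp_enorm_mono_AE AE_I2) (auto split: split_indicator)
        show "Lp_enorm p M (\<lambda>y. indicator (F n) y * g y) \<le> 1" using * g(2) by (rule order_trans)
        then show "(\<lambda>y. indicator (F n) y * g y) \<in> Lp_space p M"
          by (intro Lp_spaceI measurable_any) (auto intro: le_less_trans)
      qed
      then show "\<forall>\<^sub>F n in sequentially. Lp_enorm p M (haar_conv M (\<lambda>y. indicator (F n) y * g y) f) \<le> ennreal C"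
        by simp
    qed (use p measurable_any in auto)
  qed
  have "LpT_enorm p M f < \<infinity>" using 1 by (rule le_less_trans) simp
  then show "f \<in> LpT_space p M" using f by (simp add: LpT_space_discrete[OF p])
qed

text \<open>For finitely supported \<open>g\<close> convolution by \<open>g\<close> is a finite sum
  of translates, so only a sum and an integral have to be exchanged.\<close>

lemma haar_conv_assoc_finite_support:
  assumes p: "1 < p" "p \<le> 2" and g: "finite {y. g y \<noteq> 0}" and f: "f \<in> Lp_space p M" and h: "h \<in> Lp_space p M"
  shows "haar_conv M g (haar_conv M f h) = haar_conv M (haar_conv M g f) h"
proof
  fix x
  \<comment> \<open>The left translation \<open>z \<mapsto> - y + z\<close> removes \<open>y\<close>
    from the argument of \<open>h\<close>.\<close>
  have shift: "f (- y + z) * h (- (- y + z) + (- y + x)) = f (- y + z) * h (- z + x)" for y z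
    by (simp add: minus_add add.assoc)
  have int: "integrable M (\<lambda>z. f (- y + z) * h (- z + x))" for y
  proof -
    have "integrable (distr M borel (\<lambda>z. - y + z)) (\<lambda>z. f z * h (- z + (- y + x)))"
      unfolding distr_left by (rule Lp_integrable_conv[OF p f h])
    then have "integrable M (\<lambda>z. f (- y + z) * h (- (- y + z) + (- y + x)))"
      by (rule integrable_distr[rotated]) simp
    then show ?thesis by (simp only: shift)
  qed
  have eq: "haar_conv M f h (- y + x) = (LINT z|M. f (- y + z) * h (- z + x))" for y
  proof -
    have "haar_conv M f h (- y + x) = (LINT z|distr M borel (\<lambda>z. - y + z). f z * h (- z + (- y + x)))"
      unfolding distr_left haar_conv_def ..
    also have "\<dots> = (LINT z|M. f (- y + z) * h (- (- y + z) + (- y + x)))"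
      by (rule integral_distr) auto
    finally show ?thesis by (simp only: shift)
  qed
  let ?F = "{y. g y \<noteq> 0}"
  have "haar_conv M (haar_conv M g f) h x
      = (LINT z|M. (\<Sum>y\<in>?F. of_real cell * g y * (f (- y + z) * h (- z + x))))"
    unfolding haar_conv_def[of M "haar_conv M g f"]
    using haar_conv_finite_support[OF g] by (simp add: sum_distrib_right mult.assoc)
  also have "\<dots> = (\<Sum>y\<in>?F. (LINT z|M. of_real cell * g y * (f (- y + z) * h (- z + x))))"
    by (intro Bochner_Integration.integral_sum integrable_mult_right int)
  also have "\<dots> = (\<Sum>y\<in>?F. of_real cell * (g y * haar_conv M f h (- y + x)))"
    unfolding eq by (simp add: mult.assoc)
  also have "\<dots> = haar_conv M g (haar_conv M f h) x"
    using haar_conv_finite_support[OF g] by simp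
  finally show "haar_conv M g (haar_conv M f h) x = haar_conv M (haar_conv M g f) h x" by simp
qed

lemma LpT_Lp: "f \<in> LpT_space p M \<Longrightarrow> f \<in> Lp_space p M"
  and LpT_finite: "f \<in> LpT_space p M \<Longrightarrow> LpT_enorm p M f < \<infinity>"
  by (auto simp: LpT_space_def)

lemma LpT_conv_le:
  assumes "1 < p" "f \<in> Lp_space p M"
  shows "Lp_enorm p M (haar_conv M f h) \<le> LpT_enorm p M h * Lp_enorm p M f"
  using assms by (intro Lp_enorm_haar_conv_le) auto

lemma LpT_conv_Lp:
  assumes "1 < p" "f \<in> Lp_space p M" "h \<in> LpT_space p M"
  shows "haar_conv M f h \<in> Lp_space p M"
proof (rule Lp_spaceI)
  have "Lp_enorm p M (haar_conv M f h) \<le> LpT_enorm p M h * Lp_enorm p M f"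
    by (rule LpT_conv_le[OF assms(1,2)])
  also have "\<dots> < \<infinity>"
    using LpT_finite[OF assms(3)] Lp_space_finite[OF assms(2)] by (simp add: ennreal_mult_less_top)
  finally show "Lp_enorm p M (haar_conv M f h) < \<infinity>" .
qed simp

text \<open>For a finitely supported test function \<open>g\<close>, associativity lets
  \<open>f\<close> and then \<open>h\<close> act as operators, so the bounds multiply.\<close>

lemma LpT_mult:
  assumes p: "1 < p" "p \<le> 2" and f: "f \<in> LpT_space p M" and h: "h \<in> LpT_space p M"
  shows "haar_conv M f h \<in> LpT_space p M" "LpT_enorm p M (haar_conv M f h) \<le> LpT_enorm p M f * LpT_enorm p M h"
proof -
  obtain A where A: "0 \<le> A" "LpT_enorm p M f = ennreal A" using LpT_finite[OF f] by (cases "LpT_enorm p M f") auto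
  obtain B where B: "0 \<le> B" "LpT_enorm p M h = ennreal B" using LpT_finite[OF h] by (cases "LpT_enorm p M h") auto
  have *: "Lp_enorm p M (haar_conv M g (haar_conv M f h)) \<le> ennreal (A * B)"
    if g: "finite {y. g y \<noteq> 0}" "g \<in> Lp_space p M" "Lp_enorm p M g \<le> 1" for g
  proof -
    have "Lp_enorm p M (haar_conv M g (haar_conv M f h)) = Lp_enorm p M (haar_conv M (haar_conv M g f) h)"
      by (simp add: haar_conv_assoc_finite_support[OF p g(1) LpT_Lp[OF f] LpT_Lp[OF h]])
    also have "\<dots> \<le> LpT_enorm p M h * Lp_enorm p M (haar_conv M g f)"
      by (intro LpT_conv_le LpT_conv_Lp p g f)
    also have "\<dots> \<le> LpT_enorm p M h * (LpT_enorm p M f * Lp_enorm p M g)"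
      by (intro mult_left_mono LpT_conv_le p g) simp
    also have "\<dots> \<le> LpT_enorm p M h * (LpT_enorm p M f * 1)"
      using g(3) by (intro mult_left_mono) auto
    finally show ?thesis using A B by (simp add: ennreal_mult mult.commute)
  qed
  have "0 \<le> A * B" using A B by simp
  note T = LpT_enorm_leI[OF p LpT_conv_Lp[OF p(1) LpT_Lp[OF f] h] this *]
  show "haar_conv M f h \<in> LpT_space p M" by (rule T(1))
  show "LpT_enorm p M (haar_conv M f h) \<le> LpT_enorm p M f * LpT_enorm p M h"
    using T(2) A B by (simp add: ennreal_mult)
qed

lemma LpT_add:
  assumes p: "1 < p" "p \<le> 2" and f: "f \<in> LpT_space p M" and h: "h \<in> LpT_space p M"
  shows "(\<lambda>x. f x + h x) \<in> LpT_space p M"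
    "LpT_enorm p M (\<lambda>x. f x + h x) \<le> LpT_enorm p M f + LpT_enorm p M h"
proof -
  show le: "LpT_enorm p M (\<lambda>x. f x + h x) \<le> LpT_enorm p M f + LpT_enorm p M h"
    unfolding LpT_enorm_def[of p M "\<lambda>x. f x + h x"]
  proof (rule SUP_least)
    fix g assume g: "g \<in> {g \<in> Lp_space p M. Lp_enorm p M g \<le> 1}"
    have "haar_conv M g (\<lambda>x. f x + h x) = (\<lambda>x. haar_conv M g f x + haar_conv M g h x)"
      using g f h by (intro ext haar_conv_add_right Lp_integrable_conv[OF p]) (auto intro: LpT_Lp)
    then have "Lp_enorm p M (haar_conv M g (\<lambda>x. f x + h x))
        = Lp_enorm p M (\<lambda>x. haar_conv M g f x + haar_conv M g h x)" by simp
    also have "\<dots> \<le> Lp_enorm p M (haar_conv M g f) + Lp_enorm p M (haar_conv M g h)"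
      using p by (intro Lp_enorm_triangle) auto
    also have "\<dots> \<le> LpT_enorm p M f + LpT_enorm p M h"
      unfolding LpT_enorm_def using g by (intro add_mono SUP_upper) auto
    finally show "Lp_enorm p M (haar_conv M g (\<lambda>x. f x + h x)) \<le> LpT_enorm p M f + LpT_enorm p M h" .
  qed
  also have "\<dots> < \<infinity>" using LpT_finite[OF f] LpT_finite[OF h] by simp
  finally show "(\<lambda>x. f x + h x) \<in> LpT_space p M"
    using Lp_space_add[OF _ LpT_Lp[OF f] LpT_Lp[OF h]] p by (simp add: LpT_space_discrete[OF p])
qed

lemma LpT_cmult:
  assumes p: "1 < p" "p \<le> 2" and f: "f \<in> LpT_space p M"
  shows "(\<lambda>x. a * f x) \<in> LpT_space p M" "LpT_enorm p M (\<lambda>x. a * f x) = ennreal (cmod a) * LpT_enorm p M f"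
proof -
  have "Lp_enorm p M (haar_conv M g (\<lambda>x. a * f x)) = ennreal (cmod a) * Lp_enorm p M (haar_conv M g f)" for g
    unfolding haar_conv_cmult_right using p by (simp add: Lp_enorm_cmult)
  then show eq: "LpT_enorm p M (\<lambda>x. a * f x) = ennreal (cmod a) * LpT_enorm p M f"
    unfolding LpT_enorm_def by (simp add: SUP_mult_left_ennreal)
  show "(\<lambda>x. a * f x) \<in> LpT_space p M"
    using Lp_space_cmult[OF _ LpT_Lp[OF f]] LpT_finite[OF f] p
    by (simp add: LpT_space_discrete[OF p] eq ennreal_mult_less_top)
qed

lemma LpT_zero:
  assumes p: "1 < p" "p \<le> 2"
  shows "(\<lambda>_. 0) \<in> LpT_space p M" "LpT_enorm p M (\<lambda>_. 0) = 0"
proof -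
  have z: "haar_conv M g (\<lambda>_. 0) = (\<lambda>_. 0)" for g by (rule ext) (simp add: haar_conv_def)
  have "LpT_enorm p M (\<lambda>_. 0) \<le> 0" unfolding LpT_enorm_def by (intro SUP_least) (simp add: z Lp_enorm_zero)
  then show e: "LpT_enorm p M (\<lambda>_. 0) = 0" by simp
  show "(\<lambda>_. 0) \<in> LpT_space p M"
    unfolding LpT_space_discrete[OF p] by (simp add: e Lp_space_def Lp_enorm_zero)
qed

lemma LpT_diff:
  assumes p: "1 < p" "p \<le> 2" and f: "f \<in> LpT_space p M" and h: "h \<in> LpT_space p M"
  shows "(\<lambda>x. f x - h x) \<in> LpT_space p M"
  using LpT_add(1)[OF p f LpT_cmult(1)[OF p h, of "-1"]] by simp

lemma haar_conv_diff_left: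
  assumes p: "1 < p" "p \<le> 2" and "f \<in> Lp_space p M" "g \<in> Lp_space p M" "h \<in> Lp_space p M"
  shows "haar_conv M (\<lambda>x. f x - g x) h = (\<lambda>x. haar_conv M f h x - haar_conv M g h x)"
  using Lp_integrable_conv[OF p assms(3,5)] Lp_integrable_conv[OF p assms(4,5)]
  by (auto simp: haar_conv_def left_diff_distrib)

lemma truncation_Lp_tendsto:
  assumes p: "1 < p" and f: "f \<in> Lp_space p M"
    and F: "\<And>y. \<forall>\<^sub>F n in sequentially. f y \<noteq> 0 \<longrightarrow> y \<in> F n" and e: "0 < e"
  shows "\<forall>\<^sub>F n in sequentially. Lp_enorm p M (\<lambda>y. indicator (F n) y * f y - f y) \<le> ennreal e"
proof -
  have "(\<lambda>n. \<integral>\<^sup>+ y. ennreal (norm (indicator (F n) y * f y - f y) powr p) \<partial>M) \<longlonglongrightarrow> (\<integral>\<^sup>+ y. 0 \<partial>M)"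
  proof (rule nn_integral_dominated_convergence)
    show "(\<integral>\<^sup>+ y. ennreal (norm (f y) powr p) \<partial>M) < \<infinity>"
      using Lp_space_finite[OF f] by (simp only: Lp_enorm_finite_iff)
    show "AE y in M. ennreal (norm (indicator (F n) y * f y - f y) powr p) \<le> ennreal (norm (f y) powr p)" for n
      using p by (intro AE_I2) (auto split: split_indicator)
    show "AE y in M. (\<lambda>n. ennreal (norm (indicator (F n) y * f y - f y) powr p)) \<longlonglongrightarrow> 0"
    proof (intro AE_I2 tendsto_eventually)
      fix y
      show "\<forall>\<^sub>F n in sequentially. ennreal (norm (indicator (F n) y * f y - f y) powr p) = 0"
        using F[of y] by eventually_elim (use p in \<open>auto split: split_indicator\<close>)
    qed
  qed simp_all
  then have "\<forall>\<^sub>F n in sequentially. (\<integral>\<^sup>+ y. ennreal (norm (indicator (F n) y * f y - f y) powr p) \<partial>M) < ennreal (e powr p)"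
    using e by (intro order_tendstoD(2)[where y=0]) auto
  then show ?thesis
    using e p by (auto elim!: eventually_mono simp: Lp_enorm_le_iff)
qed

text \<open>Truncate \<open>f\<close>. On one side the convolutions converge pointwise by
  domination. On the other side they converge in \<open>L\<^sup>p\<close>, since \<open>h\<close>
  and \<open>w\<close> act as bounded operators, and therefore at each point.\<close>

lemma haar_conv_assoc:
  assumes p: "1 < p" "p \<le> 2" and f: "f \<in> LpT_space p M" and h: "h \<in> LpT_space p M" and w: "w \<in> LpT_space p M"
  shows "haar_conv M (haar_conv M f h) w = haar_conv M f (haar_conv M h w)"
proof
  fix x
  note Lp = LpT_Lp[OF f] LpT_Lp[OF h] LpT_Lp[OF w]
  obtain F :: "nat \<Rightarrow> 'a set" where F: "\<And>n. finite (F n)"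
    "\<And>y. \<forall>\<^sub>F n in sequentially. f y \<noteq> 0 \<longrightarrow> y \<in> F n"
    using finite_support_approx[OF Lp(1)] by blast
  define f' where "f' n y = indicator (F n) y * f y" for n y
  have f': "f' n \<in> Lp_space p M" for n
  proof (rule Lp_spaceI)
    have "Lp_enorm p M (f' n) \<le> Lp_enorm p M f"
      using p unfolding f'_def by (intro Lp_enorm_mono_AE AE_I2) (auto split: split_indicator)
    then show "Lp_enorm p M (f' n) < \<infinity>" using Lp_space_finite[OF Lp(1)] by (rule le_less_trans)
  qed simp
  have fin: "finite {y. f' n y \<noteq> 0}" for n
    by (rule finite_subset[OF _ F(1)[of n]]) (auto simp: f'_def split: split_indicator_asm)
  obtain B where B: "0 \<le> B" "LpT_enorm p M h = ennreal B" using LpT_finite[OF h] by (cases "LpT_enorm p M h") auto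
  obtain C where C: "0 \<le> C" "LpT_enorm p M w = ennreal C" using LpT_finite[OF w] by (cases "LpT_enorm p M w") auto
  have "(\<lambda>n. haar_conv M (f' n) (haar_conv M h w) x) \<longlonglongrightarrow> haar_conv M f (haar_conv M h w) x"
    unfolding f'_def using p Lp F LpT_conv_Lp[OF p(1) Lp(2) w] by (intro truncation_conv_tendsto)
  then have 1: "(\<lambda>n. haar_conv M (haar_conv M (f' n) h) w x) \<longlonglongrightarrow> haar_conv M f (haar_conv M h w) x"
    by (simp only: haar_conv_assoc_finite_support[OF p fin Lp(2,3)])
  have 2: "(\<lambda>n. haar_conv M (haar_conv M (f' n) h) w x) \<longlonglongrightarrow> haar_conv M (haar_conv M f h) w x"
  proof (rule tendstoI)
    fix e :: real assume e: "0 < e"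
    define \<kappa> where "\<kappa> = cell powr (1 / p)"
    have \<kappa>: "0 < \<kappa>" using cell_pos by (simp add: \<kappa>_def)
    \<comment> \<open>\<open>C * B\<close> may be 0, hence the added 1; the final error is
      \<open>C * B * \<delta> / \<kappa>\<close>.\<close>
    define \<delta> where "\<delta> = e * \<kappa> / (C * B + 1)"
    have CB: "0 \<le> C * B" using B C by simp
    then have \<delta>: "0 < \<delta>" using e \<kappa> by (simp add: \<delta>_def add_nonneg_pos)
    have small: "C * B * \<delta> / \<kappa> < e"
    proof -
      have "C * B * \<delta> / \<kappa> = e * (C * B / (C * B + 1))" using \<kappa> by (simp add: \<delta>_def)
      also have "\<dots> < e * 1" using e CB by (intro mult_strict_left_mono) (auto simp: divide_less_eq)
      finally show ?thesis by simp
    qed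
    have "\<forall>\<^sub>F n in sequentially. Lp_enorm p M (\<lambda>y. f' n y - f y) \<le> ennreal \<delta>"
      unfolding f'_def by (rule truncation_Lp_tendsto[OF p(1) Lp(1) F(2) \<delta>])
    then show "\<forall>\<^sub>F n in sequentially.
        dist (haar_conv M (haar_conv M (f' n) h) w x) (haar_conv M (haar_conv M f h) w x) < e"
    proof eventually_elim
      case (elim n)
      have d: "(\<lambda>y. f' n y - f y) \<in> Lp_space p M"
        using elim by (intro Lp_spaceI) (auto intro: le_less_trans)
      define v where "v = haar_conv M (haar_conv M (\<lambda>y. f' n y - f y) h) w"
      have v: "v = (\<lambda>x. haar_conv M (haar_conv M (f' n) h) w x - haar_conv M (haar_conv M f h) w x)"
        unfolding v_def haar_conv_diff_left[OF p f' Lp(1) Lp(2)]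
        by (rule haar_conv_diff_left[OF p LpT_conv_Lp[OF p(1) f' h] LpT_conv_Lp[OF p(1) Lp(1) h] Lp(3)])
      have "Lp_enorm p M v \<le> LpT_enorm p M w * Lp_enorm p M (haar_conv M (\<lambda>y. f' n y - f y) h)"
        unfolding v_def by (intro LpT_conv_le LpT_conv_Lp p d h)
      also have "\<dots> \<le> LpT_enorm p M w * (LpT_enorm p M h * Lp_enorm p M (\<lambda>y. f' n y - f y))"
        by (intro mult_left_mono LpT_conv_le p d) simp
      also have "\<dots> \<le> LpT_enorm p M w * (LpT_enorm p M h * ennreal \<delta>)"
        using elim by (intro mult_left_mono) auto
      also have "\<dots> = ennreal (C * B * \<delta>)"
        using B C \<delta> by (simp add: ennreal_mult mult.assoc)
      finally have "norm (v x) \<le> C * B * \<delta> / \<kappa>"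
        unfolding \<kappa>_def using p CB \<delta> by (intro Lp_point_bound) auto
      then show ?case using small by (simp add: v dist_norm)
    qed
  qed
  show "haar_conv M (haar_conv M f h) w x = haar_conv M f (haar_conv M h w) x"
    using LIMSEQ_unique[OF 2 1] .
qed

section \<open>Completeness and the Banach algebra axioms\<close>

lemma LpT_norm_point_bound:
  assumes p: "1 < p"
  obtains \<kappa> where "0 < \<kappa>" "\<And>f. f \<in> LpT_space p M \<Longrightarrow> Lp_enorm p M f \<le> ennreal (\<kappa> * LpT_norm p M f)"
    "\<And>f x. f \<in> LpT_space p M \<Longrightarrow> norm (f x) \<le> \<kappa> / cell powr (1 / p) * LpT_norm p M f"
proof -
  obtain K where K: "0 < K" "\<And>f. f \<in> LpT_space p M \<Longrightarrow> Lp_enorm p M f \<le> ennreal K * LpT_enorm p M f"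
    using discrete_Lp_norm_le[OF p] by blast
  have 1: "Lp_enorm p M f \<le> ennreal (K * LpT_norm p M f)" if "f \<in> LpT_space p M" for f
    using K(2)[OF that] LpT_finite[OF that] K(1) by (simp add: LpT_norm_def ennreal_mult less_top)
  have "norm (f x) \<le> K / cell powr (1 / p) * LpT_norm p M f" if "f \<in> LpT_space p M" for f x
    using Lp_point_bound[OF _ 1[OF that], of x] p K(1) by (simp add: LpT_norm_def)
  with K(1) 1 show thesis by (rule that)
qed

text \<open>The operator norm bounds point values, so a Cauchy sequence has a pointwise limit
  \<open>u\<close>. Fatou's lemma then bounds \<open>s n - u\<close> first in
  \<open>L\<^sup>p\<close> and then in the operator norm.\<close>

lemma LpT_complete:
  assumes p: "1 < p" "p \<le> 2" and s: "\<And>n. s n \<in> LpT_space p M"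
    and cauchy: "\<forall>e>0. \<exists>N. \<forall>m\<ge>N. \<forall>n\<ge>N. LpT_norm p M (\<lambda>x. s m x - s n x) < e"
  obtains u where "u \<in> LpT_space p M" "(\<lambda>n. LpT_norm p M (\<lambda>x. s n x - u x)) \<longlonglongrightarrow> 0"
proof -
  obtain \<kappa> where \<kappa>: "0 < \<kappa>" "\<And>f. f \<in> LpT_space p M \<Longrightarrow> Lp_enorm p M f \<le> ennreal (\<kappa> * LpT_norm p M f)"
    "\<And>f x. f \<in> LpT_space p M \<Longrightarrow> norm (f x) \<le> \<kappa> / cell powr (1 / p) * LpT_norm p M f"
    using LpT_norm_point_bound[OF p(1)] by metis
  have "Cauchy (\<lambda>n. s n x)" for x
  proof (rule CauchyI)
    fix e :: real assume "0 < e"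
    then have "0 < e / (\<kappa> / cell powr (1 / p))" using \<kappa>(1) cell_pos by simp
    then obtain N where N: "\<And>m n. N \<le> m \<Longrightarrow> N \<le> n \<Longrightarrow>
        LpT_norm p M (\<lambda>x. s m x - s n x) < e / (\<kappa> / cell powr (1 / p))"
      using cauchy by metis
    have "norm (s m x - s n x) < e" if "N \<le> m" "N \<le> n" for m n
    proof -
      have "norm (s m x - s n x) \<le> \<kappa> / cell powr (1 / p) * LpT_norm p M (\<lambda>x. s m x - s n x)"
        using \<kappa>(3)[OF LpT_diff[OF p s s]] .
      also have "\<dots> < e" using N[OF that] \<kappa>(1) cell_pos by (simp add: field_simps)
      finally show ?thesis .
    qed
    then show "\<exists>N. \<forall>m\<ge>N. \<forall>n\<ge>N. norm (s m x - s n x) < e" by blast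
  qed
  then have "convergent (\<lambda>n. s n x)" for x by (simp add: Cauchy_convergent_iff)
  then obtain u where u: "\<And>x. (\<lambda>n. s n x) \<longlonglongrightarrow> u x" unfolding convergent_def by metis
  have key: "\<exists>N. \<forall>n\<ge>N. (\<lambda>x. s n x - u x) \<in> LpT_space p M \<and> LpT_enorm p M (\<lambda>x. s n x - u x) \<le> ennreal e"
    if e: "0 < e" for e
  proof -
    obtain N where N: "\<And>m n. N \<le> m \<Longrightarrow> N \<le> n \<Longrightarrow> LpT_norm p M (\<lambda>x. s m x - s n x) < e"
      using cauchy e by metis
    have "(\<lambda>x. s n x - u x) \<in> LpT_space p M \<and> LpT_enorm p M (\<lambda>x. s n x - u x) \<le> ennreal e" if n: "N \<le> n" for n
    proof -
      have small: "LpT_enorm p M (\<lambda>x. s n x - s m x) \<le> ennreal e" if "N \<le> m" for m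
        using N[OF n that] LpT_finite[OF LpT_diff[OF p s s], of n m]
        by (cases "LpT_enorm p M (\<lambda>x. s n x - s m x)") (auto simp: LpT_norm_def intro!: ennreal_leI)
      have "Lp_enorm p M (\<lambda>x. s n x - u x) \<le> ennreal (\<kappa> * e)"
      proof (rule Lp_enorm_Fatou)
        show "AE x in M. (\<lambda>m. s n x - s m x) \<longlonglongrightarrow> s n x - u x" by (intro AE_I2 tendsto_intros u)
        have "Lp_enorm p M (\<lambda>x. s n x - s m x) \<le> ennreal (\<kappa> * e)" if "N \<le> m" for m
        proof -
          have "Lp_enorm p M (\<lambda>x. s n x - s m x) \<le> ennreal (\<kappa> * LpT_norm p M (\<lambda>x. s n x - s m x))"
            by (rule \<kappa>(2)[OF LpT_diff[OF p s s]])
          also have "\<dots> \<le> ennreal (\<kappa> * e)"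
            using N[OF n that] \<kappa>(1) by (intro ennreal_leI mult_left_mono) auto
          finally show ?thesis .
        qed
        then show "\<forall>\<^sub>F m in sequentially. Lp_enorm p M (\<lambda>x. s n x - s m x) \<le> ennreal (\<kappa> * e)"
          by (rule eventually_sequentiallyI)
      qed (use p \<kappa>(1) e in auto)
      then have Lp: "(\<lambda>x. s n x - u x) \<in> Lp_space p M"
        by (intro Lp_spaceI) (auto intro: le_less_trans)
      \<comment> \<open>For finitely supported \<open>g\<close> the convolution is a finite sum, so
        pointwise convergence of \<open>s m\<close> is enough.\<close>
      have fs: "Lp_enorm p M (haar_conv M g (\<lambda>x. s n x - u x)) \<le> ennreal e"
        if g: "finite {y. g y \<noteq> 0}" "g \<in> Lp_space p M" "Lp_enorm p M g \<le> 1" for g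
      proof (rule Lp_enorm_Fatou)
        show "AE x in M. (\<lambda>m. haar_conv M g (\<lambda>x. s n x - s m x) x) \<longlonglongrightarrow> haar_conv M g (\<lambda>x. s n x - u x) x"
          using haar_conv_finite_support[OF g(1), of g] by (intro AE_I2) (auto intro!: tendsto_intros u)
        have "Lp_enorm p M (haar_conv M g (\<lambda>x. s n x - s m x)) \<le> ennreal e" if "N \<le> m" for m
        proof -
          have "Lp_enorm p M (haar_conv M g (\<lambda>x. s n x - s m x)) \<le> LpT_enorm p M (\<lambda>x. s n x - s m x)"
            unfolding LpT_enorm_def using g by (intro SUP_upper) auto
          then show ?thesis using small[OF that] by (rule order_trans)
        qed
        then show "\<forall>\<^sub>F m in sequentially. Lp_enorm p M (haar_conv M g (\<lambda>x. s n x - s m x)) \<le> ennreal e"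
          by (rule eventually_sequentiallyI)
      qed (use p e in auto)
      show ?thesis using LpT_enorm_leI[OF p Lp _ fs] e by simp
    qed
    then show ?thesis by blast
  qed
  obtain n where n: "(\<lambda>x. s n x - u x) \<in> LpT_space p M" using key[of 1] by auto
  \<comment> \<open>\<open>u\<close> is the difference of \<open>s n\<close> and
    \<open>s n - u\<close>.\<close>
  have "u \<in> LpT_space p M" using LpT_diff[OF p s n, of n] by simp
  moreover have "(\<lambda>n. LpT_norm p M (\<lambda>x. s n x - u x)) \<longlonglongrightarrow> 0"
  proof (rule LIMSEQ_I)
    fix r :: real assume "0 < r"
    then obtain N where N: "\<forall>n\<ge>N. LpT_enorm p M (\<lambda>x. s n x - u x) \<le> ennreal (r / 2)"
      using key[of "r / 2"] by auto
    have "norm (LpT_norm p M (\<lambda>x. s n x - u x) - 0) < r" if "N \<le> n" for n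
    proof -
      have "LpT_norm p M (\<lambda>x. s n x - u x) \<le> r / 2"
        using N that \<open>0 < r\<close> unfolding LpT_norm_def by (intro enn2real_leI) auto
      then show ?thesis using \<open>0 < r\<close> by (simp add: LpT_norm_def)
    qed
    then show "\<exists>no. \<forall>n\<ge>no. norm (LpT_norm p M (\<lambda>x. s n x - u x) - 0) < r" by blast
  qed
  ultimately show thesis by (rule that)
qed

lemma discrete_imp_banach_algebra:
  assumes p: "1 < p" "p \<le> 2"
  shows "LpT_banach_algebra p M"
proof -
  obtain \<kappa> where \<kappa>: "0 < \<kappa>" "\<And>f. f \<in> LpT_space p M \<Longrightarrow> Lp_enorm p M f \<le> ennreal (\<kappa> * LpT_norm p M f)"
    "\<And>f x. f \<in> LpT_space p M \<Longrightarrow> norm (f x) \<le> \<kappa> / cell powr (1 / p) * LpT_norm p M f"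
    using LpT_norm_point_bound[OF p(1)] by metis
  \<comment> \<open>Definiteness: point values are bounded by a multiple of the norm.\<close>
  have zero: "LpT_norm p M f = 0 \<longleftrightarrow> f = (\<lambda>_. 0)" if "f \<in> LpT_space p M" for f
    using \<kappa>(3)[OF that] LpT_zero(2)[OF p] by (auto simp: LpT_norm_def)
  show ?thesis
    unfolding LpT_banach_algebra_def ae_class_discrete
  \<comment> \<open>All classes are singletons. The cases follow the axioms: 4 closure under
    products, 13 associativity, 14 and 15 distributivity, 20 homogeneity, 21 the triangle
    inequality, 22 submultiplicativity, 23 completeness.\<close>
  proof (rule complex_banach_algebra.intro, goal_cases)
    case (4 U V)
    then show ?case using LpT_mult(1)[OF p] by (auto simp: ae_rep_singleton)
  next
    case (13 U V W)
    then show ?case using haar_conv_assoc[OF p] by (auto simp: ae_rep_singleton)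
  next
    case (14 U V W)
    then obtain u v w where "u \<in> LpT_space p M" "v \<in> LpT_space p M" "w \<in> LpT_space p M"
      "U = {u}" "V = {v}" "W = {w}" by auto
    then show ?case
      by (auto simp: ae_rep_singleton haar_conv_def distrib_right fun_eq_iff
        Lp_integrable_conv[OF p] LpT_Lp intro!: Bochner_Integration.integral_add)
  next
    case (15 U V W)
    then obtain u v w where "u \<in> LpT_space p M" "v \<in> LpT_space p M" "w \<in> LpT_space p M"
      "U = {u}" "V = {v}" "W = {w}" by auto
    then show ?case
      by (auto simp: ae_rep_singleton fun_eq_iff haar_conv_add_right Lp_integrable_conv[OF p] LpT_Lp)
  next
    case (20 U a)
    then show ?case using LpT_cmult(2)[OF p] by (auto simp: ae_rep_singleton LpT_norm_def enn2real_mult)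
  next
    case (21 U V)
    then obtain u v where uv: "u \<in> LpT_space p M" "v \<in> LpT_space p M" "U = {u}" "V = {v}" by auto
    then have "enn2real (LpT_enorm p M (\<lambda>x. u x + v x)) \<le> enn2real (LpT_enorm p M u + LpT_enorm p M v)"
      using LpT_finite[OF uv(1)] LpT_finite[OF uv(2)] by (intro enn2real_mono LpT_add[OF p]) auto
    then show ?case
      using uv LpT_finite[OF uv(1)] LpT_finite[OF uv(2)] by (simp add: ae_rep_singleton LpT_norm_def enn2real_plus)
  next
    case (22 U V)
    then obtain u v where uv: "u \<in> LpT_space p M" "v \<in> LpT_space p M" "U = {u}" "V = {v}" by auto
    then have "enn2real (LpT_enorm p M (haar_conv M u v)) \<le> enn2real (LpT_enorm p M u * LpT_enorm p M v)"
      using LpT_finite[OF uv(1)] LpT_finite[OF uv(2)]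
      by (intro enn2real_mono LpT_mult[OF p]) (auto simp: ennreal_mult_less_top)
    then show ?case using uv by (simp add: ae_rep_singleton LpT_norm_def enn2real_mult)
  next
    case (23 S)
    define s where "s n = ae_rep (S n)" for n
    have s: "s n \<in> LpT_space p M" "S n = {s n}" for n
    proof -
      have "S n \<in> (\<lambda>f. {f}) ` LpT_space p M" using 23(1) by blast
      then obtain v where "v \<in> LpT_space p M" "S n = {v}" by blast
      then show "s n \<in> LpT_space p M" "S n = {s n}" by (simp_all add: s_def ae_rep_singleton)
    qed
    have diff: "ae_rep {\<lambda>x. ae_rep (S m) x + ae_rep {\<lambda>x. - 1 * ae_rep (S n) x} x} = (\<lambda>x. s m x - s n x)"
      for m n unfolding ae_rep_singleton s_def by simp
    have "\<forall>e>0. \<exists>N. \<forall>m\<ge>N. \<forall>n\<ge>N. LpT_norm p M (\<lambda>x. s m x - s n x) < e"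
      using 23(2) unfolding diff .
    then obtain u where u: "u \<in> LpT_space p M" "(\<lambda>n. LpT_norm p M (\<lambda>x. s n x - u x)) \<longlonglongrightarrow> 0"
      by (rule LpT_complete[of p s, OF p s(1)])
    have "ae_rep {\<lambda>x. ae_rep (S n) x + ae_rep {\<lambda>x. - 1 * ae_rep {u} x} x} = (\<lambda>x. s n x - u x)" for n
      unfolding ae_rep_singleton s_def by simp
    then show ?case using u by (intro bexI[of _ "{u}"]) auto
  qed (use LpT_zero[OF p] LpT_add[OF p] LpT_cmult[OF p] zero in
    \<open>auto simp: ae_rep_singleton algebra_simps LpT_norm_def haar_conv_cmult_left haar_conv_cmult_right\<close>)
qed

end

theorem theorem2p5:
  fixes M :: "'a::{topological_group_add, t2_space} measure" and p :: real
  assumes "locally_compact_space (euclidean :: 'a topology)"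
    and "left_haar_measure M"
    and "1 < p"
  shows
    "let A1 = LpT_banach_algebra p M;
         A2 = (\<exists>K>0. \<forall>f\<in>LpT_space p M. LpT_norm3 p M f \<le> K * LpT_norm p M f);
         A3 = equivalent_norms_on (LpT_space p M) (LpT_norm p M) (LpT_norm3 p M);
         A4 = (\<exists>K>0. \<forall>f\<in>LpT_space p M. Lp_norm p M f \<le> K * LpT_norm p M f);
         A5 = ((euclidean :: 'a topology) = discrete_topology UNIV)
     in (A5 \<longrightarrow> A4) \<and> (A4 \<longrightarrow> A3) \<and> (A3 \<longrightarrow> A2) \<and>
        (unimodular M \<and> p \<le> 2 \<longrightarrow>
           (A1 \<longleftrightarrow> A2) \<and> (A2 \<longleftrightarrow> A3) \<and> (A3 \<longleftrightarrow> A4) \<and> (A4 \<longleftrightarrow> A5))"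
proof -
  define A1 A2 A3 A4 A5 where "A1 = LpT_banach_algebra p M"
    and "A2 = (\<exists>K>0. \<forall>f\<in>LpT_space p M. LpT_norm3 p M f \<le> K * LpT_norm p M f)"
    and "A3 = equivalent_norms_on (LpT_space p M) (LpT_norm p M) (LpT_norm3 p M)"
    and "A4 = (\<exists>K>0. \<forall>f\<in>LpT_space p M. Lp_norm p M f \<le> K * LpT_norm p M f)"
    and "A5 = ((euclidean :: 'a topology) = discrete_topology UNIV)"
  note defs = A1_def A2_def A3_def A4_def A5_def
  interpret haar_group M by unfold_locales (fact assms)+
  have nn: "0 \<le> LpT_norm p M f" "0 \<le> Lp_norm p M f" for f by (simp_all add: LpT_norm_def Lp_norm_def)
  have 54: "A4" if A5
  proof -
    interpret discrete_haar_group M by unfold_locales (use that A5_def in simp)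
    obtain K where K: "0 < K" "\<And>f. f \<in> LpT_space p M \<Longrightarrow> Lp_enorm p M f \<le> ennreal K * LpT_enorm p M f"
      using discrete_Lp_norm_le[OF assms(3)] by blast
    have "Lp_norm p M f \<le> K * LpT_norm p M f" if f: "f \<in> LpT_space p M" for f
    proof -
      have "LpT_enorm p M f < \<infinity>" using f by (simp add: LpT_space_def)
      then have "Lp_enorm p M f \<le> ennreal (K * LpT_norm p M f)"
        using K(2)[OF f] K(1) by (simp add: LpT_norm_def ennreal_mult less_top)
      then show ?thesis using K(1) nn unfolding Lp_norm_def by (intro enn2real_leI) auto
    qed
    then show ?thesis using K(1) by (auto simp: A4_def)
  qed
  have 43: "A3" if a4: A4
  proof -
    obtain K where K: "0 < K" "\<And>f. f \<in> LpT_space p M \<Longrightarrow> Lp_norm p M f \<le> K * LpT_norm p M f"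
      using a4 by (auto simp: A4_def)
    \<comment> \<open>The constants are 1 from below and \<open>K + 1\<close> from above.\<close>
    show ?thesis
      unfolding A3_def equivalent_norms_on_def
      by (rule exI[of _ 1], intro conjI exI[of _ "K + 1"] ballI)
        (use K nn in \<open>auto simp: LpT_norm3_def distrib_right\<close>)
  qed
  have 32: "A2" if A3 using that by (auto simp: A2_def A3_def equivalent_norms_on_def)
  \<comment> \<open>The \<open>L\<^sup>p\<close> norm is one of the two summands of
    \<open>LpT_norm3\<close>.\<close>
  have 24: "A4" if a2: A2
  proof -
    obtain K where K: "0 < K" "\<And>f. f \<in> LpT_space p M \<Longrightarrow> LpT_norm3 p M f \<le> K * LpT_norm p M f"
      using a2 by (auto simp: A2_def)
    have "Lp_norm p M f \<le> K * LpT_norm p M f" if "f \<in> LpT_space p M" for f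
      using K(2)[OF that] nn(1)[of f] by (simp add: LpT_norm3_def)
    then show ?thesis using K(1) by (auto simp: A4_def)
  qed
  \<comment> \<open>A2, A3 and A4 already imply each other and follow from A5. The implication from
    A4 to A5 and the equivalence of A1 and A5 complete the picture.\<close>
  have uni: "(A4 \<longrightarrow> A5) \<and> (A1 \<longrightarrow> A5) \<and> (A5 \<longrightarrow> A1)" if u: "unimodular M" "p \<le> 2"
  proof -
    interpret unimodular_haar_group M by unfold_locales (fact u)
    have "A4 \<longrightarrow> A5"
      using not_discrete_Lp_norm_unbounded[OF _ assms(3)] unfolding A4_def A5_def by (meson not_le)
    moreover have "A1 \<longrightarrow> A5" using banach_algebra_imp_discrete[OF assms(3)] by (simp add: A1_def A5_def)
    moreover have "A1" if A5
    proof -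
      interpret discrete_unimodular_haar_group M by unfold_locales (use that A5_def in simp)
      show ?thesis unfolding A1_def by (rule discrete_imp_banach_algebra[OF assms(3) u(2)])
    qed
    ultimately show ?thesis by blast
  qed
  have "(A5 \<longrightarrow> A4) \<and> (A4 \<longrightarrow> A3) \<and> (A3 \<longrightarrow> A2) \<and>
      (unimodular M \<and> p \<le> 2 \<longrightarrow> (A1 \<longleftrightarrow> A2) \<and> (A2 \<longleftrightarrow> A3) \<and> (A3 \<longleftrightarrow> A4) \<and> (A4 \<longleftrightarrow> A5))"
    using 54 43 32 24 uni by blast
  then show ?thesis unfolding Let_def defs .
qed

end
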